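(* Let $d\ge2$, let $\Omega\subset\mathbf{R}^d$ be a bounded open $C^{1,1}$ set, and let $\phi,L,V,f,\varphi,\psi,\delta_\Omega,\eta_0,\Omega_\eta$ be as in the context. Let $U:\mathbf{R}^d\to[0,\infty)$ be given by $U(x)=\psi(V(\delta_\Omega(x)))$ for $x\in\Omega$ and $U=0$ on $\Omega^c$. Assume that for some $R>0$ there exists a constant $C_1>0$ such that for every $r\ge R$ $$\int_r^\infty \frac{dt}{\sqrt{\phi^{-1}(\varphi(t)^{-2})}}\le C_1\,\frac{r}{\sqrt{\phi^{-1}(\varphi(r)^{-2})}}.$$ Then there exist constants $\eta_1\in(0,\eta_0)$ and $C_2>0$ such that $$LU(x)\le C_2\, f(U(x)),\qquad x\in\Omega_{\eta_1}.$$
   Context: **Operator.** $\phi:[0,\infty)\to[0,\infty)$ is a complete Bernstein function with zero drift, i.e. $\phi(\lambda)=\int_0^\infty(1-e^{-\lambda s})\nu(s)\,ds$ with $\nu$ a completely monotone Lévy density, satisfying the scaling condition: there are $a_1,a_2>0$ and $0<\delta_1\le\delta_2<1$ with $a_1\lambda^{\delta_1}\le \phi(\lambda t)/\phi(t)\le a_2\lambda^{\delta_2}$ for all $\lambda\ge1$, $t\ge1$. $\phi^{-1}$ is the inverse function of $\phi$. $L=-\phi(-\Delta)$ acts pointwise as $Lu(x)=\mathrm{P.V.}\int_{\mathbf{R}^d}(u(y)-u(x))\,j(|y-x|)\,dy$, where $j(r)=\int_0^\infty(4\pi s)^{-d/2}e^{-r^2/(4s)}\nu(s)\,ds$. **Renewal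 function.** $V(t)=\int_0^\infty\mathbf{P}(H_s\le t)\,ds$, where $H$ is the ascending ladder height process of the one-dimensional subordinate Brownian motion with characteristic exponent $\phi(\theta^2)$, $\theta\in\mathbf{R}$. Equivalently, $\int_{[0,\infty)}e^{-\xi t}\,dV(t)=1/\kappa(\xi)$, $\kappa(\xi)=\exp\big(\frac1\pi\int_0^\infty\frac{\log\phi(\xi^2\theta^2)}{1+\theta^2}d\theta\big)$, $\xi>0$. $V$ is continuous and strictly increasing on $[0,\infty)$ with $V(0)=0$, $V(\infty)=\infty$. **Nonlinearity.** $f:\mathbf{R}\to[0,\infty)$ is an increasing (non-strict sense) $C^1$ function with $f(0)=0$ and $(1+m)f(t)\le tf'(t)\le(1+M)f(t)$, $t\in\mathbf{R}$, for some constants $0<m\le M$. $F(t)=\int_0^tf(s)\,ds$, with $F(t)>0$ for $t>0$. $\varphi(t)=\int_t^\infty\frac{ds}{\sqrt{F(s)}}$, $t>0$, is a decreasing bijection of $(0,\infty)$, and $\psi$ is its inverse function. **Geometry.** $\delta_\Omega(x)=\mathrm{dist}(x,\partial\Omega)$; $\Omega_\eta=\{x\in\Omega:\delta_\Omega(x)<\eta\}$; $\eta_0>0$ is a fixed number such that $\delta_\Omega\in C^{1,1}(\Omega_{\eta_0})$ (it exists because $\Omega$ is a bounded $C^{1,1}$ set). *)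

theory Defs
  imports "HOL-Analysis.Analysis"
begin

section \<open>The operator\<close>

definition completely_monotone :: "(real \<Rightarrow> real) \<Rightarrow> bool" where
  "completely_monotone \<nu> \<longleftrightarrow>
     (\<forall>n. \<forall>s>0. (deriv ^^ n) \<nu> differentiable (at s) \<and> (- 1) ^ n * (deriv ^^ n) \<nu> s \<ge> 0)"

definition levy_density :: "(real \<Rightarrow> real) \<Rightarrow> bool" where
  "levy_density \<nu> \<longleftrightarrow>
     (\<forall>s>0. \<nu> s \<ge> 0) \<and> set_integrable lborel {0<..} (\<lambda>s. min 1 s * \<nu> s)"

text \<open>Complete Bernstein functions with neither drift nor killing; only the values
  of \<open>\<phi>\<close> on \<open>[0, \<infinity>)\<close> and of \<open>\<nu>\<close> on \<open>(0, \<infinity>)\<close> matter.\<close>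

definition complete_bernstein :: "(real \<Rightarrow> real) \<Rightarrow> (real \<Rightarrow> real) \<Rightarrow> bool" where
  "complete_bernstein \<phi> \<nu> \<longleftrightarrow>
     completely_monotone \<nu> \<and> levy_density \<nu> \<and>
     (\<forall>x\<ge>0. \<phi> x = (LBINT s:{0<..}. (1 - exp (- x * s)) * \<nu> s))"

definition scaling_condition :: "(real \<Rightarrow> real) \<Rightarrow> bool" where
  "scaling_condition \<phi> \<longleftrightarrow>
     (\<exists>a1 a2 \<delta>1 \<delta>2. a1 > 0 \<and> a2 > 0 \<and> 0 < \<delta>1 \<and> \<delta>1 \<le> \<delta>2 \<and> \<delta>2 < 1 \<and>
        (\<forall>c\<ge>1. \<forall>t\<ge>1. a1 * c powr \<delta>1 \<le> \<phi> (c * t) / \<phi> t \<and>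
                        \<phi> (c * t) / \<phi> t \<le> a2 * c powr \<delta>2))"

definition phi_inv :: "(real \<Rightarrow> real) \<Rightarrow> real \<Rightarrow> real" where
  "phi_inv \<phi> = the_inv_into {0..} \<phi>"

definition jump_kernel :: "nat \<Rightarrow> (real \<Rightarrow> real) \<Rightarrow> real \<Rightarrow> real" where
  "jump_kernel d \<nu> r =
     (LBINT s:{0<..}. (4 * pi * s) powr (- real d / 2) * exp (- (r\<^sup>2) / (4 * s)) * \<nu> s)"

definition L_integrand :: "(real \<Rightarrow> real) \<Rightarrow> (real ^ 'n \<Rightarrow> real) \<Rightarrow> real ^ 'n \<Rightarrow> real ^ 'n \<Rightarrow> real" where
  "L_integrand \<nu> u x y = (u y - u x) * jump_kernel CARD('n) \<nu> (norm (y - x))"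

definition L_truncated :: "(real \<Rightarrow> real) \<Rightarrow> (real ^ 'n \<Rightarrow> real) \<Rightarrow> real ^ 'n \<Rightarrow> real \<Rightarrow> real" where
  "L_truncated \<nu> u x \<epsilon> = (LINT y:{y. norm (y - x) > \<epsilon>}|lborel. L_integrand \<nu> u x y)"

definition L_op :: "(real \<Rightarrow> real) \<Rightarrow> (real ^ 'n \<Rightarrow> real) \<Rightarrow> real ^ 'n \<Rightarrow> real" where
  "L_op \<nu> u x = Lim (at_right 0) (L_truncated \<nu> u x)"

text \<open>Bochner integrals and limits are total in HOL, so a bound on \<open>L_op \<nu> u x\<close> says nothing
  unless the principal value exists. The following predicate expresses that it does, as a
  finite limit of absolutely convergent integrals.\<close>

definition L_defined_at :: "(real \<Rightarrow> real) \<Rightarrow> (real ^ 'n \<Rightarrow> real) \<Rightarrow> real ^ 'n \<Rightarrow> bool" where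
  "L_defined_at \<nu> u x \<longleftrightarrow>
     (\<forall>\<epsilon>>0. set_integrable lborel {y. norm (y - x) > \<epsilon>} (L_integrand \<nu> u x)) \<and>
     (\<exists>l. (L_truncated \<nu> u x \<longlongrightarrow> l) (at_right 0))"


section \<open>The renewal function\<close>

text \<open>Laplace exponent of the ascending ladder height process of the one-dimensional
  subordinate Brownian motion with characteristic exponent \<open>\<theta> \<mapsto> \<phi> (\<theta>\<^sup>2)\<close>.\<close>

definition ladder_exponent :: "(real \<Rightarrow> real) \<Rightarrow> real \<Rightarrow> real" where
  "ladder_exponent \<phi> \<xi> =
     exp (1 / pi * (LBINT \<theta>:{0<..}. ln (\<phi> (\<xi>\<^sup>2 * \<theta>\<^sup>2)) / (1 + \<theta>\<^sup>2)))"

text \<open>The ladder height process \<open>H\<close> enters only through its renewal function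
  \<open>V t = (\<integral>s\<in>{0..}. P (H s \<le> t))\<close>, which is identified here by the Laplace--Stieltjes transform
  of \<open>dV\<close>; by uniqueness of Laplace transforms this determines \<open>V\<close>. It is extended by \<open>0\<close> to
  \<open>(-\<infinity>, 0)\<close> so that \<open>interval_measure V\<close> is the Stieltjes measure \<open>dV\<close>. The regularity clauses
  are known properties of the renewal function and exclude no \<open>\<phi>\<close> satisfying the scaling
  condition.\<close>

definition renewal_function :: "(real \<Rightarrow> real) \<Rightarrow> (real \<Rightarrow> real) \<Rightarrow> bool" where
  "renewal_function \<phi> V \<longleftrightarrow>
     (\<forall>t\<le>0. V t = 0) \<and> continuous_on {0..} V \<and> strict_mono_on {0..} V \<and>
     filterlim V at_top at_top \<and>
     (\<forall>\<xi>>0. (LINT t:{0..}|interval_measure V. exp (- \<xi> * t)) = 1 / ladder_exponent \<phi> \<xi>)"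


section \<open>The nonlinearity\<close>

definition nonlinearity :: "(real \<Rightarrow> real) \<Rightarrow> bool" where
  "nonlinearity f \<longleftrightarrow>
     (\<forall>t. f t \<ge> 0) \<and> mono f \<and> f C1_differentiable_on UNIV \<and> f 0 = 0 \<and>
     (\<exists>m M. 0 < m \<and> m \<le> M \<and>
        (\<forall>t. (1 + m) * f t \<le> t * deriv f t \<and> t * deriv f t \<le> (1 + M) * f t))"

definition primitive :: "(real \<Rightarrow> real) \<Rightarrow> real \<Rightarrow> real" where
  "primitive f t = (LBINT s=0..t. f s)"

definition varphi :: "(real \<Rightarrow> real) \<Rightarrow> real \<Rightarrow> real" where
  "varphi f t = (LBINT s:{t<..}. 1 / sqrt (primitive f s))"

definition psi :: "(real \<Rightarrow> real) \<Rightarrow> real \<Rightarrow> real" where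
  "psi f = the_inv_into {0<..} (varphi f)"


section \<open>Geometry\<close>

text \<open>A function of the first \<open>d - 1\<close> coordinates of an orthonormal system whose last axis is the
  unit vector \<open>e\<close> is represented by a function \<open>\<Gamma>\<close> on the whole space that is constant along \<open>e\<close>;
  its gradient on the whole space is then that of the original function.\<close>

definition C11_graph :: "real \<Rightarrow> real ^ 'n \<Rightarrow> (real ^ 'n \<Rightarrow> real) \<Rightarrow> bool" where
  "C11_graph \<Lambda> e \<Gamma> \<longleftrightarrow>
     (\<forall>v c. \<Gamma> (v + c *\<^sub>R e) = \<Gamma> v) \<and> \<Gamma> 0 = 0 \<and>
     (\<exists>G. (\<forall>v. GDERIV \<Gamma> v :> G v) \<and> G 0 = 0 \<and> (\<forall>v. norm (G v) \<le> \<Lambda>) \<and> \<Lambda>-lipschitz_on UNIV G)"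

definition C11_set :: "(real ^ 'n) set \<Rightarrow> bool" where
  "C11_set \<Omega> \<longleftrightarrow> open \<Omega> \<and>
     (\<exists>\<rho>>0. \<exists>\<Lambda>>0. \<forall>z\<in>frontier \<Omega>. \<exists>e \<Gamma>. norm e = 1 \<and> C11_graph \<Lambda> e \<Gamma> \<and>
        \<Omega> \<inter> ball z \<rho> = {y \<in> ball z \<rho>. (y - z) \<bullet> e > \<Gamma> (y - z)})"

definition bdist :: "(real ^ 'n) set \<Rightarrow> real ^ 'n \<Rightarrow> real" where
  "bdist \<Omega> x = infdist x (frontier \<Omega>)"

definition collar :: "(real ^ 'n) set \<Rightarrow> real \<Rightarrow> (real ^ 'n) set" where
  "collar \<Omega> \<eta> = {x \<in> \<Omega>. bdist \<Omega> x < \<eta>}"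

definition C11_on :: "(real ^ 'n) set \<Rightarrow> (real ^ 'n \<Rightarrow> real) \<Rightarrow> bool" where
  "C11_on S u \<longleftrightarrow> (\<exists>G \<Lambda>. (\<forall>x\<in>S. GDERIV u x :> G x) \<and> \<Lambda>-lipschitz_on S G)"

definition U_fun ::
  "(real \<Rightarrow> real) \<Rightarrow> (real \<Rightarrow> real) \<Rightarrow> (real ^ 'n) set \<Rightarrow> real ^ 'n \<Rightarrow> real" where
  "U_fun f V \<Omega> x = (if x \<in> \<Omega> then psi f (V (bdist \<Omega> x)) else 0)"

end

theory Submission imports Defs begin

text \<open>Write \<open>u = psi f \<circ> V\<close>, so that \<open>U = u \<circ> \<delta>\<close> inside the set, where \<open>\<delta>\<close> is the distance to the
  boundary. At a point with \<open>\<delta> = t\<close> the natural scale of the operator is \<open>\<phi> (1 / t\<^sup>2)\<close>, and the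
  proof shows that \<open>L U \<le> C * u t * \<phi> (1 / t\<^sup>2) \<le> C' * f (u t)\<close>.

  The second inequality holds by the choice of the profile. Since \<open>psi' = - sqrt (F psi)\<close> and
  \<open>varphi f r\<close> is comparable with \<open>r / sqrt (F r)\<close> (\<open>varphi_le\<close>, \<open>varphi_ge\<close>), the relation
  \<open>varphi f (u t) = V t\<close> says that \<open>F (u t)\<close> is comparable with \<open>(u t / V t)\<^sup>2\<close>; the growth
  condition gives \<open>f r \<ge> 2 * F r / r\<close>, and \<open>V t\<close> is comparable with \<open>1 / sqrt (\<phi> (1 / t\<^sup>2))\<close> by
  \<open>V_comparable\<close>. This is \<open>f_lower\<close>.

  For the first inequality the integral defining \<open>L U\<close> is split at distance \<open>t / 3\<close>. Far from the
  point only the positive part of \<open>U y - U x\<close> matters. By the layer-cake formula it is an integral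
  over levels \<open>r > u t\<close> of the kernel mass of \<open>{U > r}\<close>, which is the collar of width \<open>\<tau>\<close>, where
  \<open>u \<tau> = r\<close>. A collar of width \<open>\<tau>\<close> meets a ball of radius \<open>\<rho>\<close> in volume \<open>O (\<tau> * \<rho> ^ (d - 1))\<close>
  (\<open>collar_volume\<close>), and the kernel at distance \<open>\<rho>\<close> is at most a multiple of \<open>\<phi> (1 / \<rho>\<^sup>2) / \<rho> ^ d\<close>
  (\<open>jump_kernel_le\<close>), so the mass is at most a multiple of \<open>\<phi> (1 / t\<^sup>2) * \<tau> / t\<close>. As \<open>\<tau>\<close> is
  comparable with \<open>1 / sqrt (phi_inv \<phi> (1 / (varphi f r)\<^sup>2))\<close> (\<open>inverse_profile_comparable\<close>),
  integrating over \<open>r\<close> is exactly what the integral hypothesis controls (\<open>far_estimate\<close>).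

  Near the point the gradient term of \<open>U\<close> is odd and cancels in the principal value, and what is
  left is of size \<open>(u t / t) * \<bar>z\<bar> * (\<bar>z\<bar> / t) powr b\<close> provided that \<open>u'\<close> is Hoelder continuous
  with exponent \<open>b\<close> on the scale \<open>t\<close> (\<open>near_expansion\<close>). The kernel integrates \<open>\<bar>z\<bar> powr (1 + b)\<close>
  as soon as \<open>1 + b > 2 * \<delta>2\<close>, for which \<open>b = \<delta>2\<close> will do.

  What remains is the Hoelder regularity of \<open>V'\<close>, for all exponents below one. Let \<open>\<kappa>\<close> be the
  ladder exponent. Twice differentiating the integral for \<open>log \<kappa>\<close> under the integral sign exhibits
  \<open>- (log \<kappa>)''\<close> as the Laplace transform of \<open>x * w x\<close> for an explicit function \<open>w\<close> that is bounded
  and Lipschitz continuous as a function of \<open>ln x\<close> (\<open>ladder_weight\<close>), and \<open>(log \<kappa>)'\<close> is then the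
  Laplace transform of \<open>w\<close> itself. Since \<open>dV\<close> has the transform \<open>1 / \<kappa>\<close>, the measure \<open>t dV\<close> has
  the transform \<open>(log \<kappa>)' / \<kappa>\<close>, so that \<open>t dV = (w * dV) dt\<close> by uniqueness (\<open>dV_conv\<close>). The
  convolution is continuous; hence \<open>V' = (w * dV) / t\<close> exists, is at most a multiple of \<open>V t / t\<close>,
  and inherits from \<open>w\<close> every Hoelder exponent below one (\<open>v_hoelder\<close>). Taking Laplace transforms
  at \<open>1 / t\<close> also gives the size of \<open>V\<close>.\<close>

section \<open>Differentiation under the integral sign\<close>

text \<open>Difference quotients are dominated by \<open>G\<close> through the mean value theorem, so that dominated
  convergence applies along sequences.\<close>

lemma has_real_derivative_integral:
  fixes f f' :: "real \<Rightarrow> 'a \<Rightarrow> real"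
  assumes x: "x \<in> {a<..<b}"
    and int: "\<And>x. x \<in> {a<..<b} \<Longrightarrow> integrable M (f x)"
    and der: "\<And>x y. x \<in> {a<..<b} \<Longrightarrow> y \<in> space M \<Longrightarrow> ((\<lambda>x. f x y) has_real_derivative f' x y) (at x)"
    and le: "\<And>x y. x \<in> {a<..<b} \<Longrightarrow> y \<in> space M \<Longrightarrow> \<bar>f' x y\<bar> \<le> G y"
    and G: "integrable M G"
  shows "((\<lambda>x. \<integral>y. f x y \<partial>M) has_real_derivative (\<integral>y. f' x y \<partial>M)) (at x)"
    and "integrable M (f' x)"
proof -
  have mf: "f x \<in> borel_measurable M" if "x \<in> {a<..<b}" for x
    using int[OF that] by auto
  have lip: "\<bar>(f z y - f x y) / (z - x)\<bar> \<le> G y"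
    if z: "z \<in> {a<..<b}" "z \<noteq> x" and y: "y \<in> space M" for z y
  proof -
    have "norm (f z y - f x y) \<le> G y * norm (z - x)"
    proof (rule field_differentiable_bound[where S="{a<..<b}" and f'="\<lambda>z. f' z y"])
      show "((\<lambda>x. f x y) has_field_derivative f' z y) (at z within {a<..<b})" if "z \<in> {a<..<b}" for z
        using der[OF that y] by (rule has_field_derivative_at_within)
    qed (use x z le y in auto)
    then show ?thesis using z by (simp add: field_simps abs_mult)
  qed
  have seq: "(\<lambda>i. \<integral>y. (f (X i) y - f x y) / (X i - x) \<partial>M) \<longlonglongrightarrow> (\<integral>y. f' x y \<partial>M)
     \<and> integrable M (f' x)"
    if X: "\<And>i. X i \<in> {a<..<b}" "\<And>i. X i \<noteq> x" "X \<longlonglongrightarrow> x" for X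
  proof -
    have lim: "(\<lambda>i. (f (X i) y - f x y) / (X i - x)) \<longlonglongrightarrow> f' x y" if "y \<in> space M" for y
      using der[OF x that] X unfolding DERIV_def has_field_derivative_iff tendsto_at_iff_sequentially
      by (auto simp: comp_def)
    have m: "(\<lambda>y. (f (X i) y - f x y) / (X i - x)) \<in> borel_measurable M" for i
      using mf[OF X(1)] mf[OF x] by auto
    have m': "f' x \<in> borel_measurable M"
      using borel_measurable_LIMSEQ_real[OF lim m] by auto
    have ae: "AE y in M. (\<lambda>i. (f (X i) y - f x y) / (X i - x)) \<longlonglongrightarrow> f' x y"
      using lim by auto
    have bd: "AE y in M. norm ((f (X i) y - f x y) / (X i - x)) \<le> G y" for i
      using lip[OF X(1) X(2)] by auto
    show ?thesis
      using integral_dominated_convergence[OF m' m G ae bd] integrable_dominated_convergence[OF m' m G ae bd]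
      by auto
  qed
  have open_ab: "\<forall>\<^sub>F z in at x. z \<in> {a<..<b}"
    using x by (intro eventually_at_topological[THEN iffD2]) (auto intro!: exI[of _ "{a<..<b}"])
  have "((\<lambda>z. \<integral>y. (f z y - f x y) / (z - x) \<partial>M) \<longlongrightarrow> (\<integral>y. f' x y \<partial>M)) (at x within {a<..<b})"
    unfolding tendsto_at_iff_sequentially comp_def
  proof (intro allI impI)
    fix X assume "\<forall>i. X i \<in> {a<..<b} - {x}" "X \<longlonglongrightarrow> x"
    then show "(\<lambda>i. \<integral>y. (f (X i) y - f x y) / (X i - x) \<partial>M) \<longlonglongrightarrow> (\<integral>y. f' x y \<partial>M)"
      using conjunct1[OF seq, of X] by blast
  qed
  then have "((\<lambda>z. \<integral>y. (f z y - f x y) / (z - x) \<partial>M) \<longlongrightarrow> (\<integral>y. f' x y \<partial>M)) (at x)"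
    unfolding at_within_open[OF x open_greaterThanLessThan] .
  moreover have "(\<integral>y. (f z y - f x y) / (z - x) \<partial>M)
       = ((\<integral>y. f z y \<partial>M) - (\<integral>y. f x y \<partial>M)) / (z - x)" if "z \<in> {a<..<b}" for z
    using Bochner_Integration.integral_diff[OF int[OF that] int[OF x]] by simp
  then have "\<forall>\<^sub>F z in at x. (\<integral>y. (f z y - f x y) / (z - x) \<partial>M)
       = ((\<integral>y. f z y \<partial>M) - (\<integral>y. f x y \<partial>M)) / (z - x)"
    by (rule eventually_mono[OF open_ab])
  ultimately show "((\<lambda>x. \<integral>y. f x y \<partial>M) has_real_derivative (\<integral>y. f' x y \<partial>M)) (at x)"
    unfolding has_field_derivative_iff by (rule Lim_transform_eventually)
  \<comment> \<open>Integrability of the derivative comes from dominated convergence along any one sequence.\<close>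
  define X where "X i = x + (b - x) / real (i + 2)" for i
  have "X i \<in> {a<..<b}" "X i \<noteq> x" for i
  proof -
    have "(b - x) * 1 < (b - x) * real (i + 2)"
      using x by (intro mult_strict_left_mono) auto
    then have "0 < (b - x) / real (i + 2)" "(b - x) / real (i + 2) < b - x"
      using x by (auto simp: divide_less_eq)
    then show "X i \<in> {a<..<b}" "X i \<noteq> x" using x unfolding X_def by (auto simp del: of_nat_add)
  qed
  moreover have "X \<longlonglongrightarrow> x"
  proof -
    have "(\<lambda>i. x + (b - x) * (1 / real (i + 2))) \<longlonglongrightarrow> x + (b - x) * 0"
      by (intro tendsto_intros LIMSEQ_ignore_initial_segment[OF lim_1_over_n])
    then show ?thesis by (simp add: X_def[abs_def])
  qed
  ultimately show "integrable M (f' x)" using seq by blast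
qed

text \<open>The domination may fail outside \<open>A\<close>, so the statement on \<open>M\<close> is applied to functions cut off
  by the indicator.\<close>

lemma has_real_derivative_set_integral:
  fixes f f' :: "real \<Rightarrow> 'a \<Rightarrow> real"
  assumes x: "x \<in> {a<..<b}"
    and int: "\<And>x. x \<in> {a<..<b} \<Longrightarrow> set_integrable M A (f x)"
    and der: "\<And>x y. x \<in> {a<..<b} \<Longrightarrow> y \<in> A \<Longrightarrow> ((\<lambda>x. f x y) has_real_derivative f' x y) (at x)"
    and le: "\<And>x y. x \<in> {a<..<b} \<Longrightarrow> y \<in> A \<Longrightarrow> \<bar>f' x y\<bar> \<le> G y"
    and G: "set_integrable M A G"
  shows "((\<lambda>x. LINT y:A|M. f x y) has_real_derivative (LINT y:A|M. f' x y)) (at x)"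
    and "set_integrable M A (f' x)"
  unfolding set_lebesgue_integral_def set_integrable_def
proof -
  show "((\<lambda>x. LINT y|M. indicat_real A y *\<^sub>R f x y) has_real_derivative (LINT y|M. indicat_real A y *\<^sub>R f' x y)) (at x)"
    "integrable M (\<lambda>y. indicat_real A y *\<^sub>R f' x y)"
    using assms unfolding set_integrable_def
    by (intro has_real_derivative_integral[where a=a and b=b and G="\<lambda>y. indicat_real A y *\<^sub>R G y"
      and f="\<lambda>x y. indicat_real A y *\<^sub>R f x y" and f'="\<lambda>x y. indicat_real A y *\<^sub>R f' x y"];
      auto simp: indicator_def split: if_splits)+
qed

lemma power_exp_minus_le:
  fixes x :: real assumes "x \<ge> 0" shows "x ^ k * exp (- x) \<le> fact k"
proof -
  have "(\<Sum>i\<in>{k}. x ^ i /\<^sub>R fact i) \<le> exp x"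
    using sum_le_suminf[OF sums_summable[OF exp_converges[of x]], of "{k}"]
      sums_unique[OF exp_converges[of x]] assms by simp
  then show ?thesis by (simp add: exp_minus field_simps)
qed

section \<open>Bernstein functions\<close>

locale levy_exponent =
  fixes \<phi> \<nu> :: "real \<Rightarrow> real"
  assumes levy: "levy_density \<nu>"
    and phi_eq: "\<And>x. 0 \<le> x \<Longrightarrow> \<phi> x = (LBINT s:{0<..}. (1 - exp (- x * s)) * \<nu> s)"
    and phi_1_pos: "0 < \<phi> 1"
begin

lemma nu_nonneg: "0 < s \<Longrightarrow> 0 \<le> \<nu> s"
  using levy by (auto simp: levy_density_def)

lemma nu_measurable: "(\<lambda>s. indicator {0<..} s * \<nu> s) \<in> borel_measurable borel"
proof -
  have "(\<lambda>s. indicator {0<..} s *\<^sub>R (min 1 s * \<nu> s)) \<in> borel_measurable borel"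
    using levy borel_measurable_integrable[of lborel "\<lambda>s. indicator {0<..} s *\<^sub>R (min 1 s * \<nu> s)"]
    by (auto simp: levy_density_def set_integrable_def)
  then have "(\<lambda>s. (indicator {0<..} s *\<^sub>R (min 1 s * \<nu> s)) / min 1 s) \<in> borel_measurable borel"
    by (rule borel_measurable_divide) auto
  also have "(\<lambda>s. (indicator {0<..} s *\<^sub>R (min 1 s * \<nu> s)) / min 1 s) = (\<lambda>s. indicator {0<..} s * \<nu> s)"
    by (auto simp: indicator_def fun_eq_iff)
  finally show ?thesis .
qed

text \<open>The test functions that a Levy measure integrates are those of order \<open>s\<close> at \<open>0\<close> and bounded
  at infinity; all integrals against \<open>\<nu>\<close> below are justified by this domination.\<close>

lemma nu_integrable:
  assumes h: "h \<in> borel_measurable borel" and le: "\<And>s. 0 < s \<Longrightarrow> \<bar>h s\<bar> \<le> C * min 1 s"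
  shows "set_integrable lborel {0<..} (\<lambda>s. h s * \<nu> s)"
proof -
  have "set_integrable lborel {0<..} (\<lambda>s. C * (min 1 s * \<nu> s))"
    using levy by (auto simp: levy_density_def)
  then show ?thesis
  proof (rule set_integrable_bound)
    have "(\<lambda>s. h s * (indicator {0<..} s * \<nu> s)) \<in> borel_measurable borel"
      using h nu_measurable by measurable
    then show "set_borel_measurable lborel {0<..} (\<lambda>s. h s * \<nu> s)"
      by (simp add: set_borel_measurable_def algebra_simps)
    show "AE s in lborel. s \<in> {0<..} \<longrightarrow> norm (h s * \<nu> s) \<le> norm (C * (min 1 s * \<nu> s))"
    proof (intro AE_I2 impI)
      fix s :: real assume s: "s \<in> {0<..}"
      have "\<bar>h s\<bar> * \<nu> s \<le> C * min 1 s * \<nu> s"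
        using le[of s] nu_nonneg[of s] s by (intro mult_right_mono) auto
      then show "norm (h s * \<nu> s) \<le> norm (C * (min 1 s * \<nu> s))"
        using nu_nonneg[of s] s abs_ge_self[of "C * (min 1 s * \<nu> s)"]
        unfolding real_norm_def abs_mult[of "h s"] by (simp add: mult.assoc)
    qed
  qed
qed

lemma one_minus_exp_le: "0 \<le> (x::real) \<Longrightarrow> 0 < s \<Longrightarrow> 1 - exp (- x * s) \<le> max 1 x * min 1 s"
proof -
  assume a: "0 \<le> x" "0 < s"
  have "1 - exp (- x * s) \<le> x * s" using exp_ge_add_one_self[of "- x * s"] by simp
  also have "\<dots> \<le> max 1 x * s" using a by (intro mult_right_mono) auto
  finally have 1: "1 - exp (- x * s) \<le> max 1 x * s" .
  have "0 < exp (- x * s)" "1 \<le> max 1 x" by auto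
  then have 2: "1 - exp (- x * s) \<le> max 1 x * 1" by linarith
  show ?thesis using 1 2 by (cases "s \<le> 1") (auto simp: min_def)
qed

lemma phi_integrable:
  assumes "0 \<le> x" shows "set_integrable lborel {0<..} (\<lambda>s. (1 - exp (- x * s)) * \<nu> s)"
  by (rule nu_integrable[where C="max 1 x"])
    (use assms one_minus_exp_le[OF assms] in auto)

lemma phi_mono: "0 \<le> x \<Longrightarrow> x \<le> y \<Longrightarrow> \<phi> x \<le> \<phi> y"
  by (simp add: phi_eq, rule set_integral_mono)
    (use phi_integrable[of x] phi_integrable[of y] nu_nonneg in \<open>auto intro!: mult_right_mono\<close>)

lemma phi_0: "\<phi> 0 = 0"
  by (simp add: phi_eq)

lemma phi_nonneg: "0 \<le> x \<Longrightarrow> 0 \<le> \<phi> x"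
  using phi_mono[of 0 x] phi_0 by auto

text \<open>Convexity of \<open>exp\<close> at the point \<open>- x\<close> between \<open>0\<close> and \<open>- (c * x)\<close>.\<close>

lemma one_minus_exp_mult_le:
  fixes c x :: real assumes "1 \<le> c" "0 \<le> x" shows "1 - exp (- (c * x)) \<le> c * (1 - exp (- x))"
proof -
  have "convex_on UNIV (exp :: real \<Rightarrow> real)"
    by (rule convex_on_realI[where f'=exp]) (auto intro!: derivative_eq_intros)
  from convex_onD[OF this, of "1 / c" 0 "- (c * x)"]
  have "exp ((1 - 1 / c) * 0 + 1 / c * (- (c * x))) \<le> (1 - 1 / c) * exp 0 + 1 / c * exp (- (c * x))"
    using assms by simp
  then have "c * exp (- x) \<le> c * ((1 - 1 / c) * exp 0 + 1 / c * exp (- (c * x)))"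
    using assms by (intro mult_left_mono) auto
  also have "\<dots> = c - 1 + exp (- (c * x))" using assms by (simp add: algebra_simps)
  finally show ?thesis by (simp add: algebra_simps)
qed

text \<open>The integrand is concave in \<open>x\<close> and vanishes at \<open>0\<close>. Together with monotonicity this
  confines \<open>ln (\<phi> (c * x)) - ln (\<phi> x)\<close> between \<open>0\<close> and \<open>ln c\<close>, which controls \<open>\<phi>\<close> near the origin
  as well, where the scaling condition says nothing.\<close>

lemma phi_mult_le:
  assumes "1 \<le> c" "0 \<le> x" shows "\<phi> (c * x) \<le> c * \<phi> x"
proof -
  have "\<phi> (c * x) = (LBINT s:{0<..}. (1 - exp (- (c * x) * s)) * \<nu> s)"
    using assms by (intro phi_eq) auto
  also have "\<dots> \<le> (LBINT s:{0<..}. c * ((1 - exp (- x * s)) * \<nu> s))"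
  proof (rule set_integral_mono)
    fix s :: real assume s: "s \<in> {0<..}"
    have "1 - exp (- (c * x) * s) \<le> c * (1 - exp (- x * s))"
      using one_minus_exp_mult_le[of c "x * s"] assms s by (simp add: mult.assoc)
    then show "(1 - exp (- (c * x) * s)) * \<nu> s \<le> c * ((1 - exp (- x * s)) * \<nu> s)"
      using mult_right_mono[of "1 - exp (- (c * x) * s)" "c * (1 - exp (- x * s))" "\<nu> s"] nu_nonneg[of s] s by (simp add: mult.assoc)
  qed (use phi_integrable[of "c*x"] phi_integrable[of x] assms in auto)
  also have "\<dots> = c * \<phi> x" using assms by (simp add: phi_eq)
  finally show ?thesis .
qed

lemma phi_pos: "0 < x \<Longrightarrow> 0 < \<phi> x"
proof (cases "1 \<le> x")
  case True then show ?thesis using phi_mono[of 1 x] phi_1_pos by auto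
next
  case False
  assume "0 < x"
  then have "\<phi> (1 / x * x) \<le> 1 / x * \<phi> x" using False by (intro phi_mult_le) auto
  then have "0 < 1 / x * \<phi> x" using phi_1_pos \<open>0 < x\<close> by simp
  then show ?thesis using \<open>0 < x\<close> by (simp add: zero_less_divide_iff)
qed

lemma abs_ln_phi_le:
  assumes "0 < x" "0 < c" shows "\<bar>ln (\<phi> (c * x)) - ln (\<phi> x)\<bar> \<le> \<bar>ln c\<bar>"
proof (cases "1 \<le> c")
  case True
  have "ln (\<phi> (c * x)) \<le> ln (c * \<phi> x)" "ln (\<phi> x) \<le> ln (\<phi> (c * x))"
    using phi_mult_le[of c x] phi_mono[of x "c * x"] phi_pos[of x] phi_pos[of "c * x"] True assms by (auto simp: ln_le_cancel_iff)
  moreover have "ln (c * \<phi> x) = ln c + ln (\<phi> x)" using True phi_pos[of x] assms by (simp add: ln_mult)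
  ultimately show ?thesis using True by auto
next
  case False
  have "ln (\<phi> x) \<le> ln (1 / c * \<phi> (c * x))" "ln (\<phi> (c * x)) \<le> ln (\<phi> x)"
    using phi_mult_le[of "1 / c" "c * x"] phi_mono[of "c * x" x] phi_pos[of x] phi_pos[of "c * x"] False assms 
    by (auto simp: mult_le_cancel_right1)
  moreover have "ln (1 / c * \<phi> (c * x)) = - ln c + ln (\<phi> (c * x))"
    using False phi_pos[of "c * x"] assms by (simp add: ln_mult ln_div)
  ultimately show ?thesis using False assms by auto
qed

text \<open>For \<open>k \<ge> 1\<close> this is \<open>(- 1) ^ (k - 1)\<close> times the \<open>k\<close>-th derivative of \<open>\<phi>\<close>.\<close>

definition moment :: "nat \<Rightarrow> real \<Rightarrow> real" where
  "moment k x = (LBINT s:{0<..}. s ^ k * exp (- x * s) * \<nu> s)"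

lemma power_exp_le_min:
  fixes x s :: real
  assumes "0 < x" "0 < s"
  shows "s ^ Suc k * exp (- x * s) \<le> (fact (Suc k) / x ^ Suc k + fact k / x ^ k) * min 1 s"
proof -
  have *: "s ^ j * exp (- x * s) \<le> fact j / x ^ j" for j
    using power_exp_minus_le[of "x * s" j] assms by (simp add: field_simps power_mult_distrib)
  have "s ^ Suc k * exp (- x * s) \<le> fact (Suc k) / x ^ Suc k + fact k / x ^ k"
    using *[of "Suc k"] assms by (smt (verit) fact_gt_zero divide_pos_pos zero_less_power)
  moreover have "s ^ Suc k * exp (- x * s) \<le> (fact (Suc k) / x ^ Suc k + fact k / x ^ k) * s"
  proof -
    have "s ^ Suc k * exp (- x * s) = s * (s ^ k * exp (- x * s))" by simp
    also have "\<dots> \<le> s * (fact (Suc k) / x ^ Suc k + fact k / x ^ k)"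
      using *[of k] assms by (intro mult_left_mono) (smt (verit) fact_gt_zero divide_pos_pos zero_less_power, simp)
    finally show ?thesis by (simp add: mult.commute)
  qed
  ultimately show ?thesis by (auto simp: min_def)
qed

lemma moment_integrable:
  assumes "0 < x" shows "set_integrable lborel {0<..} (\<lambda>s. s ^ Suc k * exp (- x * s) * \<nu> s)"
  by (rule nu_integrable[where C="fact (Suc k) / x ^ Suc k + fact k / x ^ k"])
    (use assms power_exp_le_min[of x] in auto)

lemma moment_nonneg: "0 < x \<Longrightarrow> 0 \<le> moment k x"
  unfolding moment_def set_lebesgue_integral_def
  by (intro Bochner_Integration.integral_nonneg) (auto simp: indicator_def nu_nonneg)

lemma phi_has_derivative:
  assumes "0 < x" shows "(\<phi> has_real_derivative moment 1 x) (at x)"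
proof -
  have "((\<lambda>x. LBINT s:{0<..}. (1 - exp (- x * s)) * \<nu> s) has_real_derivative
      (LBINT s:{0<..}. s ^ 1 * exp (- x * s) * \<nu> s)) (at x)"
  proof (rule has_real_derivative_set_integral(1)[where a="x/2" and b="2*x"
      and G="\<lambda>s. s ^ Suc 0 * exp (- (x / 2) * s) * \<nu> s"])
    fix y s :: real assume y: "y \<in> {x / 2<..<2 * x}" and s: "s \<in> {0<..}"
    show "((\<lambda>y. (1 - exp (- y * s)) * \<nu> s) has_real_derivative s ^ 1 * exp (- y * s) * \<nu> s) (at y)"
      by (auto intro!: derivative_eq_intros)
    show "\<bar>s ^ 1 * exp (- y * s) * \<nu> s\<bar> \<le> s ^ Suc 0 * exp (- (x / 2) * s) * \<nu> s"
      using y s nu_nonneg[of s] by (auto simp: abs_mult intro!: mult_right_mono mult_left_mono)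
  qed (use assms phi_integrable moment_integrable[of "x/2" 0] in auto)
  then have "(\<phi> has_real_derivative (LBINT s:{0<..}. s ^ 1 * exp (- x * s) * \<nu> s)) (at x)"
    by (rule has_field_derivative_transform_within_open[where S="{0<..}"]) (use assms phi_eq in auto)
  then show ?thesis by (simp add: moment_def)
qed

lemma moment_has_derivative:
  assumes "0 < x" shows "(moment (Suc k) has_real_derivative - moment (Suc (Suc k)) x) (at x)"
proof -
  have "((\<lambda>x. LBINT s:{0<..}. s ^ Suc k * exp (- x * s) * \<nu> s) has_real_derivative
      (LBINT s:{0<..}. - (s ^ Suc (Suc k) * exp (- x * s) * \<nu> s))) (at x)"
  proof (rule has_real_derivative_set_integral(1)[where a="x/2" and b="2*x"
      and G="\<lambda>s. s ^ Suc (Suc k) * exp (- (x / 2) * s) * \<nu> s"])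
    fix y s :: real assume y: "y \<in> {x / 2<..<2 * x}" and s: "s \<in> {0<..}"
    show "((\<lambda>y. s ^ Suc k * exp (- y * s) * \<nu> s) has_real_derivative
       - (s ^ Suc (Suc k) * exp (- y * s) * \<nu> s)) (at y)"
      by (auto intro!: derivative_eq_intros)
    show "\<bar>- (s ^ Suc (Suc k) * exp (- y * s) * \<nu> s)\<bar> \<le> s ^ Suc (Suc k) * exp (- (x / 2) * s) * \<nu> s"
      using y s nu_nonneg[of s] by (auto simp: abs_mult intro!: mult_right_mono mult_left_mono)
  qed (use assms moment_integrable[of _ k] moment_integrable[of "x/2" "Suc k"] in auto)
  then show ?thesis by (simp add: moment_def[abs_def] set_lebesgue_integral_def)
qed

text \<open>With \<open>y = x * s\<close> both integrands compare with \<open>y / (1 + y)\<close>: on the left because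
  \<open>y ^ j * exp (- y) \<le> fact j\<close> for \<open>j = k\<close> and \<open>j = k + 1\<close>, on the right because \<open>exp y \<ge> 1 + y\<close>.\<close>

lemma moment_le:
  assumes "0 < x" shows "x ^ Suc k * moment (Suc k) x \<le> (fact (Suc k) + fact k) * \<phi> x"
proof -
  have "x ^ Suc k * moment (Suc k) x = (LBINT s:{0<..}. x ^ Suc k * (s ^ Suc k * exp (- x * s) * \<nu> s))"
    by (simp add: moment_def)
  also have "\<dots> \<le> (LBINT s:{0<..}. (fact (Suc k) + fact k) * ((1 - exp (- x * s)) * \<nu> s))"
  proof (rule set_integral_mono)
    fix s :: real assume s: "s \<in> {0<..}"
    define y where "y = x * s"
    have y: "0 < y" using assms s by (auto simp: y_def)
    have "exp y \<ge> 1 + y" by simp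
    then have "exp (- y) \<le> 1 / (1 + y)" using y by (simp add: exp_minus field_simps)
    then have 1: "y / (1 + y) \<le> 1 - exp (- y)" using y by (simp add: field_simps)
    have "y ^ k * exp (- y) + y ^ Suc k * exp (- y) \<le> fact k + fact (Suc k)"
      using power_exp_minus_le[of y k] power_exp_minus_le[of y "Suc k"] y by linarith
    then have "y ^ k * exp (- y) * (1 + y) \<le> fact (Suc k) + fact k" by (simp add: algebra_simps)
    then have "y ^ k * exp (- y) \<le> (fact (Suc k) + fact k) / (1 + y)" using y by (simp add: field_simps)
    then have "y * (y ^ k * exp (- y)) \<le> y * ((fact (Suc k) + fact k) / (1 + y))"
      using y by (intro mult_left_mono) auto
    also have "\<dots> = (fact (Suc k) + fact k) * (y / (1 + y))" by simp
    also have "\<dots> \<le> (fact (Suc k) + fact k) * (1 - exp (- y))"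
      using 1 by (intro mult_left_mono) auto
    finally have "y ^ Suc k * exp (- y) * \<nu> s \<le> (fact (Suc k) + fact k) * (1 - exp (- y)) * \<nu> s"
      using nu_nonneg[of s] s by (intro mult_right_mono) (auto simp: mult.assoc)
    then show "x ^ Suc k * (s ^ Suc k * exp (- x * s) * \<nu> s) \<le> (fact (Suc k) + fact k) * ((1 - exp (- x * s)) * \<nu> s)"
      by (simp add: y_def power_mult_distrib mult_ac)
  qed (use phi_integrable[of x] moment_integrable[OF assms, of k] assms in auto)
  also have "\<dots> = (fact (Suc k) + fact k) * \<phi> x" using assms by (simp add: phi_eq)
  finally show ?thesis .
qed

end

section \<open>Integrals against the Cauchy density\<close>

text \<open>A form of the fundamental theorem on a half-line that needs limits of the antiderivative
  only and delivers integrability.\<close>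

lemma set_integrable_FTC_greaterThan:
  fixes f F :: "real \<Rightarrow> real"
  assumes F: "\<And>x. a < x \<Longrightarrow> (F has_real_derivative f x) (at x)"
    and f: "\<And>x. a < x \<Longrightarrow> isCont f x" "\<And>x. a < x \<Longrightarrow> 0 \<le> f x"
    and lim: "(F \<longlongrightarrow> l0) (at_right a)" "(F \<longlongrightarrow> l1) at_top"
  shows "set_integrable lborel {a<..} f" "(LBINT x:{a<..}. f x) = l1 - l0"
proof -
  have lims: "((F \<circ> real_of_ereal) \<longlongrightarrow> l0) (at_right (ereal a))" "((F \<circ> real_of_ereal) \<longlongrightarrow> l1) (at_left \<infinity>)"
    using lim by (simp_all add: ereal_tendsto_simps1)
  have "set_integrable lborel (einterval a \<infinity>) f \<and> (LBINT x=a..\<infinity>. f x) = l1 - l0"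
    using interval_integral_FTC_nonneg[of "ereal a" "\<infinity>" F f l0 l1] F f lims
    by auto
  moreover have "einterval (ereal a) \<infinity> = {a<..}" by (auto simp: einterval_def)
  ultimately show "set_integrable lborel {a<..} f" "(LBINT x:{a<..}. f x) = l1 - l0"
    by (auto simp: interval_lebesgue_integral_def)
qed

lemma inverse_one_plus_square:
  "set_integrable lborel {0<..} (\<lambda>x::real. 1 / (1 + x\<^sup>2))" "(LBINT x:{0<..}. 1 / (1 + x\<^sup>2)) = pi / 2"
proof -
  have p: "1 + x\<^sup>2 \<noteq> 0" for x :: real by (smt (verit) zero_le_power2)
  have "(arctan \<longlongrightarrow> arctan 0) (at_right 0)"
    by (intro tendsto_intros)
  then have 0: "(arctan \<longlongrightarrow> 0) (at_right 0)" by simp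
  note * = set_integrable_FTC_greaterThan[where F=arctan and f="\<lambda>x. 1 / (1 + x\<^sup>2)", OF _ _ _ 0 tendsto_arctan_at_top]
  show "set_integrable lborel {0<..} (\<lambda>x::real. 1 / (1 + x\<^sup>2))"
    by (rule *) (auto intro!: derivative_eq_intros continuous_intros simp: p inverse_eq_divide)
  show "(LBINT x:{0<..}. 1 / (1 + x\<^sup>2)) = pi / 2"
    using p by (subst *) (auto intro!: derivative_eq_intros continuous_intros simp: inverse_eq_divide)
qed

text \<open>The majorant is the derivative of \<open>8 * arctan (sqrt x)\<close>. The logarithm is compared with
  square roots by \<open>ln y \<le> y - 1\<close> at \<open>y = sqrt x\<close> and at \<open>y = 1 / sqrt x\<close>.\<close>

lemma abs_ln_le: "0 < x \<Longrightarrow> \<bar>ln x\<bar> / (1 + x\<^sup>2) \<le> 4 / (sqrt x * (1 + x))"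
proof -
  assume x: "0 < x"
  show ?thesis
  proof (cases "1 \<le> x")
    case True
    have "ln x = 2 * ln (sqrt x)" using x by (simp add: ln_sqrt)
    also have "\<dots> \<le> 2 * sqrt x" using ln_le_minus_one[of "sqrt x"] x by simp
    finally have 1: "\<bar>ln x\<bar> \<le> 2 * sqrt x" using True by simp
    have "0 \<le> (x - 1)\<^sup>2 + x\<^sup>2 + 3" by auto
    then have "2 * x * (1 + x) \<le> 4 * (1 + x\<^sup>2)" by (simp add: power2_eq_square algebra_simps)
    moreover have "2 * sqrt x * (sqrt x * (1 + x)) = 2 * x * (1 + x)"
      using x by simp
    ultimately have *: "2 * sqrt x * (sqrt x * (1 + x)) \<le> 4 * (1 + x\<^sup>2)" by (simp only:)
    have "2 * sqrt x \<le> 4 * (1 + x\<^sup>2) / (sqrt x * (1 + x))"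
      using x by (intro mult_imp_le_div_pos *) auto
    then have "2 * sqrt x / (1 + x\<^sup>2) \<le> 4 / (sqrt x * (1 + x))"
      by (intro mult_imp_div_pos_le) (auto simp: add_pos_nonneg)
    then show ?thesis using 1 by (meson divide_right_mono order_trans add_nonneg_nonneg zero_le_one zero_le_power2)
  next
    case False
    have "- ln x = 2 * ln (1 / sqrt x)" using x by (simp add: ln_sqrt ln_div)
    also have "\<dots> \<le> 2 * (1 / sqrt x)" using ln_le_minus_one[of "1 / sqrt x"] x by simp
    finally have 1: "\<bar>ln x\<bar> \<le> 2 / sqrt x" using False x by simp
    have "2 / sqrt x / (1 + x\<^sup>2) \<le> 4 / (sqrt x * (1 + x))"
    proof -
      have "2 * (1 + x) \<le> 4 * (1 + x\<^sup>2)" using False x by (smt (verit) zero_le_power2)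
      then have "2 / (1 + x\<^sup>2) \<le> 4 / (1 + x)" using x by (simp add: divide_le_eq le_divide_eq add_pos_pos mult_ac)
      then have "1 / sqrt x * (2 / (1 + x\<^sup>2)) \<le> 1 / sqrt x * (4 / (1 + x))"
        using x by (intro mult_left_mono) auto
      then show ?thesis by (simp add: mult_ac)
    qed
    then show ?thesis using 1 by (meson divide_right_mono order_trans add_nonneg_nonneg zero_le_one zero_le_power2)
  qed
qed

lemma abs_ln_integrable: "set_integrable lborel {0<..} (\<lambda>x::real. \<bar>ln x\<bar> / (1 + x\<^sup>2))"
proof -
  have l0: "((\<lambda>x. 2 * arctan (sqrt x)) \<longlongrightarrow> 2 * arctan (sqrt 0)) (at_right 0)"
    by (intro tendsto_intros)
  have l1: "((\<lambda>x. 2 * arctan (sqrt x)) \<longlongrightarrow> 2 * (pi / 2)) at_top"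
    by (intro tendsto_intros filterlim_compose[OF tendsto_arctan_at_top] sqrt_at_top)
  have "set_integrable lborel {0<..} (\<lambda>x::real. 1 / (sqrt x * (1 + x)))"
  proof (rule set_integrable_FTC_greaterThan(1)[OF _ _ _ l0 l1])
    fix x :: real assume x: "0 < x"
    have "((\<lambda>x. 2 * arctan (sqrt x)) has_real_derivative
        2 * (inverse (1 + (sqrt x)\<^sup>2) * (inverse (sqrt x) / 2))) (at x)"
      using x by (intro DERIV_cmult DERIV_chain2[OF DERIV_arctan] DERIV_real_sqrt)
    also have "2 * (inverse (1 + (sqrt x)\<^sup>2) * (inverse (sqrt x) / 2)) = 1 / (sqrt x * (1 + x))"
      using x by (simp add: inverse_eq_divide)
    finally show "((\<lambda>x. 2 * arctan (sqrt x)) has_real_derivative 1 / (sqrt x * (1 + x))) (at x)" .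
    show "isCont (\<lambda>x. 1 / (sqrt x * (1 + x))) x" "0 \<le> 1 / (sqrt x * (1 + x))"
      using x by (auto intro!: continuous_intros)
  qed
  then have "set_integrable lborel {0<..} (\<lambda>x::real. 4 * (1 / (sqrt x * (1 + x))))"
    by (rule set_integrable_mult_right)
  then show ?thesis
  proof (rule set_integrable_bound)
    show "set_borel_measurable lborel {0<..} (\<lambda>x::real. \<bar>ln x\<bar> / (1 + x\<^sup>2))"
      by (simp add: set_borel_measurable_def)
    show "AE x in lborel. x \<in> {0<..} \<longrightarrow> norm (\<bar>ln x\<bar> / (1 + x\<^sup>2)) \<le> norm (4 * (1 / (sqrt x * (1 + x))))"
      using abs_ln_le by (intro AE_I2) auto
  qed
qed

section \<open>Logarithmic derivatives of the exponent\<close>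

context levy_exponent begin

text \<open>The derivatives of \<open>\<phi>\<close> relative to \<open>\<phi>\<close> itself, made invariant under scaling. They are
  bounded by absolute constants, which is why the ladder weight and the growth of \<open>V\<close> are
  controlled by absolute constants as well.\<close>

definition rel_moment :: "nat \<Rightarrow> real \<Rightarrow> real" where
  "rel_moment k x = x ^ k * moment k x / \<phi> x"

lemma rel_moment_nonneg: "0 < x \<Longrightarrow> 0 \<le> rel_moment k x"
  using moment_nonneg[of x k] phi_pos[of x] by (simp add: rel_moment_def)

lemma rel_moment_le: "0 < x \<Longrightarrow> rel_moment (Suc k) x \<le> fact (Suc k) + fact k"
  using moment_le[of x k] phi_pos[of x] by (simp add: rel_moment_def field_simps)

lemma rel_moment_has_derivative:
  assumes x: "0 < x"
  shows "(rel_moment (Suc k) has_real_derivative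
     (real (Suc k) * rel_moment (Suc k) x - rel_moment (Suc (Suc k)) x - rel_moment 1 x * rel_moment (Suc k) x) / x) (at x)"
proof -
  have p: "\<phi> x \<noteq> 0" using phi_pos[OF x] by simp
  have "((\<lambda>x. x ^ Suc k * moment (Suc k) x / \<phi> x) has_real_derivative
     ((real (Suc k) * x ^ k * moment (Suc k) x + x ^ Suc k * (- moment (Suc (Suc k)) x)) * \<phi> x
        - x ^ Suc k * moment (Suc k) x * moment 1 x) / (\<phi> x * \<phi> x)) (at x)"
    by (rule derivative_eq_intros phi_has_derivative moment_has_derivative x refl p)+
      (simp add: algebra_simps)
  also have "((real (Suc k) * x ^ k * moment (Suc k) x + x ^ Suc k * (- moment (Suc (Suc k)) x)) * \<phi> x
        - x ^ Suc k * moment (Suc k) x * moment 1 x) / (\<phi> x * \<phi> x)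
     = (real (Suc k) * rel_moment (Suc k) x - rel_moment (Suc (Suc k)) x - rel_moment 1 x * rel_moment (Suc k) x) / x"
    using x p by (simp add: rel_moment_def divide_simps) (simp add: algebra_simps)
  finally show ?thesis by (simp add: rel_moment_def[abs_def])
qed

text \<open>This is \<open>- \<theta>\<^sup>2\<close> times the second derivative of \<open>\<theta> \<mapsto> ln (\<phi> (\<theta>\<^sup>2))\<close>, as a function of
  \<open>x = \<theta>\<^sup>2\<close>.\<close>

definition curvature :: "real \<Rightarrow> real" where
  "curvature x = 4 * (rel_moment 1 x)\<^sup>2 - 2 * rel_moment 1 x + 4 * rel_moment 2 x"

lemma curvature_bound:
  assumes "0 < x" shows "\<bar>curvature x\<bar> \<le> 32"
proof -
  define p q where "p = rel_moment 1 x" and "q = rel_moment 2 x"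
  have a: "0 \<le> p" "p \<le> 2" "0 \<le> q" "q \<le> 3"
    using rel_moment_nonneg[OF assms] rel_moment_le[OF assms, of 0] rel_moment_le[OF assms, of 1]
    by (auto simp: numeral_2_eq_2 p_def q_def)
  then have "p\<^sup>2 \<le> 4" using power_mono[of p 2 2] by simp
  then show ?thesis using a zero_le_power2[of p]
    unfolding curvature_def p_def[symmetric] q_def[symmetric] by linarith
qed

text \<open>\<open>x\<close> times the derivative is again a polynomial in the bounded relative moments; \<open>300\<close> is a
  crude bound for it.\<close>

lemma curvature_has_derivative:
  assumes "0 < x" obtains D where "(curvature has_real_derivative D / x) (at x)" "\<bar>D\<bar> \<le> 300"
proof -
  define p q r where "p = rel_moment 1 x" and "q = rel_moment 2 x" and "r = rel_moment 3 x"
  have a: "0 \<le> p" "p \<le> 2" "0 \<le> q" "q \<le> 3" "0 \<le> r" "r \<le> 8"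
    using rel_moment_nonneg[OF assms] rel_moment_le[OF assms, of 0] rel_moment_le[OF assms, of 1]
       rel_moment_le[OF assms, of 2]
    by (auto simp: numeral_2_eq_2 numeral_3_eq_3 p_def q_def r_def fact_numeral)
  define D where "D = 8 * (p * (p - q - p * p)) - 2 * (p - q - p * p) + 4 * (2 * q - r - p * q)"
  have 1: "(rel_moment 1 has_real_derivative (p - q - p * p) / x) (at x)"
    using rel_moment_has_derivative[OF assms, of 0] by (simp add: p_def q_def numeral_2_eq_2)
  have 2: "(rel_moment 2 has_real_derivative (2 * q - r - p * q) / x) (at x)"
    using rel_moment_has_derivative[OF assms, of 1] by (simp add: p_def q_def r_def numeral_2_eq_2 numeral_3_eq_3)
  have "(curvature has_real_derivative D / x) (at x)"
    unfolding curvature_def[abs_def] D_def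
    by (rule derivative_eq_intros 1 2 refl)+
      (use assms in \<open>simp add: p_def[symmetric, unfolded One_nat_def] field_simps\<close>)
  moreover have "\<bar>D\<bar> \<le> 300"
  proof -
    have pp: "0 \<le> p * p" "p * p \<le> 4" using a mult_mono[of p 2 p 2] by auto
    have pq: "0 \<le> p * q" "p * q \<le> 6" using a mult_mono[of p 2 q 3] by auto
    have t: "\<bar>p - q - p * p\<bar> \<le> 9" using a pp by linarith
    then have "\<bar>p * (p - q - p * p)\<bar> \<le> 18" using a mult_mono[of "\<bar>p\<bar>" 2 "\<bar>p - q - p * p\<bar>" 9] unfolding abs_mult by auto
    moreover have "\<bar>8 * A - 2 * B + 4 * (2 * q - r - C)\<bar> \<le> 300"
      if "\<bar>A\<bar> \<le> 18" "\<bar>B\<bar> \<le> 9" "0 \<le> C" "C \<le> 6" for A B C :: real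
      using that a by (simp add: abs_le_iff)
    ultimately show ?thesis using t pq unfolding D_def by blast
  qed
  ultimately show ?thesis using that by blast
qed

text \<open>The mean value theorem in the variable \<open>ln x\<close>, in which the derivative is bounded.\<close>

lemma curvature_lipschitz:
  assumes "0 < x" "0 < y" shows "\<bar>curvature x - curvature y\<bar> \<le> 300 * \<bar>ln x - ln y\<bar>"
proof -
  obtain D where D: "\<And>x. 0 < x \<Longrightarrow> (curvature has_real_derivative D x / x) (at x)" "\<And>x. 0 < x \<Longrightarrow> \<bar>D x\<bar> \<le> 300"
  proof -
    have "\<forall>x. \<exists>D. 0 < x \<longrightarrow> (curvature has_real_derivative D / x) (at x) \<and> \<bar>D\<bar> \<le> 300"
      by (metis curvature_has_derivative)
    then show ?thesis using that by metis
  qed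
  have "norm ((\<lambda>t. curvature (exp t)) (ln x) - (\<lambda>t. curvature (exp t)) (ln y)) \<le> 300 * norm (ln x - ln y)"
  proof (rule field_differentiable_bound[where S=UNIV and f'="\<lambda>t. D (exp t) / exp t * exp t"])
    show "((\<lambda>t. curvature (exp t)) has_field_derivative D (exp t) / exp t * exp t) (at t within UNIV)" for t
      using DERIV_chain2[OF D(1)[of "exp t"] DERIV_exp] by auto
  qed (use D in auto)
  then show ?thesis using assms by simp
qed

lemma continuous_on_phi: "continuous_on {0<..} \<phi>"
  by (intro continuous_at_imp_continuous_on ballI DERIV_isCont[OF phi_has_derivative]) simp

lemma continuous_on_curvature: "continuous_on {0<..} curvature"
proof (intro continuous_at_imp_continuous_on ballI)
  fix x :: real assume "x \<in> {0<..}"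
  then obtain D where "(curvature has_real_derivative D / x) (at x)"
    using curvature_has_derivative[of x] by auto
  then show "isCont curvature x" by (rule DERIV_isCont)
qed

lemma continuous_on_rel_moment: "continuous_on {0<..} (rel_moment (Suc k))"
  by (intro continuous_at_imp_continuous_on ballI DERIV_isCont[OF rel_moment_has_derivative]) simp

end

section \<open>The logarithm of the ladder exponent\<close>

lemma abs_divide_one_plus_square_le:
  fixes a c t :: real assumes "\<bar>a\<bar> \<le> c" shows "\<bar>a / (1 + t\<^sup>2)\<bar> \<le> c * (1 / (1 + t\<^sup>2))"
proof -
  have "\<bar>a\<bar> / (1 + t\<^sup>2) \<le> c / (1 + t\<^sup>2)"
    using assms by (intro divide_right_mono) auto
  then show ?thesis by (simp add: abs_divide add_nonneg_nonneg)
qed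

text \<open>The Cauchy density has total mass \<open>pi / 2\<close> on the half-line.\<close>

lemma integral_inverse_square_bound:
  fixes h :: "real \<Rightarrow> real"
  assumes h: "set_borel_measurable lborel {0<..} h" and le: "\<And>x. 0 < x \<Longrightarrow> \<bar>h x\<bar> \<le> C"
  shows "set_integrable lborel {0<..} (\<lambda>x. h x / (1 + x\<^sup>2))"
    and "\<bar>LBINT x:{0<..}. h x / (1 + x\<^sup>2)\<bar> \<le> C * (pi / 2)"
proof -
  have i: "set_integrable lborel {0<..} (\<lambda>x::real. C * (1 / (1 + x\<^sup>2)))"
    using inverse_one_plus_square(1) by (rule set_integrable_mult_right)
  have b: "\<bar>h x / (1 + x\<^sup>2)\<bar> \<le> C * (1 / (1 + x\<^sup>2))" if "0 < x" for x
    using le[OF that] by (rule abs_divide_one_plus_square_le)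
  show j: "set_integrable lborel {0<..} (\<lambda>x. h x / (1 + x\<^sup>2))"
    using i
  proof (rule set_integrable_bound)
    have "(\<lambda>x. (indicator {0<..} x *\<^sub>R h x) / (1 + x\<^sup>2)) \<in> borel_measurable lborel"
      using h unfolding set_borel_measurable_def by measurable
    then show "set_borel_measurable lborel {0<..} (\<lambda>x. h x / (1 + x\<^sup>2))"
      by (simp add: set_borel_measurable_def)
    show "AE x in lborel. x \<in> {0<..} \<longrightarrow> norm (h x / (1 + x\<^sup>2)) \<le> norm (C * (1 / (1 + x\<^sup>2)))"
      using b by (intro AE_I2) (metis abs_ge_self greaterThan_iff order_trans real_norm_def)
  qed
  have "\<bar>LBINT x:{0<..}. h x / (1 + x\<^sup>2)\<bar> \<le> (LBINT x:{0<..}. \<bar>h x / (1 + x\<^sup>2)\<bar>)"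
    using set_integral_norm_bound[OF j] by simp
  also have "\<dots> \<le> (LBINT x:{0<..}. C * (1 / (1 + x\<^sup>2)))"
    by (intro set_integral_mono i set_integrable_abs[OF j] b) simp
  also have "\<dots> = C * (pi / 2)" unfolding set_integral_mult_right inverse_one_plus_square(2) ..
  finally show "\<bar>LBINT x:{0<..}. h x / (1 + x\<^sup>2)\<bar> \<le> C * (pi / 2)" .
qed

context levy_exponent begin

lemma measurable_comp_square:
  fixes h :: "real \<Rightarrow> real" and c :: real
  assumes "continuous_on {0<..} h" "0 < c"
  shows "set_borel_measurable lborel {0<..} (\<lambda>x. h (c * x\<^sup>2))"
proof -
  have "continuous_on {0<..} (\<lambda>x. h (c * x\<^sup>2))"
    by (intro continuous_on_compose2[OF assms(1)] continuous_intros) (use assms(2) in auto)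
  from borel_measurable_continuous_on_indicator[OF _ this] show ?thesis
    by (simp add: set_borel_measurable_def)
qed

text \<open>The logarithm of the ladder exponent and, by differentiation of \<open>\<xi> \<mapsto> ln (\<phi> (\<xi>\<^sup>2 * \<theta>\<^sup>2))\<close>
  under the integral sign, its two derivatives.\<close>

definition log_kappa :: "real \<Rightarrow> real" where
  "log_kappa \<xi> = 1 / pi * (LBINT \<theta>:{0<..}. ln (\<phi> (\<xi>\<^sup>2 * \<theta>\<^sup>2)) / (1 + \<theta>\<^sup>2))"

definition log_kappa' :: "real \<Rightarrow> real" where
  "log_kappa' \<xi> = 1 / pi * (LBINT \<theta>:{0<..}. (2 * rel_moment 1 (\<xi>\<^sup>2 * \<theta>\<^sup>2) / \<xi>) / (1 + \<theta>\<^sup>2))"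

definition log_kappa'' :: "real \<Rightarrow> real" where
  "log_kappa'' \<xi> = 1 / pi * (LBINT \<theta>:{0<..}. (- curvature (\<xi>\<^sup>2 * \<theta>\<^sup>2) / \<xi>\<^sup>2) / (1 + \<theta>\<^sup>2))"

lemma ladder_exponent_eq: "ladder_exponent \<phi> \<xi> = exp (log_kappa \<xi>)"
  by (simp add: ladder_exponent_def log_kappa_def)

lemma continuous_on_ln_phi: "continuous_on {0<..} (\<lambda>x. ln (\<phi> x))"
  using continuous_on_phi by (intro continuous_on_ln) (auto dest: phi_pos)

text \<open>Comparison of \<open>\<phi> (\<xi>\<^sup>2 * \<theta>\<^sup>2)\<close> with \<open>\<phi> (\<xi>\<^sup>2)\<close> costs at most \<open>2 * \<bar>ln \<theta>\<bar>\<close> in the logarithm,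
  and the Cauchy density integrates that. Hence \<open>\<kappa> \<xi>\<close> is comparable with \<open>sqrt (\<phi> (\<xi>\<^sup>2))\<close>.\<close>

lemma ln_phi_integrable:
  assumes x: "0 < \<xi>"
  shows "set_integrable lborel {0<..} (\<lambda>\<theta>. ln (\<phi> (\<xi>\<^sup>2 * \<theta>\<^sup>2)) / (1 + \<theta>\<^sup>2))"
    and "\<bar>log_kappa \<xi> - ln (\<phi> (\<xi>\<^sup>2)) / 2\<bar> \<le> 2 / pi * (LBINT \<theta>:{0<..}. \<bar>ln \<theta>\<bar> / (1 + \<theta>\<^sup>2))"
proof -
  define g where "g \<theta> = ln (\<phi> (\<xi>\<^sup>2 * \<theta>\<^sup>2)) - ln (\<phi> (\<xi>\<^sup>2))" for \<theta>
  have g: "\<bar>g \<theta>\<bar> \<le> 2 * \<bar>ln \<theta>\<bar>" if "0 < \<theta>" for \<theta>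
    using abs_ln_phi_le[of "\<xi>\<^sup>2" "\<theta>\<^sup>2"] that x by (simp add: g_def mult.commute ln_realpow abs_mult)
  have i: "set_integrable lborel {0<..} (\<lambda>\<theta>::real. 2 * (\<bar>ln \<theta>\<bar> / (1 + \<theta>\<^sup>2)))"
    using abs_ln_integrable by (rule set_integrable_mult_right)
  have gb: "\<bar>g \<theta> / (1 + \<theta>\<^sup>2)\<bar> \<le> 2 * (\<bar>ln \<theta>\<bar> / (1 + \<theta>\<^sup>2))" if "0 < \<theta>" for \<theta>
    using abs_divide_one_plus_square_le[OF g[OF that], of \<theta>] by simp
  have m: "set_borel_measurable lborel {0<..} (\<lambda>\<theta>. ln (\<phi> (\<xi>\<^sup>2 * \<theta>\<^sup>2)))"
    using measurable_comp_square[OF continuous_on_ln_phi, of "\<xi>\<^sup>2"] x by simp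
  have gi: "set_integrable lborel {0<..} (\<lambda>\<theta>. g \<theta> / (1 + \<theta>\<^sup>2))"
    using i
  proof (rule set_integrable_bound)
    have "(\<lambda>\<theta>. (indicator {0<..} \<theta> *\<^sub>R ln (\<phi> (\<xi>\<^sup>2 * \<theta>\<^sup>2)) - indicator {0<..} \<theta> * ln (\<phi> (\<xi>\<^sup>2))) / (1 + \<theta>\<^sup>2)) \<in> borel_measurable lborel"
      using m unfolding set_borel_measurable_def by measurable
    then show "set_borel_measurable lborel {0<..} (\<lambda>\<theta>. g \<theta> / (1 + \<theta>\<^sup>2))"
      by (simp add: set_borel_measurable_def g_def algebra_simps)
    show "AE \<theta> in lborel. \<theta> \<in> {0<..} \<longrightarrow> norm (g \<theta> / (1 + \<theta>\<^sup>2)) \<le> norm (2 * (\<bar>ln \<theta>\<bar> / (1 + \<theta>\<^sup>2)))"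
      using gb by (intro AE_I2) (metis abs_ge_self greaterThan_iff order_trans real_norm_def)
  qed
  have ci: "set_integrable lborel {0<..} (\<lambda>\<theta>. ln (\<phi> (\<xi>\<^sup>2)) * (1 / (1 + \<theta>\<^sup>2)))"
    using inverse_one_plus_square(1) by (rule set_integrable_mult_right)
  have eq: "ln (\<phi> (\<xi>\<^sup>2 * \<theta>\<^sup>2)) / (1 + \<theta>\<^sup>2) = ln (\<phi> (\<xi>\<^sup>2)) * (1 / (1 + \<theta>\<^sup>2)) + g \<theta> / (1 + \<theta>\<^sup>2)" for \<theta>
    by (simp add: g_def add_divide_distrib[symmetric])
  show "set_integrable lborel {0<..} (\<lambda>\<theta>. ln (\<phi> (\<xi>\<^sup>2 * \<theta>\<^sup>2)) / (1 + \<theta>\<^sup>2))"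
    unfolding eq by (rule set_integral_add(1)[OF ci gi])
  have "log_kappa \<xi> = 1 / pi * (ln (\<phi> (\<xi>\<^sup>2)) * (pi / 2) + (LBINT \<theta>:{0<..}. g \<theta> / (1 + \<theta>\<^sup>2)))"
    unfolding log_kappa_def eq set_integral_add(2)[OF ci gi] set_integral_mult_right inverse_one_plus_square(2) ..
  then have "log_kappa \<xi> - ln (\<phi> (\<xi>\<^sup>2)) / 2 = 1 / pi * (LBINT \<theta>:{0<..}. g \<theta> / (1 + \<theta>\<^sup>2))"
    by (simp add: field_simps)
  moreover have "\<bar>LBINT \<theta>:{0<..}. g \<theta> / (1 + \<theta>\<^sup>2)\<bar> \<le> (LBINT \<theta>:{0<..}. \<bar>g \<theta> / (1 + \<theta>\<^sup>2)\<bar>)"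
    using set_integral_norm_bound[OF gi] by simp
  moreover have "\<dots> \<le> (LBINT \<theta>:{0<..}. 2 * (\<bar>ln \<theta>\<bar> / (1 + \<theta>\<^sup>2)))"
    by (intro set_integral_mono i set_integrable_abs[OF gi] gb) simp
  moreover have "(LBINT \<theta>:{0<..}. 2 * (\<bar>ln \<theta>\<bar> / (1 + \<theta>\<^sup>2))) = (2::real) * (LBINT \<theta>:{0<..}. \<bar>ln \<theta>\<bar> / (1 + \<theta>\<^sup>2))"
    by (rule set_integral_mult_right)
  ultimately show "\<bar>log_kappa \<xi> - ln (\<phi> (\<xi>\<^sup>2)) / 2\<bar> \<le> 2 / pi * (LBINT \<theta>:{0<..}. \<bar>ln \<theta>\<bar> / (1 + \<theta>\<^sup>2))"
    by (simp add: abs_mult divide_right_mono)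
qed

lemma ln_phi_square_has_derivative:
  assumes "0 < x" "0 < \<theta>"
  shows "((\<lambda>x. ln (\<phi> (x\<^sup>2 * \<theta>\<^sup>2))) has_real_derivative 2 * rel_moment 1 (x\<^sup>2 * \<theta>\<^sup>2) / x) (at x)"
proof -
  have p: "0 < x\<^sup>2 * \<theta>\<^sup>2" using assms by simp
  have "((\<lambda>x. ln (\<phi> (x\<^sup>2 * \<theta>\<^sup>2))) has_real_derivative
     1 / \<phi> (x\<^sup>2 * \<theta>\<^sup>2) * (moment 1 (x\<^sup>2 * \<theta>\<^sup>2) * (2 * x * \<theta>\<^sup>2))) (at x)"
    by (rule DERIV_chain2[OF DERIV_ln_divide] DERIV_chain2[OF phi_has_derivative] phi_pos p)+
      (auto intro!: derivative_eq_intros)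
  also have "1 / \<phi> (x\<^sup>2 * \<theta>\<^sup>2) * (moment 1 (x\<^sup>2 * \<theta>\<^sup>2) * (2 * x * \<theta>\<^sup>2)) = 2 * rel_moment 1 (x\<^sup>2 * \<theta>\<^sup>2) / x"
    using assms by (simp add: rel_moment_def power2_eq_square)
  finally show ?thesis .
qed

lemma rel_moment_square_has_derivative:
  assumes "0 < x" "0 < \<theta>"
  shows "((\<lambda>x. 2 * rel_moment 1 (x\<^sup>2 * \<theta>\<^sup>2) / x) has_real_derivative - curvature (x\<^sup>2 * \<theta>\<^sup>2) / x\<^sup>2) (at x)"
proof -
  define y where "y = x\<^sup>2 * \<theta>\<^sup>2"
  have p: "0 < y" using assms by (simp add: y_def)
  have d: "(rel_moment 1 has_real_derivative (rel_moment 1 y - rel_moment 2 y - rel_moment 1 y * rel_moment 1 y) / y) (at y)"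
    using rel_moment_has_derivative[OF p, of 0] by (simp add: numeral_2_eq_2)
  have "((\<lambda>x. rel_moment 1 (x\<^sup>2 * \<theta>\<^sup>2)) has_real_derivative
     (rel_moment 1 y - rel_moment 2 y - rel_moment 1 y * rel_moment 1 y) / y * (2 * x * \<theta>\<^sup>2)) (at x)"
    by (rule DERIV_chain2[where f="rel_moment 1" and g="\<lambda>x. x\<^sup>2 * \<theta>\<^sup>2"])
      (use d in \<open>auto simp: y_def intro!: derivative_eq_intros\<close>)
  also have "(rel_moment 1 y - rel_moment 2 y - rel_moment 1 y * rel_moment 1 y) / y * (2 * x * \<theta>\<^sup>2)
     = 2 * (rel_moment 1 y - rel_moment 2 y - rel_moment 1 y * rel_moment 1 y) / x"
    using assms by (simp add: y_def power2_eq_square)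
  finally have 1: "((\<lambda>x. rel_moment 1 (x\<^sup>2 * \<theta>\<^sup>2)) has_real_derivative
     2 * (rel_moment 1 y - rel_moment 2 y - rel_moment 1 y * rel_moment 1 y) / x) (at x)" .
  have "((\<lambda>x. 2 * rel_moment 1 (x\<^sup>2 * \<theta>\<^sup>2) / x) has_real_derivative
    (2 * (2 * (rel_moment 1 y - rel_moment 2 y - rel_moment 1 y * rel_moment 1 y) / x) * x - 2 * rel_moment 1 y * 1) / (x * x)) (at x)"
    unfolding y_def using assms
    by (intro DERIV_divide DERIV_cmult 1[unfolded y_def] DERIV_ident) auto
  also have "(2 * (2 * (rel_moment 1 y - rel_moment 2 y - rel_moment 1 y * rel_moment 1 y) / x) * x - 2 * rel_moment 1 y * 1) / (x * x)
     = - curvature y / x\<^sup>2"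
    using assms by (simp add: curvature_def power2_eq_square)
  finally show ?thesis by (simp only: y_def)
qed

lemma rel_moment_1_measurable:
  assumes "0 < x" shows "set_borel_measurable lborel {0<..} (\<lambda>\<theta>. 2 * rel_moment 1 (x\<^sup>2 * \<theta>\<^sup>2) / x)"
proof -
  have "continuous_on {0<..} (\<lambda>y. 2 * rel_moment 1 y / x)"
    using continuous_on_rel_moment[of 0] assms by (intro continuous_intros) auto
  then show ?thesis using measurable_comp_square[of "\<lambda>y. 2 * rel_moment 1 y / x" "x\<^sup>2"] assms by simp
qed

lemma rel_moment_1_le: "0 < y \<Longrightarrow> \<bar>rel_moment 1 y\<bar> \<le> 2"
  using rel_moment_le[of y 0] rel_moment_nonneg[of y 1] by simp

lemma log_kappa_has_derivative:
  assumes x: "0 < x"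
  shows "(log_kappa has_real_derivative log_kappa' x) (at x)"
  unfolding log_kappa_def[abs_def] log_kappa'_def
proof (intro DERIV_cmult has_real_derivative_set_integral(1)[where a="x/2" and b="2*x"
    and G="\<lambda>\<theta>. 8 / x * (1 / (1 + \<theta>\<^sup>2))"] set_integrable_mult_right inverse_one_plus_square(1))
  fix y \<theta> :: real assume y: "y \<in> {x / 2<..<2 * x}" and t: "\<theta> \<in> {0<..}"
  show "((\<lambda>x. ln (\<phi> (x\<^sup>2 * \<theta>\<^sup>2)) / (1 + \<theta>\<^sup>2)) has_real_derivative
     2 * rel_moment 1 (y\<^sup>2 * \<theta>\<^sup>2) / y / (1 + \<theta>\<^sup>2)) (at y)"
    using y t x by (intro DERIV_cdivide ln_phi_square_has_derivative) auto
  have "\<bar>2 * rel_moment 1 (y\<^sup>2 * \<theta>\<^sup>2) / y\<bar> \<le> 2 * 2 / (x / 2)"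
    unfolding abs_divide abs_mult using y t x rel_moment_1_le[of "y\<^sup>2 * \<theta>\<^sup>2"]
    by (intro frac_le mult_mono) auto
  then have "\<bar>2 * rel_moment 1 (y\<^sup>2 * \<theta>\<^sup>2) / y\<bar> \<le> 8 / x" by simp
  then show "\<bar>2 * rel_moment 1 (y\<^sup>2 * \<theta>\<^sup>2) / y / (1 + \<theta>\<^sup>2)\<bar> \<le> 8 / x * (1 / (1 + \<theta>\<^sup>2))"
    by (rule abs_divide_one_plus_square_le)
qed (use x ln_phi_integrable(1) in auto)

lemma log_kappa'_has_derivative:
  assumes x: "0 < x"
  shows "(log_kappa' has_real_derivative log_kappa'' x) (at x)"
  unfolding log_kappa'_def[abs_def] log_kappa''_def
proof (intro DERIV_cmult has_real_derivative_set_integral(1)[where a="x/2" and b="2*x"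
    and G="\<lambda>\<theta>. 128 / x\<^sup>2 * (1 / (1 + \<theta>\<^sup>2))"] set_integrable_mult_right inverse_one_plus_square(1))
  fix y :: real assume y: "y \<in> {x / 2<..<2 * x}"
  have y0: "0 < y" using x y by simp
  show "set_integrable lborel {0<..} (\<lambda>\<theta>. 2 * rel_moment 1 (y\<^sup>2 * \<theta>\<^sup>2) / y / (1 + \<theta>\<^sup>2))"
    using rel_moment_1_measurable[OF y0] y0 rel_moment_1_le
    by (intro integral_inverse_square_bound(1)[where C="4 / y"]) (auto simp: abs_mult divide_right_mono)
  fix \<theta> :: real assume t: "\<theta> \<in> {0<..}"
  show "((\<lambda>x. 2 * rel_moment 1 (x\<^sup>2 * \<theta>\<^sup>2) / x / (1 + \<theta>\<^sup>2)) has_real_derivative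
     - curvature (y\<^sup>2 * \<theta>\<^sup>2) / y\<^sup>2 / (1 + \<theta>\<^sup>2)) (at y)"
    using y0 t by (intro DERIV_cdivide rel_moment_square_has_derivative) auto
  have "\<bar>- curvature (y\<^sup>2 * \<theta>\<^sup>2) / y\<^sup>2\<bar> \<le> 32 / (x / 2)\<^sup>2"
    unfolding abs_divide abs_minus_cancel using y t x curvature_bound[of "y\<^sup>2 * \<theta>\<^sup>2"]
    by (intro frac_le) (auto intro!: power_mono simp del: power_divide simp: abs_le_iff)
  then have "\<bar>- curvature (y\<^sup>2 * \<theta>\<^sup>2) / y\<^sup>2\<bar> \<le> 128 / x\<^sup>2" by (simp add: power_divide)
  then show "\<bar>- curvature (y\<^sup>2 * \<theta>\<^sup>2) / y\<^sup>2 / (1 + \<theta>\<^sup>2)\<bar> \<le> 128 / x\<^sup>2 * (1 / (1 + \<theta>\<^sup>2))"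
    by (rule abs_divide_one_plus_square_le)
qed (use x in auto)

lemma log_kappa'_bound:
  assumes x: "0 < x" shows "\<bar>log_kappa' x\<bar> \<le> 2 / x"
proof -
  have "\<bar>LBINT \<theta>:{0<..}. 2 * rel_moment 1 (x\<^sup>2 * \<theta>\<^sup>2) / x / (1 + \<theta>\<^sup>2)\<bar> \<le> 4 / x * (pi / 2)"
    using rel_moment_1_measurable[OF x] x rel_moment_1_le
    by (intro integral_inverse_square_bound(2)) (auto simp: abs_mult divide_right_mono)
  then have "1 / pi * \<bar>LBINT \<theta>:{0<..}. 2 * rel_moment 1 (x\<^sup>2 * \<theta>\<^sup>2) / x / (1 + \<theta>\<^sup>2)\<bar> \<le> 1 / pi * (4 / x * (pi / 2))"
    by (intro mult_left_mono) auto
  then show ?thesis unfolding log_kappa'_def by (simp add: abs_mult)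
qed

end

section \<open>The ladder weight\<close>

lemma set_integral_scale_pos:
  fixes f :: "real \<Rightarrow> real"
  assumes c: "0 < c"
  shows "(LBINT x:{0<..}. f x) = c * (LBINT x:{0<..}. f (c * x))"
proof -
  have "(LBINT x:{0<..}. f x) = \<bar>c\<bar> *\<^sub>R (LBINT x. indicator {0<..} (0 + c * x) *\<^sub>R f (0 + c * x))"
    unfolding set_lebesgue_integral_def by (rule lborel_integral_real_affine) (use c in auto)
  also have "(\<lambda>x. indicator {0<..} (0 + c * x) *\<^sub>R f (0 + c * x)) = (\<lambda>x. indicator {0<..} x *\<^sub>R f (c * x))"
    using c by (auto simp: indicator_def zero_less_mult_iff fun_eq_iff)
  finally show ?thesis using c by (simp add: set_lebesgue_integral_def)
qed

text \<open>An explicit antiderivative, found by two integrations by parts.\<close>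

lemma laplace_one_minus_cos:
  assumes a: "0 < (a::real)"
  shows "set_integrable lborel {0<..} (\<lambda>x. exp (- a * x) * (1 - cos (t * x)))"
    and "(LBINT x:{0<..}. exp (- a * x) * (1 - cos (t * x))) = t\<^sup>2 / (a * (a\<^sup>2 + t\<^sup>2))"
proof -
  define q where "q = 1 / (a\<^sup>2 + t\<^sup>2)"
  have p: "a\<^sup>2 + t\<^sup>2 \<noteq> 0" using a by (smt (verit) zero_le_power2 zero_less_power)
  have q: "(a\<^sup>2 + t\<^sup>2) * q = 1" using p by (simp add: q_def)
  define F where "F x = - (1 / a) * exp (- a * x)
     - (t * (exp (- a * x) * sin (t * x)) - a * (exp (- a * x) * cos (t * x))) * q" for x
  have der: "(F has_real_derivative exp (- a * x) * (1 - cos (t * x))) (at x)" for x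
  proof -
    define e s c where "e = exp (- a * x)" and "s = sin (t * x)" and "c = cos (t * x)"
    have "(F has_real_derivative - (1 / a) * (e * (- a))
       - (t * (e * (- a) * s + e * (c * t)) - a * (e * (- a) * c + e * (- s * t))) * q) (at x)"
      unfolding F_def[abs_def] e_def s_def c_def
      by (auto intro!: derivative_eq_intros simp: algebra_simps)
    also have "- (1 / a) * (e * (- a)) = e" using a by simp
    also have "(t * (e * (- a) * s + e * (c * t)) - a * (e * (- a) * c + e * (- s * t))) * q = e * c * ((a\<^sup>2 + t\<^sup>2) * q)"
      by (simp add: power2_eq_square algebra_simps)
    also have "e - e * c * ((a\<^sup>2 + t\<^sup>2) * q) = e * (1 - c)" unfolding q by (simp add: algebra_simps)
    finally show ?thesis by (simp add: e_def c_def)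
  qed
  have l0: "(F \<longlongrightarrow> F 0) (at_right 0)"
    using DERIV_isCont[OF der[of 0]] by (simp add: isCont_def filterlim_at_split)
  have e0: "((\<lambda>x. exp (- a * x)) \<longlongrightarrow> 0) at_top"
  proof -
    have "filterlim (\<lambda>x. - a * x) at_bot at_top"
      using a by (intro filterlim_tendsto_neg_mult_at_bot[OF tendsto_const _ filterlim_ident]) auto
    then show ?thesis by (rule filterlim_compose[OF exp_at_bot])
  qed
  have b: "((\<lambda>x. exp (- a * x) * h (t * x)) \<longlongrightarrow> 0) at_top" if "\<And>x. \<bar>h x\<bar> \<le> 1" for h :: "real \<Rightarrow> real"
    by (rule Lim_null_comparison[OF _ e0]) (use that in \<open>auto simp: abs_mult intro!: always_eventually mult_left_le\<close>)
  have l1: "(F \<longlongrightarrow> - (1 / a) * 0 - (t * 0 - a * 0) * q) at_top"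
    unfolding F_def[abs_def] by (intro tendsto_intros e0 b abs_sin_le_one abs_cos_le_one)
  show "set_integrable lborel {0<..} (\<lambda>x. exp (- a * x) * (1 - cos (t * x)))"
    by (rule set_integrable_FTC_greaterThan(1)[OF der _ _ l0 l1]) (auto intro!: continuous_intros)
  have "(LBINT x:{0<..}. exp (- a * x) * (1 - cos (t * x))) = (- (1 / a) * 0 - (t * 0 - a * 0) * q) - F 0"
    by (rule set_integrable_FTC_greaterThan(2)[OF der _ _ l0 l1]) (auto intro!: continuous_intros)
  also have "\<dots> = t\<^sup>2 / (a * (a\<^sup>2 + t\<^sup>2))"
    using a p by (simp add: F_def q_def divide_simps) (simp add: power2_eq_square algebra_simps)
  finally show "(LBINT x:{0<..}. exp (- a * x) * (1 - cos (t * x))) = t\<^sup>2 / (a * (a\<^sup>2 + t\<^sup>2))" .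
qed

text \<open>Here \<open>(1 - cos u) / u\<^sup>2\<close> is at most \<open>1\<close> and \<open>1 - cos u\<close> is at most \<open>2\<close>.\<close>

lemma one_minus_cos_le:
  fixes u :: real assumes "0 < u" shows "(1 - cos u) / u\<^sup>2 * (1 + u\<^sup>2) \<le> 3"
proof -
  have "cos (2 * (u / 2)) = 1 - 2 * (sin (u / 2))\<^sup>2" by (rule cos_double_sin)
  then have "1 - cos u = 2 * (sin (u / 2))\<^sup>2" by simp
  also have "\<dots> \<le> 2 * (u / 2)\<^sup>2"
    using abs_sin_x_le_abs_x[of "u / 2"] by (simp add: abs_le_square_iff[symmetric] del: power_divide)
  also have "\<dots> \<le> u\<^sup>2" by (simp add: power2_eq_square)
  finally have 1: "(1 - cos u) / u\<^sup>2 \<le> 1" using assms by simp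
  have "(1 - cos u) / u\<^sup>2 * (1 + u\<^sup>2) = (1 - cos u) / u\<^sup>2 + (1 - cos u)"
    using assms by (simp add: field_simps)
  also have "\<dots> \<le> 1 + 2" using 1 cos_ge_minus_one[of u] by (intro add_mono) auto
  finally show ?thesis by simp
qed

context levy_exponent begin

text \<open>Replacing \<open>1 / (a * (a\<^sup>2 + \<theta>\<^sup>2))\<close> in the formula for \<open>- (log \<kappa>)'' a\<close> by the Laplace
  transform of \<open>(1 - cos (\<theta> * x)) / \<theta>\<^sup>2\<close> shows that this second derivative is the Laplace
  transform of a function; the weight is that function divided by \<open>x\<close>, after the substitution
  \<open>u = x * \<theta>\<close>. The substitution makes boundedness and the logarithmic Lipschitz bound evident,
  since the curvature has both properties.\<close>

definition ladder_weight :: "real \<Rightarrow> real" where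
  "ladder_weight x = 1 / pi * (LBINT u:{0<..}. (1 - cos u) / u\<^sup>2 * curvature (1 / x\<^sup>2 * u\<^sup>2))"

lemma oscillatory_bound:
  assumes h: "set_borel_measurable lborel {0<..} h" and le: "\<And>x. 0 < x \<Longrightarrow> \<bar>h x\<bar> \<le> C"
  shows "set_integrable lborel {0<..} (\<lambda>u. (1 - cos u) / u\<^sup>2 * h u)"
    "\<bar>LBINT u:{0<..}. (1 - cos u) / u\<^sup>2 * h u\<bar> \<le> (3 * C) * (pi / 2)"
proof -
  have eq: "(1 - cos u) / u\<^sup>2 * h u = ((1 - cos u) / u\<^sup>2 * (1 + u\<^sup>2) * h u) / (1 + u\<^sup>2)" for u
  proof -
    have "1 + u\<^sup>2 \<noteq> 0" by (smt (verit) zero_le_power2)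
    then show ?thesis by simp
  qed
  have "(\<lambda>u. (1 - cos u) / u\<^sup>2 * (1 + u\<^sup>2) * (indicator {0<..} u *\<^sub>R h u)) \<in> borel_measurable lborel"
    using h unfolding set_borel_measurable_def by measurable
  then have m: "set_borel_measurable lborel {0<..} (\<lambda>u. (1 - cos u) / u\<^sup>2 * (1 + u\<^sup>2) * h u)"
    by (simp add: set_borel_measurable_def mult_ac)
  have b: "\<bar>(1 - cos u) / u\<^sup>2 * (1 + u\<^sup>2) * h u\<bar> \<le> 3 * C" if "0 < u" for u
  proof -
    have "0 \<le> (1 - cos u) / u\<^sup>2 * (1 + u\<^sup>2)" by (intro mult_nonneg_nonneg divide_nonneg_nonneg) auto
    then show ?thesis unfolding abs_mult[of _ "h u"]
      using one_minus_cos_le[OF that] le[OF that] by (intro mult_mono) auto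
  qed
  show "set_integrable lborel {0<..} (\<lambda>u. (1 - cos u) / u\<^sup>2 * h u)"
    unfolding eq by (rule integral_inverse_square_bound(1)[OF m b])
  show "\<bar>LBINT u:{0<..}. (1 - cos u) / u\<^sup>2 * h u\<bar> \<le> (3 * C) * (pi / 2)"
    unfolding eq by (rule integral_inverse_square_bound(2)[OF m b])
qed

lemma curvature_measurable:
  "0 < x \<Longrightarrow> set_borel_measurable lborel {0<..} (\<lambda>u. curvature (1 / x\<^sup>2 * u\<^sup>2))"
  using measurable_comp_square[OF continuous_on_curvature, of "1 / x\<^sup>2"] by simp

text \<open>The constant is \<open>3 * 32 / 2\<close>, from the bounds \<open>32\<close> for the curvature and \<open>3\<close> of
  \<open>one_minus_cos_le\<close>.\<close>

lemma ladder_weight_bound: assumes x: "0 < x" shows "\<bar>ladder_weight x\<bar> \<le> 48"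
proof -
  have "\<bar>LBINT u:{0<..}. (1 - cos u) / u\<^sup>2 * curvature (1 / x\<^sup>2 * u\<^sup>2)\<bar> \<le> (3 * 32) * (pi / 2)"
    by (intro oscillatory_bound(2) curvature_measurable x curvature_bound) (use x in auto)
  then have "1 / pi * \<bar>LBINT u:{0<..}. (1 - cos u) / u\<^sup>2 * curvature (1 / x\<^sup>2 * u\<^sup>2)\<bar> \<le> 1 / pi * ((3 * 32) * (pi / 2))"
    by (intro mult_left_mono) auto
  then show ?thesis by (simp add: ladder_weight_def abs_mult)
qed

text \<open>The constant is \<open>3 * 600 / 2\<close>: squaring the argument doubles the Lipschitz constant \<open>300\<close> of
  the curvature.\<close>

lemma ladder_weight_lipschitz:
  assumes x: "0 < x" and y: "0 < y"
  shows "\<bar>ladder_weight x - ladder_weight y\<bar> \<le> 900 * \<bar>ln x - ln y\<bar>"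
proof -
  define h where "h z u = curvature (1 / z\<^sup>2 * u\<^sup>2)" for z u
  have i: "set_integrable lborel {0<..} (\<lambda>u. (1 - cos u) / u\<^sup>2 * h z u)" if "0 < z" for z
    unfolding h_def using that
    by (intro oscillatory_bound(1)[where C=32] curvature_measurable curvature_bound) auto
  have b: "\<bar>h x u - h y u\<bar> \<le> 600 * \<bar>ln x - ln y\<bar>" if "0 < u" for u
  proof -
    have "\<bar>h x u - h y u\<bar> \<le> 300 * \<bar>ln (1 / x\<^sup>2 * u\<^sup>2) - ln (1 / y\<^sup>2 * u\<^sup>2)\<bar>"
      unfolding h_def using x y that by (intro curvature_lipschitz) auto
    also have "ln (1 / x\<^sup>2 * u\<^sup>2) - ln (1 / y\<^sup>2 * u\<^sup>2) = 2 * (ln y - ln x)"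
      using x y that by (simp add: ln_mult ln_div ln_realpow)
    also have "\<bar>2 * (ln y - ln x)\<bar> = 2 * \<bar>ln x - ln y\<bar>"
      unfolding abs_mult abs_minus_commute[of "ln y"] by simp
    finally show ?thesis by simp
  qed
  have m: "set_borel_measurable lborel {0<..} (\<lambda>u. h x u - h y u)"
    using curvature_measurable[OF x] curvature_measurable[OF y]
    unfolding set_borel_measurable_def h_def by (simp add: right_diff_distrib)
  have "ladder_weight x - ladder_weight y = 1 / pi * ((LBINT u:{0<..}. (1 - cos u) / u\<^sup>2 * h x u) - (LBINT u:{0<..}. (1 - cos u) / u\<^sup>2 * h y u))"
    by (simp add: ladder_weight_def h_def right_diff_distrib)
  also have "\<dots> = 1 / pi * (LBINT u:{0<..}. (1 - cos u) / u\<^sup>2 * (h x u - h y u))"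
    using set_integral_diff(2)[OF i[OF x] i[OF y]] by (simp add: right_diff_distrib)
  finally have "\<bar>ladder_weight x - ladder_weight y\<bar> = 1 / pi * \<bar>LBINT u:{0<..}. (1 - cos u) / u\<^sup>2 * (h x u - h y u)\<bar>"
    by (simp add: abs_mult)
  also have "\<dots> \<le> 1 / pi * ((3 * (600 * \<bar>ln x - ln y\<bar>)) * (pi / 2))"
    by (intro mult_left_mono oscillatory_bound(2) m b) auto
  finally show ?thesis by simp
qed

lemma continuous_on_ladder_weight: "continuous_on {0<..} ladder_weight"
proof (intro continuous_at_imp_continuous_on ballI)
  fix x :: real assume "x \<in> {0<..}"
  then have x: "0 < x" by simp
  have "((\<lambda>y. 900 * \<bar>ln y - ln x\<bar>) \<longlongrightarrow> 900 * \<bar>ln x - ln x\<bar>) (at x)"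
    using x by (intro tendsto_intros) auto
  then have l: "((\<lambda>y. 900 * \<bar>ln y - ln x\<bar>) \<longlongrightarrow> 0) (at x)" by simp
  have "\<forall>\<^sub>F y in at x. norm (ladder_weight y - ladder_weight x) \<le> 900 * \<bar>ln y - ln x\<bar>"
    using eventually_at_in_open'[of "{0<..}" x] x
    by (auto elim!: eventually_mono intro!: ladder_weight_lipschitz)
  then have "((\<lambda>y. ladder_weight y - ladder_weight x) \<longlongrightarrow> 0) (at x)"
    by (rule Lim_null_comparison[OF _ l])
  then show "isCont ladder_weight x" unfolding isCont_def by (simp add: LIM_zero_iff)
qed

lemma ladder_weight_measurable: "(\<lambda>x. indicator {0<..} x * ladder_weight x) \<in> borel_measurable borel"
  using borel_measurable_continuous_on_indicator[OF _ continuous_on_ladder_weight] by simp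

text \<open>The form before the substitution, in which \<open>x\<close> occurs in the cosine only and Fubini
  applies.\<close>

lemma ladder_weight_eq:
  assumes x: "0 < x"
  shows "x * ladder_weight x = 1 / pi * (LBINT \<theta>:{0<..}. (1 - cos (x * \<theta>)) / \<theta>\<^sup>2 * curvature (\<theta>\<^sup>2))"
proof -
  have "ladder_weight x = 1 / pi * (x * (LBINT \<theta>:{0<..}. (1 - cos (x * \<theta>)) / (x * \<theta>)\<^sup>2 * curvature (1 / x\<^sup>2 * (x * \<theta>)\<^sup>2)))"
    unfolding ladder_weight_def by (subst set_integral_scale_pos[OF x]) simp
  also have "(\<lambda>\<theta>. (1 - cos (x * \<theta>)) / (x * \<theta>)\<^sup>2 * curvature (1 / x\<^sup>2 * (x * \<theta>)\<^sup>2))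
     = (\<lambda>\<theta>. 1 / x\<^sup>2 * ((1 - cos (x * \<theta>)) / \<theta>\<^sup>2 * curvature (\<theta>\<^sup>2)))"
    using x by (simp add: power_mult_distrib mult_ac)
  finally have "ladder_weight x = 1 / pi * (x * (1 / x\<^sup>2 * (LBINT \<theta>:{0<..}. (1 - cos (x * \<theta>)) / \<theta>\<^sup>2 * curvature (\<theta>\<^sup>2))))"
    by (simp only: set_integral_mult_right)
  then show ?thesis using x by (simp add: power2_eq_square)
qed

text \<open>Fubini for the integrals over \<open>\<theta>\<close> and \<open>x\<close>, with \<open>laplace_one_minus_cos\<close> for the inner one.
  The substitution \<open>\<theta> = a * t\<close> turns the result into the integral for the second derivative.\<close>

lemma laplace_ident_ladder_weight:
  assumes a: "0 < a"
  shows "(LBINT x:{0<..}. exp (- a * x) * (x * ladder_weight x)) = - log_kappa'' a"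
proof -
  define c where "c \<theta> = indicator {0<..} \<theta> * curvature (\<theta>\<^sup>2)" for \<theta>
  have [measurable]: "c \<in> borel_measurable borel"
    using measurable_comp_square[OF continuous_on_curvature, of 1]
    by (simp add: c_def[abs_def] set_borel_measurable_def)
  define f where "f = (\<lambda>(\<theta>, x). c \<theta> / \<theta>\<^sup>2 * (indicator {0<..} x *\<^sub>R (exp (- a * x) * (1 - cos (\<theta> * x)))))"
  have fm: "f \<in> borel_measurable (lborel \<Otimes>\<^sub>M lborel)"
    unfolding f_def by measurable
  have ix: "integrable lborel (\<lambda>x. indicator {0<..} x *\<^sub>R (exp (- a * x) * (1 - cos (\<theta> * x))))" for \<theta>
    using laplace_one_minus_cos(1)[OF a, of \<theta>] by (simp add: set_integrable_def)
  have vx: "(LBINT x. indicator {0<..} x *\<^sub>R (exp (- a * x) * (1 - cos (\<theta> * x)))) = \<theta>\<^sup>2 / (a * (a\<^sup>2 + \<theta>\<^sup>2))" for \<theta>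
    using laplace_one_minus_cos(2)[OF a, of \<theta>] by (simp add: set_lebesgue_integral_def)
  have c0: "c \<theta> / \<theta>\<^sup>2 * (\<theta>\<^sup>2 / (a * (a\<^sup>2 + \<theta>\<^sup>2))) = c \<theta> / (a * (a\<^sup>2 + \<theta>\<^sup>2))" for \<theta>
    by (simp add: c_def indicator_def)
  have inner: "(LBINT x. f (\<theta>, x)) = c \<theta> / (a * (a\<^sup>2 + \<theta>\<^sup>2))" for \<theta>
    unfolding f_def prod.case integral_mult_right_zero vx c0 ..
  have inner_abs: "(LBINT x. norm (f (\<theta>, x))) = \<bar>c \<theta>\<bar> / (a * (a\<^sup>2 + \<theta>\<^sup>2))" for \<theta>
  proof -
    have "norm (f (\<theta>, x)) = \<bar>c \<theta>\<bar> / \<theta>\<^sup>2 * (indicator {0<..} x *\<^sub>R (exp (- a * x) * (1 - cos (\<theta> * x))))" for x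
      by (simp add: f_def abs_mult)
    then have "(LBINT x. norm (f (\<theta>, x))) = \<bar>c \<theta>\<bar> / \<theta>\<^sup>2 * (\<theta>\<^sup>2 / (a * (a\<^sup>2 + \<theta>\<^sup>2)))"
      by (simp only: integral_mult_right_zero vx)
    then show ?thesis by (simp add: c_def indicator_def)
  qed
  have scale: "(LBINT \<theta>:{0<..}. g (\<theta>\<^sup>2) / (a * (a\<^sup>2 + \<theta>\<^sup>2))) = (LBINT t:{0<..}. (g (a\<^sup>2 * t\<^sup>2) / a\<^sup>2) / (1 + t\<^sup>2))" for g :: "real \<Rightarrow> real"
  proof -
    have "(\<lambda>t. g ((a * t)\<^sup>2) / (a * (a\<^sup>2 + (a * t)\<^sup>2))) = (\<lambda>t. 1 / a * (g (a\<^sup>2 * t\<^sup>2) / a\<^sup>2 / (1 + t\<^sup>2)))"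
    proof
      fix t :: real
      have "a * (a\<^sup>2 + (a * t)\<^sup>2) = a * (a\<^sup>2 * (1 + t\<^sup>2))" by (simp add: algebra_simps power_mult_distrib)
      then show "g ((a * t)\<^sup>2) / (a * (a\<^sup>2 + (a * t)\<^sup>2)) = 1 / a * (g (a\<^sup>2 * t\<^sup>2) / a\<^sup>2 / (1 + t\<^sup>2))"
        by (simp add: power_mult_distrib)
    qed
    then show ?thesis using a by (subst set_integral_scale_pos[OF a]) (simp only: set_integral_mult_right, simp)
  qed
  have ic: "integrable lborel (\<lambda>\<theta>. \<bar>c \<theta>\<bar> / (a * (a\<^sup>2 + \<theta>\<^sup>2)))"
  proof -
    have "set_integrable lborel {0<..} (\<lambda>t. (\<bar>curvature (t\<^sup>2)\<bar> * (1 + t\<^sup>2) / (a * (a\<^sup>2 + t\<^sup>2))) / (1 + t\<^sup>2))"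
    proof (rule integral_inverse_square_bound(1)[where C="32 * (1 / a + 1 / a ^ 3)"])
      have "(\<lambda>t. \<bar>c t\<bar> * (1 + t\<^sup>2) / (a * (a\<^sup>2 + t\<^sup>2))) \<in> borel_measurable lborel" by measurable
      then show "set_borel_measurable lborel {0<..} (\<lambda>t. \<bar>curvature (t\<^sup>2)\<bar> * (1 + t\<^sup>2) / (a * (a\<^sup>2 + t\<^sup>2)))"
        by (simp add: set_borel_measurable_def c_def abs_mult mult_ac)
      fix t :: real assume t: "0 < t"
      have "1 + t\<^sup>2 \<le> (1 / a + 1 / a ^ 3) * (a * (a\<^sup>2 + t\<^sup>2))"
      proof -
        have "(1 / a + 1 / a ^ 3) * (a * (a\<^sup>2 + t\<^sup>2)) = a\<^sup>2 + t\<^sup>2 + 1 + t\<^sup>2 / a\<^sup>2"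
          using a by (simp add: field_simps power3_eq_cube power2_eq_square)
        then show ?thesis using a by (simp add: add_increasing2)
      qed
      then have "(1 + t\<^sup>2) / (a * (a\<^sup>2 + t\<^sup>2)) \<le> 1 / a + 1 / a ^ 3"
        using a by (intro mult_imp_div_pos_le) (auto simp: add_pos_nonneg)
      then have "\<bar>curvature (t\<^sup>2)\<bar> * ((1 + t\<^sup>2) / (a * (a\<^sup>2 + t\<^sup>2))) \<le> 32 * (1 / a + 1 / a ^ 3)"
        using curvature_bound[of "t\<^sup>2"] t a by (intro mult_mono) auto
      then show "\<bar>\<bar>curvature (t\<^sup>2)\<bar> * (1 + t\<^sup>2) / (a * (a\<^sup>2 + t\<^sup>2))\<bar> \<le> 32 * (1 / a + 1 / a ^ 3)"
        using a by (simp add: abs_mult)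
    qed
    moreover have "(\<bar>curvature (t\<^sup>2)\<bar> * (1 + t\<^sup>2) / (a * (a\<^sup>2 + t\<^sup>2))) / (1 + t\<^sup>2) = \<bar>curvature (t\<^sup>2)\<bar> / (a * (a\<^sup>2 + t\<^sup>2))" for t
    proof -
      have "1 + t\<^sup>2 \<noteq> 0" by (smt (verit) zero_le_power2)
      then show ?thesis by simp
    qed
    ultimately show ?thesis by (simp add: set_integrable_def c_def abs_mult)
  qed
  have fi: "integrable (lborel \<Otimes>\<^sub>M lborel) f"
  proof (rule lborel_pair.Fubini_integrable[OF fm])
    show "integrable lborel (\<lambda>\<theta>. LBINT x. norm (f (\<theta>, x)))" unfolding inner_abs by (rule ic)
    show "AE \<theta> in lborel. integrable lborel (\<lambda>x. f (\<theta>, x))"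
      unfolding f_def prod.case by (intro AE_I2 integrable_mult_right ix)
  qed
  have "(LBINT x. LBINT \<theta>. f (\<theta>, x)) = (LBINT \<theta>. LBINT x. f (\<theta>, x))"
    using lborel_pair.Fubini_integral[of "\<lambda>\<theta> x. f (\<theta>, x)"] fi by simp
  also have "\<dots> = (LBINT \<theta>:{0<..}. curvature (\<theta>\<^sup>2) / (a * (a\<^sup>2 + \<theta>\<^sup>2)))"
    unfolding inner by (simp add: c_def set_lebesgue_integral_def)
  also have "\<dots> = (LBINT t:{0<..}. (curvature (a\<^sup>2 * t\<^sup>2) / a\<^sup>2) / (1 + t\<^sup>2))" by (rule scale)
  also have "\<dots> = - pi * log_kappa'' a"
    unfolding log_kappa''_def by (simp add: set_lebesgue_integral_def)
  finally have 1: "(LBINT x. LBINT \<theta>. f (\<theta>, x)) = - pi * log_kappa'' a" .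
  have "(LBINT \<theta>. f (\<theta>, x)) = pi * (indicator {0<..} x *\<^sub>R (exp (- a * x) * (x * ladder_weight x)))" for x
  proof (cases "0 < x")
    case True
    have "(LBINT \<theta>. f (\<theta>, x)) = (LBINT \<theta>. exp (- a * x) * (indicator {0<..} \<theta> *\<^sub>R ((1 - cos (x * \<theta>)) / \<theta>\<^sup>2 * curvature (\<theta>\<^sup>2))))"
      using True by (simp add: f_def c_def mult_ac)
    also have "\<dots> = exp (- a * x) * (LBINT \<theta>:{0<..}. (1 - cos (x * \<theta>)) / \<theta>\<^sup>2 * curvature (\<theta>\<^sup>2))"
      by (simp only: integral_mult_right_zero set_lebesgue_integral_def)
    finally show ?thesis using True ladder_weight_eq[OF True] by simp
  qed (simp add: f_def)
  then have "(LBINT x. LBINT \<theta>. f (\<theta>, x)) = pi * (LBINT x:{0<..}. exp (- a * x) * (x * ladder_weight x))"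
    by (simp only: integral_mult_right_zero set_lebesgue_integral_def)
  then have "pi * (LBINT x:{0<..}. exp (- a * x) * (x * ladder_weight x)) = pi * (- log_kappa'' a)"
    using 1 by simp
  then show ?thesis unfolding mult_cancel_left using pi_neq_zero by blast
qed

end

section \<open>Laplace transforms\<close>

text \<open>Of the decay \<open>exp (- (a / 2) * x)\<close> one half absorbs the factor \<open>x\<close> and the other half
  remains. The bound is uniform in \<open>y\<close>, so it dominates derivatives of Laplace transforms near
  \<open>a\<close>.\<close>

lemma ident_exp_le:
  fixes a x y :: real
  assumes a: "0 < a" and x: "0 < x" and y: "a / 2 < y"
  shows "x * exp (- y * x) \<le> 4 / a * exp (- (a / 4) * x)"
proof -
  have "x * exp (- y * x) \<le> x * exp (- (a / 2) * x)"
    using x y by (intro mult_left_mono) auto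
  also have "\<dots> = 4 / a * ((a / 4 * x) ^ 1 * exp (- (a / 4 * x))) * exp (- (a / 4) * x)"
    using a by (simp add: exp_add[symmetric] mult.assoc)
  also have "\<dots> \<le> 4 / a * 1 * exp (- (a / 4) * x)"
    using power_exp_minus_le[of "a / 4 * x" 1] a x by (intro mult_right_mono mult_left_mono) auto
  finally show ?thesis by simp
qed

lemma laplace_one:
  fixes a :: real assumes a: "0 < a"
  shows "set_integrable lborel {0<..} (\<lambda>x. exp (- a * x))" "(LBINT x:{0<..}. exp (- a * x)) = 1 / a"
proof -
  have l0: "((\<lambda>x. - (1 / a) * exp (- a * x)) \<longlongrightarrow> - (1 / a) * exp (- a * 0)) (at_right 0)"
    by (intro tendsto_intros)
  have "filterlim (\<lambda>x. - a * x) at_bot at_top"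
    using a by (intro filterlim_tendsto_neg_mult_at_bot[OF tendsto_const _ filterlim_ident]) auto
  then have l1: "((\<lambda>x. - (1 / a) * exp (- a * x)) \<longlongrightarrow> - (1 / a) * 0) at_top"
    by (intro tendsto_intros filterlim_compose[OF exp_at_bot])
  have d: "((\<lambda>x. - (1 / a) * exp (- a * x)) has_real_derivative exp (- a * x)) (at x)" for x
    using a by (auto intro!: derivative_eq_intros)
  show "set_integrable lborel {0<..} (\<lambda>x. exp (- a * x))"
    by (rule set_integrable_FTC_greaterThan(1)[OF d _ _ l0 l1]) (auto intro!: continuous_intros)
  have "(LBINT x:{0<..}. exp (- a * x)) = - (1 / a) * 0 - (- (1 / a) * exp (- a * 0))"
    by (rule set_integrable_FTC_greaterThan(2)[OF d _ _ l0 l1]) (auto intro!: continuous_intros)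
  then show "(LBINT x:{0<..}. exp (- a * x)) = 1 / a" by simp
qed

lemma laplace_bounded_integrable:
  fixes a :: real
  assumes a: "0 < a" and h: "set_borel_measurable lborel {0<..} h" and le: "\<And>x. 0 < x \<Longrightarrow> \<bar>h x\<bar> \<le> C"
  shows "set_integrable lborel {0<..} (\<lambda>x. exp (- a * x) * h x)"
    and "\<bar>LBINT x:{0<..}. exp (- a * x) * h x\<bar> \<le> C / a"
proof -
  have i: "set_integrable lborel {0<..} (\<lambda>x. C * exp (- a * x))"
    using laplace_one(1)[OF a] by (rule set_integrable_mult_right)
  have b: "\<bar>exp (- a * x) * h x\<bar> \<le> C * exp (- a * x)" if "0 < x" for x
    using le[OF that] by (simp add: abs_mult)
  show j: "set_integrable lborel {0<..} (\<lambda>x. exp (- a * x) * h x)"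
    using i
  proof (rule set_integrable_bound)
    have "(\<lambda>x. exp (- a * x) * (indicator {0<..} x *\<^sub>R h x)) \<in> borel_measurable lborel"
      using h unfolding set_borel_measurable_def by measurable
    then show "set_borel_measurable lborel {0<..} (\<lambda>x. exp (- a * x) * h x)"
      by (simp add: set_borel_measurable_def mult_ac)
    show "AE x in lborel. x \<in> {0<..} \<longrightarrow> norm (exp (- a * x) * h x) \<le> norm (C * exp (- a * x))"
      using b by (intro AE_I2) (metis abs_ge_self greaterThan_iff order_trans real_norm_def)
  qed
  have "\<bar>LBINT x:{0<..}. exp (- a * x) * h x\<bar> \<le> (LBINT x:{0<..}. \<bar>exp (- a * x) * h x\<bar>)"
    using set_integral_norm_bound[OF j] by simp
  also have "\<dots> \<le> (LBINT x:{0<..}. C * exp (- a * x))"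
    by (intro set_integral_mono i set_integrable_abs[OF j] b) simp
  also have "\<dots> = C / a" unfolding set_integral_mult_right laplace_one(2)[OF a] by simp
  finally show "\<bar>LBINT x:{0<..}. exp (- a * x) * h x\<bar> \<le> C / a" .
qed

context levy_exponent begin

lemma laplace_ladder_weight_integrable:
  "0 < a \<Longrightarrow> set_integrable lborel {0<..} (\<lambda>x. exp (- a * x) * ladder_weight x)"
  "0 < a \<Longrightarrow> \<bar>LBINT x:{0<..}. exp (- a * x) * ladder_weight x\<bar> \<le> 48 / a"
proof -
  have m: "set_borel_measurable lborel {0<..} ladder_weight"
    using ladder_weight_measurable by (simp add: set_borel_measurable_def)
  show "0 < a \<Longrightarrow> set_integrable lborel {0<..} (\<lambda>x. exp (- a * x) * ladder_weight x)"
    by (rule laplace_bounded_integrable(1)[OF _ m ladder_weight_bound])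
  show "0 < a \<Longrightarrow> \<bar>LBINT x:{0<..}. exp (- a * x) * ladder_weight x\<bar> \<le> 48 / a"
    by (rule laplace_bounded_integrable(2)[OF _ m ladder_weight_bound])
qed

text \<open>By \<open>laplace_ident_ladder_weight\<close> both sides have the same derivative in \<open>a\<close>. Their
  difference is constant, and both are \<open>O (1 / a)\<close> as \<open>a\<close> grows.\<close>

lemma laplace_ladder_weight:
  assumes a: "0 < a"
  shows "(LBINT x:{0<..}. exp (- a * x) * ladder_weight x) = log_kappa' a"
proof -
  define B where "B a = (LBINT x:{0<..}. exp (- a * x) * ladder_weight x)" for a
  have der: "(B has_real_derivative log_kappa'' a) (at a)" if a: "0 < a" for a
  proof -
    have "((\<lambda>a. LBINT x:{0<..}. exp (- a * x) * ladder_weight x) has_real_derivative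
      (LBINT x:{0<..}. - (exp (- a * x) * (x * ladder_weight x)))) (at a)"
    proof (rule has_real_derivative_set_integral(1)[where a="a/2" and b="2*a"
        and G="\<lambda>x. 48 * (4 / a) * exp (- (a / 4) * x)"])
      show "set_integrable lborel {0<..} (\<lambda>x. 48 * (4 / a) * exp (- (a / 4) * x))"
        using laplace_one(1)[of "a / 4"] a by (intro set_integrable_mult_right) auto
      fix y x :: real assume y: "y \<in> {a / 2<..<2 * a}" and x: "x \<in> {0<..}"
      show "((\<lambda>y. exp (- y * x) * ladder_weight x) has_real_derivative - (exp (- y * x) * (x * ladder_weight x))) (at y)"
        by (auto intro!: derivative_eq_intros)
      have P: "x * exp (- y * x) \<le> 4 / a * exp (- (a / 4) * x)"
        using a x y by (intro ident_exp_le) auto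
      have "x * exp (- y * x) * \<bar>ladder_weight x\<bar> \<le> 4 / a * exp (- (a / 4) * x) * 48"
        using x a by (intro mult_mono[OF P ladder_weight_bound]) simp_all
      then show "\<bar>- (exp (- y * x) * (x * ladder_weight x))\<bar> \<le> 48 * (4 / a) * exp (- (a / 4) * x)"
        using x by (simp add: abs_mult mult_ac)
    qed (use a laplace_ladder_weight_integrable in auto)
    moreover have "(LBINT x:{0<..}. - (exp (- a * x) * (x * ladder_weight x))) = log_kappa'' a"
      using laplace_ident_ladder_weight[OF a] by (simp add: set_lebesgue_integral_def)
    ultimately show ?thesis by (simp add: B_def[abs_def])
  qed
  have "((\<lambda>a. B a - log_kappa' a) has_real_derivative 0) (at x within {0<..})" if "x \<in> {0<..}" for x
    using DERIV_diff[OF der[of x] log_kappa'_has_derivative[of x]] that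
    by (auto intro: has_field_derivative_at_within)
  then obtain c where c: "\<And>x. 0 < x \<Longrightarrow> B x - log_kappa' x = c"
    using has_field_derivative_zero_constant[of "{0<..}" "\<lambda>a. B a - log_kappa' a"] by auto
  \<comment> \<open>\<open>50 = 48 + 2\<close> adds the bounds for the two sides.\<close>
  have "\<bar>c\<bar> * x \<le> 50" if "0 < x" for x
  proof -
    have "\<bar>c\<bar> \<le> \<bar>B x\<bar> + \<bar>log_kappa' x\<bar>" using c[OF that] by linarith
    also have "\<dots> \<le> 48 / x + 2 / x"
      unfolding B_def using that by (intro add_mono laplace_ladder_weight_integrable(2) log_kappa'_bound)
    also have "\<dots> = 50 / x" by simp
    finally show ?thesis using that by (simp add: field_simps)
  qed
  from this[of "51 / \<bar>c\<bar>"] have "c = 0" by (cases "c = 0") auto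
  then show ?thesis using c[OF a] by (simp add: B_def)
qed

end

text \<open>In the variable \<open>exp (- t)\<close> the transforms at \<open>a = 1, 2, \<dots>\<close> are the moments of signed
  measures on the unit interval. By Weierstrass approximation they determine the integrals of
  continuous functions, and approximation of the indicator of an interval finishes the proof. The
  two base measures may differ, so that \<open>t dV\<close> can be compared with a density.\<close>

lemma laplace_transform_unique:
  fixes M N :: "real measure" and f g :: "real \<Rightarrow> real"
  assumes sets: "sets M = sets borel" "sets N = sets borel"
    and meas: "f \<in> borel_measurable borel" "g \<in> borel_measurable borel"
    and pos: "\<And>t. t < 0 \<Longrightarrow> f t = 0" "\<And>t. t < 0 \<Longrightarrow> g t = 0"
    and int: "\<And>a. 0 < a \<Longrightarrow> integrable M (\<lambda>t. exp (- a * t) * f t)"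
      "\<And>a. 0 < a \<Longrightarrow> integrable N (\<lambda>t. exp (- a * t) * g t)"
    and eq: "\<And>a. 0 < a \<Longrightarrow> (\<integral>t. exp (- a * t) * f t \<partial>M) = (\<integral>t. exp (- a * t) * g t \<partial>N)"
  shows "(\<integral>t. indicator {p..q} t * f t \<partial>M) = (\<integral>t. indicator {p..q} t * g t \<partial>N)"
proof -
  have int1: "integrable M (\<lambda>t. exp (- t) * f t)" "integrable N (\<lambda>t. exp (- t) * g t)"
    using int[of 1] by simp_all
  \<comment> \<open>The additional factor \<open>exp (- t)\<close> makes \<open>f\<close> and \<open>g\<close> integrable; it turns the monomial of
    degree \<open>i\<close> into the transform at \<open>i + 1\<close>.\<close>
  have cont_eq: "(\<integral>t. exp (- t) * h (exp (- t)) * f t \<partial>M) = (\<integral>t. exp (- t) * h (exp (- t)) * g t \<partial>N)"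
    if h: "continuous_on UNIV h" for h :: "real \<Rightarrow> real"
  proof -
    have hm: "h \<in> borel_measurable borel" using h by (rule borel_measurable_continuous_onI)
    have "compact (h ` {0..1})" by (intro compact_continuous_image continuous_on_subset[OF h]) auto
    then have "bounded (h ` {0..1})" by (rule compact_imp_bounded)
    then obtain K where "\<forall>x\<in>h ` {0..1}. norm x \<le> K"
      unfolding bounded_iff by blast
    then have K: "\<bar>h x\<bar> \<le> K" if "x \<in> {0..1}" for x using that by simp
    have ih: "integrable X (\<lambda>t. exp (- t) * h (exp (- t)) * u t)"
      if X: "sets X = sets borel" "u \<in> borel_measurable borel" "\<And>t. t < 0 \<Longrightarrow> u t = 0"
        "integrable X (\<lambda>t. exp (- t) * u t)" for X :: "real measure" and u :: "real \<Rightarrow> real"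
    proof (rule Bochner_Integration.integrable_bound)
      show "integrable X (\<lambda>t. K * (exp (- t) * u t))" using X(4) by simp
      show "(\<lambda>t. exp (- t) * h (exp (- t)) * u t) \<in> borel_measurable X"
        unfolding measurable_cong_sets[OF X(1) refl] using hm X(2) by measurable
      show "AE t in X. norm (exp (- t) * h (exp (- t)) * u t) \<le> norm (K * (exp (- t) * u t))"
      proof (intro AE_I2)
        fix t
        show "norm (exp (- t) * h (exp (- t)) * u t) \<le> norm (K * (exp (- t) * u t))"
        proof (cases "t < 0")
          case False
          then have "\<bar>h (exp (- t))\<bar> \<le> \<bar>K\<bar>" using K[of "exp (- t)"] by force
          then have "\<bar>h (exp (- t))\<bar> * \<bar>exp (- t) * u t\<bar> \<le> \<bar>K\<bar> * \<bar>exp (- t) * u t\<bar>"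
            by (intro mult_right_mono) auto
          then show ?thesis by (simp add: abs_mult mult_ac)
        qed (simp add: X)
      qed
    qed
    define S where "S = (\<integral>t. \<bar>exp (- t) * f t\<bar> \<partial>M) + (\<integral>t. \<bar>exp (- t) * g t\<bar> \<partial>N)"
    have S: "0 \<le> S" by (simp add: S_def)
    have *: "\<bar>(\<integral>t. exp (- t) * h (exp (- t)) * f t \<partial>M) - (\<integral>t. exp (- t) * h (exp (- t)) * g t \<partial>N)\<bar> \<le> e * S"
      if e: "0 < e" for e
    proof -
      obtain p where p: "real_polynomial_function p" "\<And>x. x \<in> {0..1} \<Longrightarrow> \<bar>h x - p x\<bar> < e"
        using Stone_Weierstrass_real_polynomial_function[of "{0..1::real}" h e] e
          continuous_on_subset[OF h, of "{0..1}"] by auto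
      obtain c n where ps: "p = (\<lambda>x. \<Sum>i\<le>n. c i * x ^ i)"
        using real_polynomial_function_imp_sum[OF p(1)] by auto
      have pe: "exp (- t) * p (exp (- t)) * u t = (\<Sum>i\<le>n. c i * (exp (- real (Suc i) * t) * u t))" for t and u :: "real \<Rightarrow> real"
      proof -
        have "exp (- real (Suc i) * t) = exp (- t) ^ Suc i" for i
          unfolding exp_of_nat_mult[symmetric] by (simp only: mult_minus_left mult_minus_right)
        then show ?thesis by (simp add: ps sum_distrib_left sum_distrib_right mult_ac)
      qed
      have ig: "integrable M (\<lambda>t. exp (- t) * p (exp (- t)) * f t)" "integrable N (\<lambda>t. exp (- t) * p (exp (- t)) * g t)"
        unfolding pe using int by (auto intro!: integrable_sum integrable_mult_right simp del: of_nat_Suc mult_minus_left)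
      have geq: "(\<integral>t. exp (- t) * p (exp (- t)) * f t \<partial>M) = (\<integral>t. exp (- t) * p (exp (- t)) * g t \<partial>N)"
      proof -
        have "(\<integral>t. c i * (exp (- real (Suc i) * t) * f t) \<partial>M) = (\<integral>t. c i * (exp (- real (Suc i) * t) * g t) \<partial>N)" for i
          unfolding integral_mult_right_zero using eq[of "real (Suc i)"] by simp
        moreover have "(\<integral>t. exp (- t) * p (exp (- t)) * f t \<partial>M) = (\<Sum>i\<le>n. \<integral>t. c i * (exp (- real (Suc i) * t) * f t) \<partial>M)"
          unfolding pe by (intro Bochner_Integration.integral_sum integrable_mult_right int) simp
        moreover have "(\<integral>t. exp (- t) * p (exp (- t)) * g t \<partial>N) = (\<Sum>i\<le>n. \<integral>t. c i * (exp (- real (Suc i) * t) * g t) \<partial>N)"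
          unfolding pe by (intro Bochner_Integration.integral_sum integrable_mult_right int) simp
        ultimately show ?thesis by (simp only:)
      qed
      have d: "\<bar>(\<integral>t. exp (- t) * h (exp (- t)) * u t \<partial>X) - (\<integral>t. exp (- t) * p (exp (- t)) * u t \<partial>X)\<bar>
          \<le> e * (\<integral>t. \<bar>exp (- t) * u t\<bar> \<partial>X)"
        if X: "sets X = sets borel" "u \<in> borel_measurable borel" "\<And>t. t < 0 \<Longrightarrow> u t = 0"
          "integrable X (\<lambda>t. exp (- t) * u t)"
          "integrable X (\<lambda>t. exp (- t) * p (exp (- t)) * u t)" for X :: "real measure" and u :: "real \<Rightarrow> real"
      proof -
        note iX = ih[OF X(1-4)]
        have "\<bar>(\<integral>t. exp (- t) * h (exp (- t)) * u t \<partial>X) - (\<integral>t. exp (- t) * p (exp (- t)) * u t \<partial>X)\<bar>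
          = \<bar>\<integral>t. exp (- t) * h (exp (- t)) * u t - exp (- t) * p (exp (- t)) * u t \<partial>X\<bar>"
          using iX X(5) by simp
        also have "\<dots> \<le> (\<integral>t. \<bar>exp (- t) * h (exp (- t)) * u t - exp (- t) * p (exp (- t)) * u t\<bar> \<partial>X)"
          by (rule integral_abs_bound)
        also have "\<dots> \<le> (\<integral>t. e * \<bar>exp (- t) * u t\<bar> \<partial>X)"
        proof (rule integral_mono)
          show "integrable X (\<lambda>t. \<bar>exp (- t) * h (exp (- t)) * u t - exp (- t) * p (exp (- t)) * u t\<bar>)"
            using iX X(5) by auto
          show "integrable X (\<lambda>t. e * \<bar>exp (- t) * u t\<bar>)" using X(4) by auto
          fix t
          show "\<bar>exp (- t) * h (exp (- t)) * u t - exp (- t) * p (exp (- t)) * u t\<bar> \<le> e * \<bar>exp (- t) * u t\<bar>"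
          proof (cases "t < 0")
            case False
            then have "\<bar>h (exp (- t)) - p (exp (- t))\<bar> \<le> e" using p(2)[of "exp (- t)"] by force
            then have "\<bar>h (exp (- t)) - p (exp (- t))\<bar> * \<bar>exp (- t) * u t\<bar> \<le> e * \<bar>exp (- t) * u t\<bar>"
              by (intro mult_right_mono) auto
            moreover have "exp (- t) * h (exp (- t)) * u t - exp (- t) * p (exp (- t)) * u t
               = (h (exp (- t)) - p (exp (- t))) * (exp (- t) * u t)" by (simp add: algebra_simps)
            ultimately show ?thesis by (simp only: abs_mult)
          qed (simp add: X)
        qed
        finally show ?thesis by simp
      qed
      show ?thesis
        using d[OF sets(1) meas(1) pos(1) int1(1) ig(1)] d[OF sets(2) meas(2) pos(2) int1(2) ig(2)] geq
        unfolding S_def distrib_left abs_le_iff by linarith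
    qed
    have "\<bar>(\<integral>t. exp (- t) * h (exp (- t)) * f t \<partial>M) - (\<integral>t. exp (- t) * h (exp (- t)) * g t \<partial>N)\<bar> \<le> 0"
    proof (rule field_le_epsilon)
      fix d :: real assume "0 < d"
      note that = this
      have "\<bar>(\<integral>t. exp (- t) * h (exp (- t)) * f t \<partial>M) - (\<integral>t. exp (- t) * h (exp (- t)) * g t \<partial>N)\<bar> \<le> d / (S + 1) * S"
        using that S by (intro *) auto
      also have "\<dots> \<le> d" using that S by (simp add: field_simps)
      finally show "\<bar>(\<integral>t. exp (- t) * h (exp (- t)) * f t \<partial>M) - (\<integral>t. exp (- t) * h (exp (- t)) * g t \<partial>N)\<bar> \<le> 0 + d"
        by simp
    qed
    then show ?thesis by simp
  qed
  \<comment> \<open>Continuous functions that decrease to the indicator of \<open>{p..q}\<close>.\<close>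
  define k where "k n t = max 0 (1 - real (Suc n) * max 0 (max (p - t) (t - q)))" for n :: nat and t
  define c where "c = exp (- (q + 1))"
  have c: "0 < c" by (simp add: c_def)
  have k0: "k n t = 0" if "q + 1 \<le> t" for n t
  proof -
    have "1 * 1 \<le> real (Suc n) * max 0 (max (p - t) (t - q))" using that by (intro mult_mono) auto
    then show ?thesis by (simp add: k_def)
  qed
  have k1: "0 \<le> k n t" "k n t \<le> 1" for n t by (auto simp: k_def)
  have kc: "continuous_on UNIV (k n)" for n
    unfolding k_def by (intro continuous_intros)
  have km: "k n \<in> borel_measurable borel" for n
    using kc by (rule borel_measurable_continuous_onI)
  \<comment> \<open>Chosen such that \<open>exp (- t) * h n (exp (- t)) = k n t\<close>. Replacing \<open>x\<close> by \<open>max x c\<close> keeps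
    \<open>h n\<close> continuous at \<open>0\<close> and changes nothing, as \<open>k n\<close> vanishes beyond \<open>q + 1\<close>.\<close>
  define h where "h n x = k n (- ln (max x c)) / max x c" for n x
  have hc: "continuous_on UNIV (h n)" for n
    unfolding h_def using c
    by (intro continuous_intros continuous_on_compose2[OF kc]) auto
  have kh: "exp (- t) * h n (exp (- t)) = k n t" for n t
  proof (cases "t \<le> q + 1")
    case True
    then have "max (exp (- t)) c = exp (- t)" by (intro max_absorb1) (simp add: c_def)
    then show ?thesis by (simp add: h_def)
  next
    case False
    then have "max (exp (- t)) c = c" by (intro max_absorb2) (simp add: c_def)
    then show ?thesis using False k0[of t n] k0[of "1 + q" n] by (simp add: h_def c_def)
  qed
  have kint: "(\<integral>t. k n t * f t \<partial>M) = (\<integral>t. k n t * g t \<partial>N)" for n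
    using cont_eq[OF hc[of n]] unfolding kh .
  have klim: "(\<lambda>n. k n t) \<longlonglongrightarrow> indicator {p..q} t" for t
  proof (cases "t \<in> {p..q}")
    case True then show ?thesis by (simp add: k_def)
  next
    case False
    define m where "m = max 0 (max (p - t) (t - q))"
    have m: "0 < m" using False by (auto simp: m_def)
    obtain n0 where n0: "1 / m < real n0" using reals_Archimedean2 by blast
    have "k n t = 0" if "n0 \<le> n" for n
    proof -
      have "1 / m < real (Suc n)" using n0 that by linarith
      then have "1 \<le> real (Suc n) * m" using m by (simp add: field_simps)
      then show ?thesis by (simp add: k_def m_def)
    qed
    then have "eventually (\<lambda>n. k n t = 0) sequentially" by (auto simp: eventually_sequentially)
    then show ?thesis using False by (simp add: tendsto_eventually)
  qed
  have lim: "(\<lambda>n. \<integral>t. k n t * u t \<partial>X) \<longlonglongrightarrow> (\<integral>t. indicator {p..q} t * u t \<partial>X)"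
    if X: "sets X = sets borel" "u \<in> borel_measurable borel" "integrable X (\<lambda>t. exp (- t) * u t)"
    for X :: "real measure" and u :: "real \<Rightarrow> real"
  proof (rule integral_dominated_convergence[where w="\<lambda>t. exp (q + 1) * \<bar>exp (- t) * u t\<bar>"])
    show "AE t in X. norm (k n t * u t) \<le> exp (q + 1) * \<bar>exp (- t) * u t\<bar>" for n
    proof (intro AE_I2)
      fix t show "norm (k n t * u t) \<le> exp (q + 1) * \<bar>exp (- t) * u t\<bar>"
      proof (cases "q + 1 \<le> t")
        case False
        then have "1 \<le> exp (q + 1 - t)" by simp
        then have "k n t \<le> exp (q + 1 - t)" using k1[of n t] by linarith
        also have "\<dots> = exp (q + 1) * exp (- t)" by (simp add: exp_add[symmetric])
        finally have "k n t \<le> exp (q + 1) * exp (- t)" .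
        then have "k n t * \<bar>u t\<bar> \<le> exp (q + 1) * exp (- t) * \<bar>u t\<bar>" by (intro mult_right_mono) auto
        then show ?thesis using k1[of n t] by (simp add: abs_mult mult_ac)
      qed (simp add: k0)
    qed
    show "AE t in X. (\<lambda>n. k n t * u t) \<longlonglongrightarrow> indicator {p..q} t * u t"
      by (intro AE_I2 tendsto_mult klim tendsto_const)
    show "(\<lambda>t. indicator {p..q} t * u t) \<in> borel_measurable X" "(\<lambda>t. k n t * u t) \<in> borel_measurable X" for n
      unfolding measurable_cong_sets[OF X(1) refl] using km X(2) by measurable
    show "integrable X (\<lambda>t. exp (q + 1) * \<bar>exp (- t) * u t\<bar>)" using X(3) by auto
  qed
  show ?thesis
    using LIMSEQ_unique[OF lim[OF sets(1) meas(1) int1(1), unfolded kint] lim[OF sets(2) meas(2) int1(2)]] .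
qed

section \<open>The renewal measure as a convolution\<close>

locale ladder_renewal = levy_exponent +
  fixes V :: "real \<Rightarrow> real"
  assumes renewal: "renewal_function \<phi> V"
begin

abbreviation dV :: "real measure" where "dV \<equiv> interval_measure V"

lemma V_nonpos: "t \<le> 0 \<Longrightarrow> V t = 0"
  using renewal by (auto simp: renewal_function_def)

lemma V_strict_mono: "0 \<le> s \<Longrightarrow> s < t \<Longrightarrow> V s < V t"
  using renewal by (auto simp: renewal_function_def strict_mono_on_def)

lemma V_pos: "0 < t \<Longrightarrow> 0 < V t"
  using V_strict_mono[of 0 t] V_nonpos[of 0] by simp

lemma V_mono: "x \<le> y \<Longrightarrow> V x \<le> V y"
  using V_nonpos[of x] V_nonpos[of y] V_pos[of y] V_strict_mono[of x y]
  by (cases "x \<le> 0"; cases "y \<le> 0"; cases "x = y") auto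

lemma V_nonneg: "0 \<le> V t"
  using V_nonpos[of t] V_pos[of t] by (cases "t \<le> 0") auto

lemma V_cont: "continuous_on UNIV V"
proof -
  have "continuous_on {..0} V" using V_nonpos by (subst continuous_on_cong[where g="\<lambda>_. 0"]) auto
  moreover have "continuous_on {0..} V" using renewal by (simp add: renewal_function_def)
  ultimately have "continuous_on ({..0} \<union> {0..}) V" by (intro continuous_on_closed_Un) auto
  moreover have "{..0} \<union> {0..} = (UNIV :: real set)" by auto
  ultimately show ?thesis by simp
qed

lemma V_right_cont: "continuous (at_right a) V"
  using V_cont by (auto simp: continuous_on_eq_continuous_within intro: continuous_within_subset)

lemma emeasure_dV_Icc: "a \<le> b \<Longrightarrow> emeasure dV {a..b} = ennreal (V b - V a)"
  by (intro emeasure_interval_measure_Icc V_mono V_cont)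

lemma emeasure_dV_Ioc: "a \<le> b \<Longrightarrow> emeasure dV {a<..b} = ennreal (V b - V a)"
  by (intro emeasure_interval_measure_Ioc V_mono V_right_cont)

lemma measure_dV_Icc: "a \<le> b \<Longrightarrow> measure dV {a..b} = V b - V a"
  using V_mono[of a b] by (simp add: measure_def emeasure_dV_Icc)

lemma AE_dV_pos: "AE t in dV. 0 < t"
proof -
  have "AE t in dV. t \<notin> {- real n..0}" for n
    by (rule AE_not_in) (auto simp: null_sets_def emeasure_dV_Icc V_nonpos)
  then have "AE t in dV. \<forall>n. t \<notin> {- real n..0}" by (intro AE_all_countable[THEN iffD2] allI)
  then show ?thesis
  proof eventually_elim
    case (elim t)
    obtain n where "- t \<le> real n" using real_arch_simple by blast
    then show ?case using elim[rule_format, of n] by auto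
  qed
qed

lemma AE_dV_neq: "AE t in dV. t \<noteq> c"
  using AE_not_in[of "{c}" dV] emeasure_dV_Icc[of c c] by (auto simp: null_sets_def)

text \<open>The prescribed transform is positive, and the Bochner integral of a non-integrable function
  is \<open>0\<close>; hence the exponentials are integrable. The origin carries no mass because \<open>V\<close> is
  continuous.\<close>

lemma dV_laplace:
  assumes a: "0 < a"
  shows "set_integrable dV {0<..} (\<lambda>t. exp (- a * t))" "(LINT t:{0<..}|dV. exp (- a * t)) = exp (- log_kappa a)"
proof -
  have 1: "(LINT t:{0..}|dV. exp (- a * t)) = exp (- log_kappa a)"
    using renewal a by (auto simp: renewal_function_def ladder_exponent_eq exp_minus inverse_eq_divide)
  have i: "integrable dV (\<lambda>t. indicator {0..} t *\<^sub>R exp (- a * t))"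
  proof (rule ccontr)
    assume "\<not> ?thesis"
    then have "(LINT t:{0..}|dV. exp (- a * t)) = 0"
      unfolding set_lebesgue_integral_def by (rule not_integrable_integral_eq)
    then show False using 1 by simp
  qed
  have ae: "AE t in dV. indicator {0..} t *\<^sub>R exp (- a * t) = indicator {0<..} t *\<^sub>R exp (- a * t)"
    using AE_dV_pos by eventually_elim auto
  show "set_integrable dV {0<..} (\<lambda>t. exp (- a * t))"
    unfolding set_integrable_def by (rule integrable_cong_AE_imp[OF i]) (use ae in \<open>auto elim: eventually_mono\<close>)
  have "(LINT t:{0<..}|dV. exp (- a * t)) = (LINT t:{0..}|dV. exp (- a * t))"
    unfolding set_lebesgue_integral_def by (rule integral_cong_AE) (use ae in \<open>auto elim: eventually_mono\<close>)
  then show "(LINT t:{0<..}|dV. exp (- a * t)) = exp (- log_kappa a)" using 1 by simp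
qed

text \<open>Differentiation of \<open>dV_laplace\<close>; the right-hand side is \<open>- (1 / \<kappa>)'\<close>.\<close>

lemma dV_laplace_moment:
  assumes a: "0 < a"
  shows "set_integrable dV {0<..} (\<lambda>t. exp (- a * t) * t)"
    "(LINT t:{0<..}|dV. exp (- a * t) * t) = log_kappa' a * exp (- log_kappa a)"
proof -
  have i1: "set_integrable dV {0<..} (\<lambda>t. exp (- y * t))" if "y \<in> {a / 2<..<2 * a}" for y
    using dV_laplace(1)[of y] that a by simp
  have i2: "((\<lambda>y. exp (- y * t)) has_real_derivative - (exp (- y * t) * t)) (at y)" for y t :: real
    by (auto intro!: derivative_eq_intros)
  have i3: "\<bar>- (exp (- y * t) * t)\<bar> \<le> 4 / a * exp (- (a / 4) * t)"
    if "y \<in> {a / 2<..<2 * a}" "t \<in> {0<..}" for y t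
    using ident_exp_le[OF a, of t y] that by (simp add: abs_mult mult_ac)
  have i4: "set_integrable dV {0<..} (\<lambda>t. 4 / a * exp (- (a / 4) * t))"
    using dV_laplace(1)[of "a / 4"] a by (intro set_integrable_mult_right) simp
  have a': "a \<in> {a / 2<..<2 * a}" using a by simp
  have der: "((\<lambda>a. LINT t:{0<..}|dV. exp (- a * t)) has_real_derivative (LINT t:{0<..}|dV. - (exp (- a * t) * t))) (at a)"
    by (rule has_real_derivative_set_integral(1)[OF a' i1 i2 i3 i4])
  have int: "set_integrable dV {0<..} (\<lambda>t. - (exp (- a * t) * t))"
    by (rule has_real_derivative_set_integral(2)[OF a' i1 i2 i3 i4])
  have "set_integrable dV {0<..} (\<lambda>t. (-1) * - (exp (- a * t) * t))"
    using int by (rule set_integrable_mult_right)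
  then show "set_integrable dV {0<..} (\<lambda>t. exp (- a * t) * t)" by simp
  have "((\<lambda>a. exp (- log_kappa a)) has_real_derivative exp (- log_kappa a) * (- log_kappa' a)) (at a)"
    by (intro DERIV_chain2[OF DERIV_exp] DERIV_minus log_kappa_has_derivative a)
  then have "((\<lambda>a. LINT t:{0<..}|dV. exp (- a * t)) has_real_derivative exp (- log_kappa a) * (- log_kappa' a)) (at a)"
    by (rule has_field_derivative_transform_within_open[where S="{0<..}"]) (use a dV_laplace in auto)
  from DERIV_unique[OF der this]
  show "(LINT t:{0<..}|dV. exp (- a * t) * t) = log_kappa' a * exp (- log_kappa a)"
    by (simp add: set_lebesgue_integral_def mult.commute)
qed

text \<open>The ladder weight extended by \<open>0\<close> to the negative half-line, where the convolution with \<open>dV\<close>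
  must not see it.\<close>

definition W :: "real \<Rightarrow> real" where "W x = indicator {0<..} x * ladder_weight x"

definition conv :: "real \<Rightarrow> real" where
  "conv t = (LINT s|dV. indicator {0<..} s * W (t - s))"

lemma W_measurable [measurable]: "W \<in> borel_measurable borel"
  unfolding W_def[abs_def] by (rule ladder_weight_measurable)

lemma W_bound: "\<bar>W x\<bar> \<le> 48"
  using ladder_weight_bound[of x] by (auto simp: W_def indicator_def)

lemma isCont_W: "x \<noteq> 0 \<Longrightarrow> isCont W x"
proof (cases "0 < x")
  case True
  have "isCont ladder_weight x"
    using continuous_on_ladder_weight True by (simp add: continuous_on_eq_continuous_at)
  moreover have "\<forall>\<^sub>F y in nhds x. W y = ladder_weight y"
    using eventually_nhds_in_open[of "{0<..}" x] True by (auto elim!: eventually_mono simp: W_def)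
  ultimately show ?thesis using isCont_cong by blast
next
  case False
  moreover assume "x \<noteq> 0"
  ultimately have "\<forall>\<^sub>F y in nhds x. W y = 0"
    using eventually_nhds_in_open[of "{..<0}" x] by (auto elim!: eventually_mono simp: W_def)
  then show ?thesis using isCont_cong[of W "\<lambda>_. 0" x] by simp
qed

lemma conv_nonpos: "t \<le> 0 \<Longrightarrow> conv t = 0"
  unfolding conv_def by (rule integral_eq_zero_AE) (auto simp: W_def indicator_def)

lemma integrable_dV_bounded:
  assumes "f \<in> borel_measurable borel" "\<And>s. \<bar>f s\<bar> \<le> (C::real)" "\<And>s. s \<notin> {a..b} \<Longrightarrow> f s = 0"
  shows "integrable dV f"
proof (rule integrableI_bounded_set[where A="{a..b}" and B=C])
  show "emeasure dV {a..b} < \<infinity>" by (cases "a \<le> b") (auto simp: emeasure_dV_Icc)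
qed (use assms in auto)

lemma integral_dV_bound:
  assumes "f \<in> borel_measurable borel" "\<And>s. \<bar>f s\<bar> \<le> (C::real)" "\<And>s. s \<notin> {a..b} \<Longrightarrow> f s = 0" "a \<le> b"
  shows "\<bar>integral\<^sup>L dV f\<bar> \<le> C * (V b - V a)"
proof -
  have "\<bar>integral\<^sup>L dV f\<bar> \<le> (LINT s|dV. \<bar>f s\<bar>)" by (rule integral_abs_bound)
  also have "\<dots> \<le> (LINT s|dV. C * indicator {a..b} s)"
  proof (rule integral_mono)
    show "integrable dV (\<lambda>s. \<bar>f s\<bar>)"
      by (intro integrable_abs integrable_dV_bounded[OF assms(1-3)])
    show "integrable dV (\<lambda>s. C * indicator {a..b} s)"
      using assms(4) by (auto simp: emeasure_dV_Icc)
    show "\<bar>f s\<bar> \<le> C * indicator {a..b} s" for s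
      using assms(2,3)[of s] by (cases "s \<in> {a..b}") auto
  qed
  also have "\<dots> = C * (V b - V a)" using assms(4) by (simp add: measure_dV_Icc)
  finally show ?thesis .
qed

lemma conv_bound: assumes "0 < t" shows "\<bar>conv t\<bar> \<le> 48 * V t"
proof -
  have "\<bar>conv t\<bar> \<le> 48 * (V t - V 0)"
    unfolding conv_def
  proof (rule integral_dV_bound)
    show "\<bar>indicator {0<..} s * W (t - s)\<bar> \<le> 48" for s
      using W_bound[of "t - s"] by (simp add: indicator_def)
    show "indicator {0<..} s * W (t - s) = 0" if "s \<notin> {0..t}" for s
      using that by (auto simp: W_def indicator_def)
  qed (use assms in auto)
  then show ?thesis using V_nonpos[of 0] by simp
qed

text \<open>\<open>W\<close> is continuous away from \<open>0\<close>, and \<open>dV\<close> has no atom at \<open>t\<close>; dominated convergence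
  applies.\<close>

lemma isCont_conv: assumes t: "0 < t" shows "isCont conv t"
  unfolding continuous_at_sequentially comp_def
proof (intro allI impI)
  fix X assume X: "X \<longlonglongrightarrow> t"
  then have "Bseq X" by (intro convergent_imp_Bseq convergentI)
  then obtain K where "\<forall>n. norm (X n) \<le> K" by (rule BseqE)
  then have K: "\<bar>X n\<bar> \<le> K" for n by simp
  show "(\<lambda>n. conv (X n)) \<longlonglongrightarrow> conv t"
    unfolding conv_def
  proof (rule integral_dominated_convergence[where w="\<lambda>s. 48 * indicator {0..K} s"])
    have "0 \<le> K" using K[of 0] by linarith
    then show "integrable dV (\<lambda>s. 48 * indicator {0..K} s :: real)" by (auto simp: emeasure_dV_Icc)
    show "AE s in dV. norm (indicator {0<..} s * W (X n - s)) \<le> 48 * indicator {0..K} s" for n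
    proof (intro AE_I2)
      fix s
      show "norm (indicator {0<..} s * W (X n - s)) \<le> 48 * indicator {0..K} s"
      proof (cases "0 < s \<and> s < X n")
        case True
        then have "s \<in> {0..K}" using K[of n] by auto
        then show ?thesis using True W_bound[of "X n - s"] by simp
      qed (auto simp: W_def)
    qed
    show "AE s in dV. (\<lambda>n. indicator {0<..} s * W (X n - s)) \<longlonglongrightarrow> indicator {0<..} s * W (t - s)"
      using AE_dV_neq[of t]
    proof eventually_elim
      case (elim s)
      then have "isCont W (t - s)" by (intro isCont_W) auto
      then show ?case using X
        by (intro tendsto_mult tendsto_const isCont_tendsto_compose[of _ W] tendsto_diff)
    qed
  qed auto
qed

sublocale dV: sigma_finite_measure dV
  by (intro sigma_finite_interval_measure V_mono V_right_cont)

text \<open>Fubini, with the translation \<open>t = s + x\<close> in the inner integral.\<close>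

lemma conv_laplace:
  assumes a: "0 < a"
  shows "integrable lborel (\<lambda>t. exp (- a * t) * conv t)"
    "(LBINT t. exp (- a * t) * conv t) = log_kappa' a * exp (- log_kappa a)"
proof -
  interpret P: pair_sigma_finite dV lborel ..
  define f where "f = (\<lambda>(s, t). exp (- a * t) * (indicator {0<..} s * W (t - s)))"
  have fm: "f \<in> borel_measurable (dV \<Otimes>\<^sub>M lborel)"
    unfolding f_def by measurable
  have Wi: "integrable lborel (\<lambda>x. exp (- a * x) * W x)" "(LBINT x. exp (- a * x) * W x) = log_kappa' a"
    using laplace_ladder_weight_integrable(1)[OF a] laplace_ladder_weight[OF a]
    by (simp_all add: set_integrable_def set_lebesgue_integral_def W_def mult_ac)
  have shift: "exp (- a * (s + 1 * x)) * (c * W (s + 1 * x - s)) = (c * exp (- a * s)) * (exp (- a * x) * W x)" for s x c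
  proof -
    have "exp (- a * (s + 1 * x)) = exp (- a * s) * exp (- a * x)"
      by (simp add: exp_add[symmetric] algebra_simps)
    then show ?thesis by simp
  qed
  have shift': "\<bar>exp (- a * (s + 1 * x)) * (indicator {0<..} s * W (s + 1 * x - s))\<bar> = (indicator {0<..} s * exp (- a * s)) * \<bar>exp (- a * x) * W x\<bar>" for s x
    unfolding shift by (simp add: abs_mult)
  have inner_int: "integrable lborel (\<lambda>t. f (s, t))" for s
  proof -
    have "integrable lborel (\<lambda>x. f (s, s + 1 * x))"
      unfolding f_def prod.case shift using Wi(1) by (rule integrable_mult_right)
    then show ?thesis using lborel_integrable_real_affine_iff[of 1 "\<lambda>t. f (s, t)" s] by simp
  qed
  have inner: "(LBINT t. f (s, t)) = (indicator {0<..} s * exp (- a * s)) * log_kappa' a" for s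
  proof -
    have "(LBINT t. f (s, t)) = \<bar>1\<bar> *\<^sub>R (LBINT x. f (s, s + 1 * x))"
      by (rule lborel_integral_real_affine) simp
    also have "\<dots> = (indicator {0<..} s * exp (- a * s)) * log_kappa' a"
      unfolding f_def prod.case shift integral_mult_right_zero Wi(2) by simp
    finally show ?thesis .
  qed
  have inner_abs: "(LBINT t. norm (f (s, t))) = (indicator {0<..} s * exp (- a * s)) * (LBINT x. \<bar>exp (- a * x) * W x\<bar>)" for s
  proof -
    have "(LBINT t. norm (f (s, t))) = \<bar>1\<bar> *\<^sub>R (LBINT x. norm (f (s, s + 1 * x)))"
      by (rule lborel_integral_real_affine) simp
    also have "\<dots> = (indicator {0<..} s * exp (- a * s)) * (LBINT x. \<bar>exp (- a * x) * W x\<bar>)"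
      unfolding f_def prod.case real_norm_def shift' integral_mult_right_zero by simp
    finally show ?thesis .
  qed
  have ei: "integrable dV (\<lambda>s. indicator {0<..} s * exp (- a * s))" "(LINT s|dV. indicator {0<..} s * exp (- a * s)) = exp (- log_kappa a)"
    using dV_laplace[OF a] by (simp_all add: set_integrable_def set_lebesgue_integral_def)
  have fi: "integrable (dV \<Otimes>\<^sub>M lborel) f"
  proof (rule P.Fubini_integrable[OF fm])
    show "integrable dV (\<lambda>s. LBINT t. norm (f (s, t)))" unfolding inner_abs using ei(1) by (rule integrable_mult_left)
    show "AE s in dV. integrable lborel (\<lambda>t. f (s, t))" using inner_int by simp
  qed
  have fi': "integrable (dV \<Otimes>\<^sub>M lborel) (case_prod (\<lambda>s t. f (s, t)))" using fi by simp
  have eq: "(LINT s|dV. f (s, t)) = exp (- a * t) * conv t" for t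
    unfolding f_def prod.case integral_mult_right_zero conv_def ..
  show "integrable lborel (\<lambda>t. exp (- a * t) * conv t)"
    using P.integrable_snd[OF fi'] unfolding eq .
  have "(LBINT t. exp (- a * t) * conv t) = (LINT s|dV. (LBINT t. f (s, t)))"
    using P.Fubini_integral[OF fi'] unfolding eq .
  also have "\<dots> = exp (- log_kappa a) * log_kappa' a"
    unfolding inner integral_mult_left_zero ei(2) ..
  finally show "(LBINT t. exp (- a * t) * conv t) = log_kappa' a * exp (- log_kappa a)" by (simp add: mult.commute)
qed

lemma conv_measurable [measurable]: "conv \<in> borel_measurable borel"
  unfolding conv_def[abs_def] by measurable

text \<open>Both sides have the transform \<open>(log \<kappa>)' / \<kappa>\<close> by \<open>dV_laplace_moment\<close> and \<open>conv_laplace\<close>. This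
  turns the implicit description of \<open>V\<close> by its transform into a Volterra equation for the density
  of \<open>dV\<close>.\<close>

lemma dV_conv:
  assumes "0 < p" shows "(LINT t|dV. indicator {p..q} t * t) = (LBINT t. indicator {p..q} t * conv t)"
proof -
  have "(LINT t|dV. indicator {p..q} t * (indicator {0<..} t * t)) = (LBINT t. indicator {p..q} t * conv t)"
  proof (rule laplace_transform_unique)
    show "integrable dV (\<lambda>t. exp (- a * t) * (indicator {0<..} t * t))" if "0 < a" for a
      using dV_laplace_moment(1)[OF that] by (simp add: set_integrable_def mult_ac)
    show "(LINT t|dV. exp (- a * t) * (indicator {0<..} t * t)) = (LBINT t. exp (- a * t) * conv t)" if "0 < a" for a
      using dV_laplace_moment(2)[OF that] conv_laplace(2)[OF that] by (simp add: set_lebesgue_integral_def mult_ac)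
  qed (use conv_laplace(1) conv_nonpos in auto)
  moreover have "indicator {p..q} t * (indicator {0<..} t * t) = indicator {p..q} t * t" for t :: real
    using assms by (auto simp: indicator_def)
  ultimately show ?thesis by simp
qed

section \<open>The renewal density\<close>

text \<open>The density of \<open>dV\<close> according to \<open>dV_conv\<close>; it is the derivative of \<open>V\<close> by
  \<open>V_has_derivative\<close>.\<close>

definition v :: "real \<Rightarrow> real" where "v t = conv t / t"

lemma continuous_on_conv: "continuous_on {0<..} conv"
  using isCont_conv by (auto intro!: continuous_at_imp_continuous_on)

lemma conv_integral_bounds:
  assumes "0 < p" "p \<le> q"
  shows "p * (V q - V p) \<le> integral {p..q} conv" "integral {p..q} conv \<le> q * (V q - V p)"
proof -
  have "set_integrable lborel {p..q} conv"
    using assms by (intro borel_integrable_atLeastAtMost' continuous_on_subset[OF continuous_on_conv]) auto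
  then have "(LBINT t:{p..q}. conv t) = integral {p..q} conv" by (rule set_borel_integral_eq_integral)
  then have eq: "integral {p..q} conv = (LINT t|dV. indicator {p..q} t * t)"
    using dV_conv[OF assms(1), of q] by (simp add: set_lebesgue_integral_def)
  have fin: "emeasure dV {p..q} < \<infinity>" using assms by (simp add: emeasure_dV_Icc)
  have i: "integrable dV (\<lambda>t. indicator {p..q} t * t)"
    by (rule integrable_dV_bounded[where C=q and a=p and b=q]) (use assms in \<open>auto simp: indicator_def\<close>)
  have ci: "integrable dV (\<lambda>t. indicator {p..q} t * c)" for c :: real
    using fin by auto
  have cv: "(LINT t|dV. indicator {p..q} t * c) = c * (V q - V p)" for c :: real
    using assms by (simp add: measure_dV_Icc)
  show "p * (V q - V p) \<le> integral {p..q} conv" "integral {p..q} conv \<le> q * (V q - V p)"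
    unfolding eq cv[symmetric] by (intro integral_mono i ci; auto simp: indicator_def)+
qed

text \<open>By \<open>conv_integral_bounds\<close> the difference quotients of \<open>V\<close> lie between those of the
  antiderivative of \<open>conv\<close>, divided by the larger and by the smaller endpoint.\<close>

lemma V_has_derivative:
  assumes t: "0 < t"
  shows "(V has_real_derivative v t) (at t)"
proof -
  define J where "J x = integral {t/2..x} conv" for x
  have ii: "conv integrable_on {a..b}" if "0 < a" for a b
    using that by (intro integrable_continuous_real continuous_on_subset[OF continuous_on_conv]) auto
  have "(J has_real_derivative conv t) (at t within {t/2..2*t})"
    unfolding J_def[abs_def] using t
    by (intro integral_has_real_derivative continuous_on_subset[OF continuous_on_conv]) auto
  then have "(J has_real_derivative conv t) (at t within {t/2<..<2*t})"
    by (rule has_field_derivative_subset) auto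
  then have J: "(J has_real_derivative conv t) (at t)"
    using t by (simp add: at_within_open[of t "{t/2<..<2*t}"])
  have ev: "\<forall>\<^sub>F z in at t. z \<in> {t/2<..<2*t}"
    using t by (intro eventually_at_in_open') auto
  have J_diff: "J q - J p = integral {p..q} conv" if "t/2 < p" "p \<le> q" for p q
    using Henstock_Kurzweil_Integration.integral_combine[where a="t/2" and c=p and b=q and f=conv] that ii[of "t/2" q] t by (simp add: J_def)
  have b: "(J z - J t) / (z - t) / max z t \<le> (V z - V t) / (z - t)
      \<and> (V z - V t) / (z - t) \<le> (J z - J t) / (z - t) / min z t"
    if z: "z \<in> {t/2<..<2*t}" "z \<noteq> t" for z
  proof -
    define p q where "p = min z t" and "q = max z t"
    have pq: "0 < p" "t / 2 < p" "p < q" using z t by (auto simp: p_def q_def)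
    have 1: "(J z - J t) / (z - t) = (J q - J p) / (q - p)" "(V z - V t) / (z - t) = (V q - V p) / (q - p)"
      using minus_divide_divide[of "J z - J t" "z - t"] minus_divide_divide[of "V z - V t" "z - t"]
      by (auto simp: p_def q_def min_def max_def)
    have 2: "J q - J p \<le> q * (V q - V p)" "p * (V q - V p) \<le> J q - J p"
      using conv_integral_bounds[of p q] J_diff[of p q] pq by auto
    have "(J q - J p) / (q - p) / q \<le> (V q - V p) / (q - p)"
      using 2(1) pq by (simp add: divide_simps) (simp add: mult.commute)
    moreover have "(V q - V p) / (q - p) \<le> (J q - J p) / (q - p) / p"
      using 2(2) pq by (simp add: divide_simps) (simp add: mult.commute)
    ultimately show ?thesis unfolding 1 p_def[symmetric] q_def[symmetric] by blast
  qed
  have lim: "((\<lambda>z. (J z - J t) / (z - t)) \<longlongrightarrow> conv t) (at t)"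
    using J by (simp add: has_field_derivative_iff)
  have "((\<lambda>z. (J z - J t) / (z - t) / max z t) \<longlongrightarrow> conv t / max t t) (at t)"
    using t by (intro tendsto_intros lim) auto
  then have l1: "((\<lambda>z. (J z - J t) / (z - t) / max z t) \<longlongrightarrow> conv t / t) (at t)" by simp
  have "((\<lambda>z. (J z - J t) / (z - t) / min z t) \<longlongrightarrow> conv t / min t t) (at t)"
    using t by (intro tendsto_intros lim) auto
  then have l2: "((\<lambda>z. (J z - J t) / (z - t) / min z t) \<longlongrightarrow> conv t / t) (at t)" by simp
  have ev': "\<forall>\<^sub>F z in at t. z \<in> {t/2<..<2*t} \<and> z \<noteq> t"
    using ev by (simp add: eventually_at_filter)
  have e1: "\<forall>\<^sub>F z in at t. (J z - J t) / (z - t) / max z t \<le> (V z - V t) / (z - t)"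
    by (rule eventually_mono[OF ev']) (use b in blast)
  have e2: "\<forall>\<^sub>F z in at t. (V z - V t) / (z - t) \<le> (J z - J t) / (z - t) / min z t"
    by (rule eventually_mono[OF ev']) (use b in blast)
  have "((\<lambda>z. (V z - V t) / (z - t)) \<longlongrightarrow> conv t / t) (at t)"
    by (rule tendsto_sandwich[OF e1 e2 l1 l2])
  then show ?thesis by (simp add: has_field_derivative_iff v_def)
qed

lemma v_nonneg: assumes "0 < t" shows "0 \<le> v t"
proof -
  have "mono_on UNIV V" using V_mono by (auto simp: mono_on_def)
  then show ?thesis using mono_on_imp_deriv_nonneg[of UNIV V "v t" t] V_has_derivative[OF assms] by simp
qed

lemma v_le: "0 < t \<Longrightarrow> v t \<le> 48 * V t / t"
  using conv_bound[of t] by (simp add: v_def divide_right_mono)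

lemma isCont_v: "0 < t \<Longrightarrow> isCont v t"
  unfolding v_def[abs_def] by (intro continuous_intros isCont_conv) auto

lemma v_measurable [measurable]: "v \<in> borel_measurable borel"
  unfolding v_def[abs_def] by measurable

lemma dV_eq_density: "dV = density lborel (\<lambda>t. ennreal (indicator {0<..} t * v t))"
proof (rule measure_eqI_generator_eq[where \<Omega>=UNIV and E="range (\<lambda>(a, b). {a<..b::real})"
      and A="\<lambda>n. {- real n<..real n}"])
  show "Int_stable (range (\<lambda>(a, b). {a<..b::real}))"
    by (auto simp: Int_stable_def image_iff intro!: exI)
  show "sets dV = sigma_sets UNIV (range (\<lambda>(a, b). {a<..b}))"
    by (simp add: borel_sigma_sets_Ioc)
  show "sets (density lborel (\<lambda>t. ennreal (indicator {0<..} t * v t))) = sigma_sets UNIV (range (\<lambda>(a, b). {a<..b}))"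
    by (simp add: borel_sigma_sets_Ioc)
  show "(\<Union>n. {- real n<..real n}) = UNIV"
  proof (intro equalityI subsetI UNIV_I)
    fix x :: real
    obtain n where "\<bar>x\<bar> < real n" using reals_Archimedean2 by blast
    then have "x \<in> {- real n<..real n}" by auto
    then show "x \<in> (\<Union>n. {- real n<..real n})" by blast
  qed
  show "emeasure dV {- real n<..real n} \<noteq> \<infinity>" for n
    by (subst emeasure_dV_Ioc) auto
  fix X assume "X \<in> range (\<lambda>(a, b). {a<..b::real})"
  then obtain a b where X: "X = {a<..b}" by auto
  define c where "c = max a 0"
  have D: "emeasure (density lborel (\<lambda>t. ennreal (indicator {0<..} t * v t))) X
    = (\<integral>\<^sup>+t. ennreal (indicator {c<..b} t * v t) \<partial>lborel)"
  proof -
    have "emeasure (density lborel (\<lambda>t. ennreal (indicator {0<..} t * v t))) X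
       = (\<integral>\<^sup>+t. ennreal (indicator {0<..} t * v t) * indicator X t \<partial>lborel)"
      by (rule emeasure_density) (auto simp: X)
    also have "\<dots> = (\<integral>\<^sup>+t. ennreal (indicator {c<..b} t * v t) \<partial>lborel)"
      by (intro nn_integral_cong) (auto simp: X c_def indicator_def)
    finally show ?thesis .
  qed
  show "emeasure dV X = emeasure (density lborel (\<lambda>t. ennreal (indicator {0<..} t * v t))) X"
  proof (cases "c < b")
    case False
    have "emeasure dV X = 0"
    proof (cases "a \<le> b")
      case True
      then have "V b = V a" using False V_nonpos[of a] V_nonpos[of b] by (cases "0 \<le> a") (auto simp: c_def)
      then show ?thesis using True by (simp add: X emeasure_dV_Ioc)
    qed (simp add: X)
    moreover have "{c<..b} = {}" using False by auto
    ultimately show ?thesis unfolding D by simp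
  next
    case True
    have cc: "0 \<le> c" by (simp add: c_def)
    have eIoo: "einterval (ereal c) (ereal b) = {c<..<b}" by (auto simp: einterval_def)
    have lims: "((V \<circ> real_of_ereal) \<longlongrightarrow> V c) (at_right (ereal c))" "((V \<circ> real_of_ereal) \<longlongrightarrow> V b) (at_left (ereal b))"
      using V_cont by (simp_all add: ereal_tendsto_simps1 continuous_on_def filterlim_at_split)
    have "set_integrable lborel (einterval c b) v \<and> (LBINT x=c..b. v x) = V b - V c"
      using interval_integral_FTC_nonneg[of "ereal c" "ereal b" V v "V c" "V b"] True cc lims V_has_derivative isCont_v v_nonneg
      by auto
    then have i: "integrable lborel (\<lambda>t. indicator {c<..<b} t * v t)"
      and I: "(LBINT t. indicator {c<..<b} t * v t) = V b - V c"
      using True by (auto simp: eIoo set_integrable_def interval_lebesgue_integral_def set_lebesgue_integral_def)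
    have "(\<integral>\<^sup>+t. ennreal (indicator {c<..b} t * v t) \<partial>lborel) = (\<integral>\<^sup>+t. ennreal (indicator {c<..<b} t * v t) \<partial>lborel)"
    proof (rule nn_integral_cong_AE)
      show "AE t in lborel. ennreal (indicator {c<..b} t * v t) = ennreal (indicator {c<..<b} t * v t)"
        using AE_lborel_singleton[of b] by eventually_elim (auto simp: indicator_def)
    qed
    also have "\<dots> = ennreal (V b - V c)"
      using nn_integral_eq_integral[OF i] I v_nonneg cc by (auto simp: indicator_def)
    also have "V c = V a" using V_nonpos[of a] V_nonpos[of 0] by (auto simp: c_def max_def)
    finally show ?thesis using True unfolding D by (simp add: X emeasure_dV_Ioc c_def)
  qed
qed auto

end

section \<open>Hoelder continuity of the renewal density\<close>

text \<open>Trades the logarithmic modulus of continuity of the weight for a Hoelder modulus, which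
  integrates to a finite value at the singularity as long as \<open>b < 1\<close>.\<close>

lemma ln_one_plus_le_powr:
  fixes x b :: real assumes "0 < x" "0 < b" "b \<le> 1" shows "ln (1 + x) \<le> 2 / b * x powr b"
proof (cases "x \<le> 1")
  case True
  have "ln (1 + x) \<le> x" using assms by (intro ln_add_one_self_le_self) auto
  also have "x = x powr 1" using assms by simp
  also have "\<dots> \<le> x powr b" using True assms by (intro powr_mono') auto
  also have "\<dots> \<le> 2 / b * x powr b"
    using assms mult_right_mono[of 1 "2 / b" "x powr b"] by (simp add: field_simps)
  finally show ?thesis .
next
  case False
  have "ln (1 + x) \<le> (1 + x) powr b / b" using assms by (intro ln_powr_bound) auto
  also have "\<dots> \<le> (2 * x) powr b / b"
    using assms False by (intro divide_right_mono powr_mono2) auto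
  also have "\<dots> = 2 powr b * x powr b / b" using assms by (simp add: powr_mult)
  also have "\<dots> \<le> 2 powr 1 * x powr b / b"
    using assms by (intro divide_right_mono mult_right_mono powr_mono) auto
  finally show ?thesis by simp
qed

lemma powr_reflect_integral:
  fixes a t b :: real
  assumes "a < t" "0 < b" "b < 1"
  shows "set_integrable lborel {a<..<t} (\<lambda>s. (t - s) powr - b)"
    "(LBINT s:{a<..<t}. (t - s) powr - b) = (t - a) powr (1 - b) / (1 - b)"
proof -
  have eI: "einterval (ereal a) (ereal t) = {a<..<t}" by (auto simp: einterval_def)
  define F where "F s = - ((t - s) powr (1 - b) / (1 - b))" for s
  have der: "(F has_real_derivative (t - s) powr - b) (at s)" if "s < t" for s
  proof -
    have "((\<lambda>s. (t - s) powr (1 - b)) has_real_derivative (1 - b) * (t - s) powr (1 - b - 1) * (0 - 1)) (at s)"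
      by (intro DERIV_chain2[where f="\<lambda>z. z powr (1 - b)"] has_real_derivative_powr DERIV_diff DERIV_const DERIV_ident)
        (use that in auto)
    from DERIV_minus[OF DERIV_cdivide[OF this, of "1 - b"]]
    show ?thesis unfolding F_def[abs_def] using assms by simp
  qed
  have c: "continuous_on {..t} F"
    unfolding F_def using assms by (intro continuous_intros continuous_on_powr') auto
  have "(F \<longlongrightarrow> F t) (at_left t)"
    by (rule tendsto_within_subset[where S="{..t}"]) (use c in \<open>auto simp: continuous_on_def\<close>)
  moreover have "(F \<longlongrightarrow> F a) (at_right a)"
    using DERIV_isCont[OF der[OF assms(1)]] by (simp add: isCont_def filterlim_at_split)
  ultimately have lims: "((F \<circ> real_of_ereal) \<longlongrightarrow> F a) (at_right (ereal a))" "((F \<circ> real_of_ereal) \<longlongrightarrow> F t) (at_left (ereal t))"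
    by (simp_all add: ereal_tendsto_simps1)
  have c': "isCont (\<lambda>s. (t - s) powr - b) x" if "x < t" for x
    using that by (intro continuous_intros) auto
  have "set_integrable lborel (einterval a t) (\<lambda>s. (t - s) powr - b) \<and> (LBINT s=a..t. (t - s) powr - b) = F t - F a"
    by (intro conjI interval_integral_FTC_nonneg[of "ereal a" "ereal t" F]) (use assms lims der c' in auto)
  then show "set_integrable lborel {a<..<t} (\<lambda>s. (t - s) powr - b)"
    "(LBINT s:{a<..<t}. (t - s) powr - b) = (t - a) powr (1 - b) / (1 - b)"
    using assms by (auto simp: eI interval_lebesgue_integral_def F_def)
qed

context ladder_renewal begin

lemma integrable_dV_iff:
  assumes [measurable]: "f \<in> borel_measurable borel"
  shows "integrable dV f \<longleftrightarrow> integrable lborel (\<lambda>s. indicator {0<..} s * v s * f s)"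
  unfolding dV_eq_density
  by (subst integrable_density) (auto simp: indicator_def v_nonneg)

lemma integral_dV_eq:
  assumes [measurable]: "f \<in> borel_measurable borel"
  shows "integral\<^sup>L dV f = (LBINT s. indicator {0<..} s * v s * f s)"
  unfolding dV_eq_density
  by (subst integral_density) (auto simp: indicator_def v_nonneg)

text \<open>This is \<open>v t \<le> 48 * V t / t\<close> in integrated form: \<open>V\<close> grows at most like the power \<open>48\<close>, so
  it is doubling and its Laplace transform at \<open>1 / t\<close> is governed by its values up to \<open>t\<close>.\<close>

lemma V_quotient_antimono:
  assumes "0 < s" "s \<le> t" shows "V t / t ^ 48 \<le> V s / s ^ 48"
proof (rule DERIV_nonpos_imp_nonincreasing[OF assms(2)])
  fix x assume x: "s \<le> x" "x \<le> t"
  have x0: "0 < x" using x assms by simp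
  have "((\<lambda>x. V x / x ^ 48) has_real_derivative (v x * x ^ 48 - V x * (48 * x ^ 47)) / (x ^ 48 * x ^ 48)) (at x)"
    using x0 by (auto intro!: derivative_eq_intros V_has_derivative)
  moreover have "(v x * x ^ 48 - V x * (48 * x ^ 47)) / (x ^ 48 * x ^ 48) \<le> 0"
  proof -
    have "v x * x \<le> 48 * V x" using v_le[OF x0] x0 by (simp add: field_simps)
    then have "v x * x * x ^ 47 \<le> 48 * V x * x ^ 47" using x0 by (intro mult_right_mono) auto
    moreover have "v x * x * x ^ 47 = v x * x ^ 48" unfolding mult.assoc by (simp flip: power_Suc)
    ultimately have "v x * x ^ 48 - V x * (48 * x ^ 47) \<le> 0" by simp
    then show ?thesis by (intro divide_nonpos_nonneg) auto
  qed
  ultimately show "\<exists>y. ((\<lambda>x. V x / x ^ 48) has_real_derivative y) (at x) \<and> y \<le> 0" by blast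
qed

lemma V_increment_le:
  assumes "0 < t" "t \<le> t'" shows "V t' - V t \<le> 48 * V t' * ((t' - t) / t)"
proof -
  have "t * (V t' - V t) \<le> integral {t..t'} conv" using conv_integral_bounds(1) assms by simp
  also have "\<dots> \<le> integral {t..t'} (\<lambda>_. 48 * V t')"
  proof (rule integral_le)
    show "conv integrable_on {t..t'}" using assms
      by (intro integrable_continuous_real continuous_on_subset[OF continuous_on_conv]) auto
    show "conv x \<le> 48 * V t'" if "x \<in> {t..t'}" for x
      using conv_bound[of x] V_mono[of x t'] that assms by auto
  qed auto
  also have "\<dots> = 48 * V t' * (t' - t)" using assms by simp
  finally show ?thesis using assms by (simp add: field_simps)
qed

lemma W_diff_le:
  assumes b: "0 < b" "b \<le> 1" and "s < t" "t < t'"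
  shows "\<bar>W (t' - s) - W (t - s)\<bar> \<le> 1800 / b * ((t' - t) powr b * (t - s) powr - b)"
proof -
  have p: "0 < t' - s" "0 < t - s" "0 < t' - t" using assms by auto
  have "\<bar>W (t' - s) - W (t - s)\<bar> \<le> 900 * \<bar>ln (t' - s) - ln (t - s)\<bar>"
    using ladder_weight_lipschitz[of "t' - s" "t - s"] p by (simp add: W_def)
  also have "ln (t' - s) - ln (t - s) = ln (1 + (t' - t) / (t - s))"
  proof -
    have "1 + (t' - t) / (t - s) = (t' - s) / (t - s)" using p by (simp add: field_simps)
    then show ?thesis using p by (simp add: ln_div)
  qed
  also have "\<bar>ln (1 + (t' - t) / (t - s))\<bar> = ln (1 + (t' - t) / (t - s))"
    using p by simp
  also have "900 * \<dots> \<le> 900 * (2 / b * ((t' - t) / (t - s)) powr b)"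
    using p b by (intro mult_left_mono ln_one_plus_le_powr) auto
  also have "\<dots> = 1800 / b * ((t' - t) powr b * (t - s) powr - b)"
    using p by (simp add: powr_divide powr_minus_divide)
  finally show ?thesis .
qed

text \<open>The increment of the convolution is split at \<open>s = t / 2\<close>, \<open>s = t\<close> and \<open>s = t'\<close>. Below
  \<open>t / 2\<close> the increment of the weight is uniformly of order \<open>(h / t) powr b\<close> with \<open>h = t' - t\<close>.
  Between \<open>t / 2\<close> and \<open>t\<close> it is at most a multiple of \<open>(h / (t - s)) powr b\<close>, which is integrated
  against the density \<open>v \<le> 96 * V t / t\<close>. Between \<open>t\<close> and \<open>t'\<close> only the mass \<open>V t' - V t\<close> of order
  \<open>V t' * h / t\<close> enters.\<close>

lemma conv_hoelder:
  assumes b: "0 < b" "b < 1"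
  obtains C where "0 < C" "\<And>t t'. 0 < t \<Longrightarrow> t \<le> t' \<Longrightarrow> t' \<le> 2 * t \<Longrightarrow>
     \<bar>conv t' - conv t\<bar> \<le> C * V t' * ((t' - t) / t) powr b"
proof -
  define K where "K = 1800 / b"
  define C where "C = 2 * K + 96 * K / (1 - b) + 48 * 48"
  have K: "0 < K" using b by (simp add: K_def)
  have C: "0 < C" using b K by (auto simp: C_def intro!: add_pos_nonneg)
  have main: "\<bar>conv t' - conv t\<bar> \<le> C * V t' * ((t' - t) / t) powr b"
    if t: "0 < t" and tt: "t < t'" and t2: "t' \<le> 2 * t" for t t'
  proof -
    define h where "h = t' - t"
    have h: "0 < h" "h \<le> t" using tt t2 by (auto simp: h_def)
    \<comment> \<open>Majorants of the increment on the three pieces.\<close>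
    define f1 where "f1 s = K * (2 * h / t) powr b * indicator {0..t/2} s" for s
    define f2 where "f2 s = K * h powr b * (indicator {t/2<..<t} s * (t - s) powr - b)" for s
    define f3 where "f3 s = (48::real) * indicator {t..t'} s" for s :: real
    have i1: "integrable dV f1" "integral\<^sup>L dV f1 = K * (2 * h / t) powr b * V (t / 2)"
      unfolding f1_def using t V_nonpos[of 0] by (auto simp: emeasure_dV_Icc measure_dV_Icc)
    have i3: "integrable dV f3" "integral\<^sup>L dV f3 = 48 * (V t' - V t)"
      unfolding f3_def using tt by (auto simp: emeasure_dV_Icc measure_dV_Icc)
    define g where "g s = indicator {t/2<..<t} s * (t - s) powr - b" for s
    have gm [measurable]: "g \<in> borel_measurable borel" unfolding g_def[abs_def] by measurable
    have gi: "integrable lborel g" "integral\<^sup>L lborel g = (t / 2) powr (1 - b) / (1 - b)"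
      using powr_reflect_integral[of "t/2" t b] t b by (simp_all add: g_def[abs_def] set_integrable_def set_lebesgue_integral_def)
    have gb: "indicator {0<..} s * v s * g s \<le> 96 * V t / t * g s" "0 \<le> indicator {0<..} s * v s * g s" for s
    proof -
      have "v s \<le> 96 * V t / t" if "s \<in> {t/2<..<t}"
      proof -
        have s: "0 < s" "t / 2 < s" "s < t" using that t by auto
        have "v s \<le> 48 * V s / s" using s by (intro v_le)
        also have "\<dots> \<le> 48 * V t / (t / 2)" using s t V_mono[of s t] V_nonneg[of s] by (intro frac_le) auto
        finally show ?thesis by simp
      qed
      then have "s \<in> {t/2<..<t} \<Longrightarrow> v s * g s \<le> 96 * V t / t * g s"
        by (intro mult_right_mono) (auto simp: g_def)
      then show "indicator {0<..} s * v s * g s \<le> 96 * V t / t * g s"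
        using t by (cases "s \<in> {t/2<..<t}") (auto simp: g_def)
      show "0 \<le> indicator {0<..} s * v s * g s" by (auto simp: g_def indicator_def v_nonneg)
    qed
    have gi': "integrable lborel (\<lambda>s. indicator {0<..} s * v s * g s)"
    proof (rule Bochner_Integration.integrable_bound)
      show "integrable lborel (\<lambda>s. 96 * V t / t * g s)" using gi(1) by simp
      show "AE s in lborel. norm (indicator {0<..} s * v s * g s) \<le> norm (96 * V t / t * g s)"
      proof (intro AE_I2)
        fix s show "norm (indicator {0<..} s * v s * g s) \<le> norm (96 * V t / t * g s)"
          using gb[of s] unfolding real_norm_def by linarith
      qed
    qed measurable
    have ig: "integrable dV g" using gi' by (subst integrable_dV_iff) auto
    have "integral\<^sup>L dV g \<le> (LBINT s. 96 * V t / t * g s)"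
      unfolding integral_dV_eq[OF gm] using gi' gi(1) gb(1) by (intro integral_mono) auto
    then have ig': "integral\<^sup>L dV g \<le> 96 * V t / t * ((t / 2) powr (1 - b) / (1 - b))"
      unfolding integral_mult_right_zero gi(2) .
    have i2: "integrable dV f2" "integral\<^sup>L dV f2 \<le> K * h powr b * (96 * V t / t * ((t / 2) powr (1 - b) / (1 - b)))"
    proof -
      have f2: "f2 = (\<lambda>s. K * h powr b * g s)" by (simp add: f2_def[abs_def] g_def)
      show "integrable dV f2" unfolding f2 using ig by simp
      show "integral\<^sup>L dV f2 \<le> K * h powr b * (96 * V t / t * ((t / 2) powr (1 - b) / (1 - b)))"
        unfolding f2 integral_mult_right_zero using ig' K by (intro mult_left_mono) auto
    qed
    define q where "q u s = indicator {0<..} s * W (u - s)" for u s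
    have qi: "integrable dV (q u)" if "0 < u" for u
    proof (rule integrable_dV_bounded[where C=48 and a=0 and b=u])
      show "\<bar>q u s\<bar> \<le> 48" for s using W_bound[of "u - s"] by (simp add: q_def indicator_def)
      show "q u s = 0" if "s \<notin> {0..u}" for s using that by (auto simp: q_def W_def indicator_def)
    qed (simp add: q_def[abs_def])
    have pt: "\<bar>q t' s - q t s\<bar> \<le> f1 s + f2 s + f3 s" for s
    proof -
      consider "s \<le> 0" | "0 < s" "s \<le> t / 2" | "t / 2 < s" "s < t" | "t \<le> s" "s \<le> t'" | "t' < s" using t by linarith
      then show ?thesis
      proof cases
        case 1 then show ?thesis using t tt K by (simp add: q_def f1_def f2_def f3_def)
      next
        case 2
        have "\<bar>W (t' - s) - W (t - s)\<bar> \<le> K * (h powr b * (t - s) powr - b)"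
          using W_diff_le[of b s t t'] 2 t tt b by (simp add: K_def h_def)
        also have "\<dots> \<le> K * (h powr b * (t / 2) powr - b)"
          using K b 2 t by (intro mult_left_mono powr_mono2') auto
        also have "h powr b * (t / 2) powr - b = (2 * h / t) powr b"
        proof -
          have e: "2 * h / t = h / (t / 2)" by simp
          show ?thesis unfolding e powr_minus_divide using h t by (subst powr_divide) auto
        qed
        finally show ?thesis using 2 t tt by (simp add: q_def f1_def f2_def f3_def)
      next
        case 3
        have "\<bar>W (t' - s) - W (t - s)\<bar> \<le> K * (h powr b * (t - s) powr - b)"
          using W_diff_le[of b s t t'] 3 t tt b by (simp add: K_def h_def)
        then show ?thesis using 3 t tt by (simp add: q_def f1_def f2_def f3_def)
      next
        case 4
        have "W (t - s) = 0" using 4 by (simp add: W_def)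
        then show ?thesis using 4 t W_bound[of "t' - s"] by (simp add: q_def f1_def f2_def f3_def)
      next
        case 5 then show ?thesis using t tt by (simp add: q_def f1_def f2_def f3_def W_def)
      qed
    qed
    have cq: "conv u = integral\<^sup>L dV (q u)" for u by (simp add: conv_def q_def[abs_def])
    have "\<bar>conv t' - conv t\<bar> = \<bar>LINT s|dV. q t' s - q t s\<bar>"
      unfolding cq using Bochner_Integration.integral_diff[OF qi[of t'] qi[OF t]] t tt by simp
    also have "\<dots> \<le> (LINT s|dV. \<bar>q t' s - q t s\<bar>)" by (rule integral_abs_bound)
    also have "\<dots> \<le> (LINT s|dV. f1 s + f2 s + f3 s)"
      using qi[OF t] qi[of t'] t tt i1(1) i2(1) i3(1) pt by (intro integral_mono) auto
    also have "\<dots> = integral\<^sup>L dV f1 + integral\<^sup>L dV f2 + integral\<^sup>L dV f3"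
      using i1(1) i2(1) i3(1) by simp
    also have "\<dots> \<le> 2 * K * V t' * (h / t) powr b + 96 * K / (1 - b) * V t' * (h / t) powr b + 48 * 48 * V t' * (h / t) powr b"
    proof (intro add_mono)
      have "(2 * h / t) powr b = 2 powr b * (h / t) powr b" using h t by (simp add: powr_mult powr_divide)
      also have "\<dots> \<le> 2 powr 1 * (h / t) powr b" using b by (intro mult_right_mono powr_mono) auto
      finally have "(2 * h / t) powr b \<le> 2 * (h / t) powr b" by simp
      then have "K * (2 * h / t) powr b * V (t / 2) \<le> K * (2 * (h / t) powr b) * V t'"
        using K V_mono[of "t/2" t'] t tt V_nonneg by (intro mult_mono mult_nonneg_nonneg) auto
      then show "integral\<^sup>L dV f1 \<le> 2 * K * V t' * (h / t) powr b" by (simp add: i1(2) mult_ac)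
      have e: "h powr b * (t powr (1 - b) / t) = (h / t) powr b"
        using t h by (simp add: powr_diff powr_divide)
      have "(t / 2) powr (1 - b) \<le> t powr (1 - b)" using t b by (intro powr_mono2) auto
      then have "K * h powr b * (96 * V t / t * ((t / 2) powr (1 - b) / (1 - b)))
          \<le> K * h powr b * (96 * V t' / t * (t powr (1 - b) / (1 - b)))"
        using K t b V_mono[of t t'] tt V_nonneg[of t] V_nonneg[of t']
        by (intro mult_left_mono mult_mono divide_right_mono) auto
      also have "\<dots> = 96 * K / (1 - b) * V t' * (h powr b * (t powr (1 - b) / t))"
        by (simp add: divide_inverse mult_ac)
      finally show "integral\<^sup>L dV f2 \<le> 96 * K / (1 - b) * V t' * (h / t) powr b"
        using i2(2) unfolding e by linarith
      have "h / t = (h / t) powr 1" using h t by simp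
      also have "\<dots> \<le> (h / t) powr b" using h t b by (intro powr_mono') auto
      finally have "48 * (V t' - V t) \<le> 48 * (48 * V t' * (h / t) powr b)"
        using V_increment_le[of t t'] t tt V_nonneg[of t'] mult_left_mono[of "h / t" "(h / t) powr b" "48 * V t'"]
        by (simp add: h_def)
      then show "integral\<^sup>L dV f3 \<le> 48 * 48 * V t' * (h / t) powr b" by (simp add: i3(2))
    qed
    also have "\<dots> = C * V t' * (h / t) powr b" by (simp add: C_def algebra_simps)
    finally show ?thesis by (simp add: h_def)
  qed
  have "\<bar>conv t' - conv t\<bar> \<le> C * V t' * ((t' - t) / t) powr b"
    if "0 < t" "t \<le> t'" "t' \<le> 2 * t" for t t'
    using main[of t t'] that C V_nonneg[of t'] by (cases "t = t'") auto
  then show ?thesis using that C by blast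
qed

text \<open>Division of \<open>conv_hoelder\<close> by \<open>t\<close>; the change of the divisor contributes a Lipschitz term,
  bounded by \<open>V t' / t * ((t' - t) / t)\<close>.\<close>

lemma v_hoelder:
  assumes b: "0 < b" "b < 1"
  obtains C where "0 < C" "\<And>t t'. 0 < t \<Longrightarrow> t \<le> t' \<Longrightarrow> t' \<le> 2 * t \<Longrightarrow>
     \<bar>v t' - v t\<bar> \<le> C * V t' / t * ((t' - t) / t) powr b"
proof -
  obtain C where C: "0 < C" "\<And>t t'. 0 < t \<Longrightarrow> t \<le> t' \<Longrightarrow> t' \<le> 2 * t \<Longrightarrow>
     \<bar>conv t' - conv t\<bar> \<le> C * V t' * ((t' - t) / t) powr b"
    using conv_hoelder[OF b] by blast
  have "\<bar>v t' - v t\<bar> \<le> (C + 48) * V t' / t * ((t' - t) / t) powr b"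
    if t: "0 < t" "t \<le> t'" "t' \<le> 2 * t" for t t'
  proof -
    define r where "r = ((t' - t) / t) powr b"
    have t': "0 < t'" using t by simp
    have "(t' - t) / t = ((t' - t) / t) powr 1" using t by simp
    also have "\<dots> \<le> r" unfolding r_def using t b by (intro powr_mono') (auto simp: field_simps)
    finally have r: "(t' - t) / t \<le> r" .
    have eq: "v t' - v t = (conv t' - conv t) / t' - conv t / t * ((t' - t) / t')"
      using t t' by (simp add: v_def field_simps)
    have "\<bar>v t' - v t\<bar> \<le> \<bar>(conv t' - conv t) / t'\<bar> + \<bar>conv t / t * ((t' - t) / t')\<bar>"
      unfolding eq by (rule abs_triangle_ineq4)
    also have "\<dots> = \<bar>conv t' - conv t\<bar> / t' + \<bar>conv t\<bar> / t * ((t' - t) / t')"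
      using t t' by (simp add: abs_mult)
    also have "\<dots> \<le> C * V t' * r / t + 48 * V t' / t * r"
    proof (intro add_mono)
      show "\<bar>conv t' - conv t\<bar> / t' \<le> C * V t' * r / t"
        using C(2)[OF t] t C(1) V_nonneg[of t'] by (intro frac_le) (auto simp: r_def)
      have "(t' - t) / t' \<le> (t' - t) / t" using t by (intro divide_left_mono) auto
      also note r
      finally have 1: "(t' - t) / t' \<le> r" .
      have "\<bar>conv t\<bar> / t \<le> 48 * V t' / t"
        using conv_bound[OF t(1)] V_mono[OF t(2)] t by (intro divide_right_mono) auto
      then show "\<bar>conv t\<bar> / t * ((t' - t) / t') \<le> 48 * V t' / t * r"
        using 1 t t' V_nonneg[of t'] by (intro mult_mono) auto
    qed
    also have "\<dots> = (C + 48) * V t' / t * r" by (simp add: algebra_simps add_divide_distrib)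
    finally show ?thesis by (simp add: r_def)
  qed
  then show ?thesis using that[of "C + 48"] C(1) by auto
qed

section \<open>Size of the renewal function\<close>

text \<open>On \<open>(0, t]\<close> the exponential \<open>exp (- s / t)\<close> is at least \<open>exp (- 1)\<close>.\<close>

lemma V_le_laplace:
  assumes t: "0 < t" shows "V t \<le> exp 1 * exp (- log_kappa (1 / t))"
proof -
  have i: "integrable dV (\<lambda>s. indicator {0<..} s *\<^sub>R exp (- (1 / t) * s))"
    using dV_laplace(1)[of "1 / t"] t by (simp add: set_integrable_def)
  have e: "emeasure dV {0<..t} = ennreal (V t)" using emeasure_dV_Ioc[of 0 t] t V_nonpos[of 0] by simp
  then have e': "measure dV {0<..t} = V t" using V_nonneg[of t] by (simp add: measure_def)
  have "exp (- 1) * V t = (LINT s|dV. exp (- 1) * indicator {0<..t} s)"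
    by (simp add: e')
  also have "\<dots> \<le> (LINT s|dV. indicator {0<..} s *\<^sub>R exp (- (1 / t) * s))"
  proof (rule integral_mono[OF _ i])
    show "integrable dV (\<lambda>s. exp (- 1) * indicator {0<..t} s :: real)"
      using e by (intro integrable_mult_right) (simp add: integrable_indicator_iff)
    show "exp (- 1) * indicator {0<..t} s \<le> indicator {0<..} s *\<^sub>R exp (- (1 / t) * s)" for s
      using t by (auto simp: indicator_def)
  qed
  also have "\<dots> = exp (- log_kappa (1 / t))"
    using dV_laplace(2)[of "1 / t"] t by (simp add: set_lebesgue_integral_def)
  finally have "exp 1 * (exp (- 1) * V t) \<le> exp 1 * exp (- log_kappa (1 / t))" by simp
  then show ?thesis by (simp add: mult.assoc[symmetric] exp_add[symmetric])
qed

text \<open>The part of the transform up to \<open>t\<close> is at most \<open>V t\<close>. Beyond \<open>t\<close> the density is at most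
  \<open>48 * (V t / t) * (s / t) ^ 47\<close> by \<open>V_quotient_antimono\<close>, and the exponential absorbs the
  power.\<close>

lemma laplace_le_V:
  assumes t: "0 < t" shows "exp (- log_kappa (1 / t)) \<le> (1 + 96 * (2 ^ 47 * fact 47)) * V t"
proof -
  define K where "K = (2 ^ 47 * fact 47 :: real)"
  have e: "emeasure dV {0<..t} = ennreal (V t)" using emeasure_dV_Ioc[of 0 t] t V_nonpos[of 0] by simp
  then have e': "measure dV {0<..t} = V t" using V_nonneg[of t] by (simp add: measure_def)
  define g where "g s = indicator {t<..} s * exp (- (1 / t) * s)" for s
  have gm [measurable]: "g \<in> borel_measurable borel" unfolding g_def[abs_def] by measurable
  have i: "integrable dV (\<lambda>s. indicator {0<..} s *\<^sub>R exp (- (1 / t) * s))"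
    using dV_laplace(1)[of "1 / t"] t by (simp add: set_integrable_def)
  have gi: "integrable dV g"
    by (rule Bochner_Integration.integrable_bound[OF i]) (use t in \<open>auto simp: g_def indicator_def\<close>)
  have i1: "integrable dV (\<lambda>s. indicator {0<..t} s :: real)"
    using e by (simp add: integrable_indicator_iff)
  have gv: "indicator {0<..} s * v s * g s \<le> 48 * V t * K / t * (indicator {0<..} s *\<^sub>R exp (- (1 / (2 * t)) * s))" for s
  proof (cases "t < s")
    case True
    define u where "u = s / t"
    have u: "0 < u" and s: "0 < s" using True t by (auto simp: u_def)
    have "V s \<le> V t * u ^ 48"
      using V_quotient_antimono[of t s] t True s by (simp add: u_def field_simps)
    have "v s \<le> 48 * V s / s" by (rule v_le[OF s])
    also have "\<dots> \<le> 48 * (V t * u ^ 48) / s" using \<open>V s \<le> V t * u ^ 48\<close> s by (intro divide_right_mono) auto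
    also have "\<dots> = 48 * V t / t * u ^ 47"
    proof -
      have "u ^ 48 = u ^ 47 * u" by (simp flip: power_Suc2)
      then show ?thesis using s t by (simp add: u_def)
    qed
    finally have 1: "v s \<le> 48 * V t / t * u ^ 47" .
    have 2: "u ^ 47 * exp (- u) \<le> K * exp (- (u / 2))"
    proof -
      have "(u / 2) ^ 47 * exp (- (u / 2)) \<le> fact 47" using power_exp_minus_le[of "u / 2" 47] u by simp
      then have "2 ^ 47 * ((u / 2) ^ 47 * exp (- (u / 2))) \<le> K" unfolding K_def by (intro mult_left_mono) auto
      then have "u ^ 47 * exp (- (u / 2)) \<le> K" by (simp add: power_divide)
      then have "u ^ 47 * exp (- (u / 2)) * exp (- (u / 2)) \<le> K * exp (- (u / 2))" by (intro mult_right_mono) auto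
      then show ?thesis by (simp add: mult.assoc exp_add[symmetric])
    qed
    have "v s * exp (- u) \<le> 48 * V t / t * u ^ 47 * exp (- u)" using 1 by (intro mult_right_mono) auto
    also have "\<dots> = 48 * V t / t * (u ^ 47 * exp (- u))" by simp
    also have "\<dots> \<le> 48 * V t / t * (K * exp (- (u / 2)))" using 2 t V_nonneg[of t] by (intro mult_left_mono) auto
    finally have "v s * exp (- u) \<le> 48 * V t * K / t * exp (- (u / 2))" by simp
    then show ?thesis using True s by (simp add: g_def u_def mult_ac)
  next
    case False
    have "0 \<le> 48 * V t * K / t" using V_nonneg[of t] t by (simp add: K_def)
    then have "0 \<le> 48 * V t * K / t * (indicator {0<..} s *\<^sub>R exp (- (1 / (2 * t)) * s))"
      by (rule mult_nonneg_nonneg) simp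
    moreover have "g s = 0" using False by (simp add: g_def)
    ultimately show ?thesis by simp
  qed
  have i2: "integrable lborel (\<lambda>s. 48 * V t * K / t * (indicator {0<..} s *\<^sub>R exp (- (1 / (2 * t)) * s)))"
    using laplace_one(1)[of "1 / (2 * t)"] t by (intro integrable_mult_right) (simp add: set_integrable_def)
  have v2: "(LBINT s. indicator {0<..} s *\<^sub>R exp (- (1 / (2 * t)) * s)) = 2 * t"
    using laplace_one(2)[of "1 / (2 * t)"] t by (simp add: set_lebesgue_integral_def)
  have "exp (- log_kappa (1 / t)) = (LINT s|dV. indicator {0<..} s *\<^sub>R exp (- (1 / t) * s))"
    using dV_laplace(2)[of "1 / t"] t by (simp add: set_lebesgue_integral_def)
  also have "\<dots> \<le> (LINT s|dV. indicator {0<..t} s + g s)"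
    by (intro integral_mono i Bochner_Integration.integrable_add i1 gi)
      (use t in \<open>auto simp: g_def indicator_def\<close>)
  also have "\<dots> = V t + integral\<^sup>L dV g" using i1 gi by (simp add: e')
  also have "integral\<^sup>L dV g \<le> (LBINT s. 48 * V t * K / t * (indicator {0<..} s *\<^sub>R exp (- (1 / (2 * t)) * s)))"
    unfolding integral_dV_eq[OF gm]
    using gi gv i2 by (intro integral_mono) (auto simp: integrable_dV_iff)
  also have "\<dots> = 48 * V t * K / t * (2 * t)" unfolding integral_mult_right_zero v2 ..
  also have "V t + 48 * V t * K / t * (2 * t) = (1 + 96 * K) * V t" using t by (simp add: algebra_simps)
  finally show ?thesis by (simp add: K_def)
qed

text \<open>The transform of \<open>dV\<close> at \<open>1 / t\<close> is comparable with \<open>V t\<close> by the two preceding lemmas and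
  with \<open>1 / sqrt (\<phi> (1 / t\<^sup>2))\<close> by \<open>ln_phi_integrable\<close>.\<close>

lemma V_comparable:
  obtains c C where "0 < c" "0 < C"
    "\<And>t. 0 < t \<Longrightarrow> c / sqrt (\<phi> (1 / t\<^sup>2)) \<le> V t"
    "\<And>t. 0 < t \<Longrightarrow> V t \<le> C / sqrt (\<phi> (1 / t\<^sup>2))"
proof -
  define a where "a = 2 / pi * (LBINT \<theta>:{0<..}. \<bar>ln \<theta>\<bar> / (1 + \<theta>\<^sup>2))"
  have b: "exp (- a) / sqrt (\<phi> (1 / t\<^sup>2)) \<le> exp (- log_kappa (1 / t))"
    "exp (- log_kappa (1 / t)) \<le> exp a / sqrt (\<phi> (1 / t\<^sup>2))" if t: "0 < t" for t
  proof -
    have p: "0 < \<phi> (1 / t\<^sup>2)" using t by (intro phi_pos) simp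
    have s: "1 / sqrt (\<phi> (1 / t\<^sup>2)) = exp (- (ln (\<phi> (1 / t\<^sup>2)) / 2))"
      using p by (simp add: exp_minus inverse_eq_divide ln_sqrt[symmetric])
    have "\<bar>log_kappa (1 / t) - ln (\<phi> (1 / t\<^sup>2)) / 2\<bar> \<le> a"
      using ln_phi_integrable(2)[of "1 / t"] t by (simp add: a_def power_one_over)
    then have "- a - ln (\<phi> (1 / t\<^sup>2)) / 2 \<le> - log_kappa (1 / t)" "- log_kappa (1 / t) \<le> a - ln (\<phi> (1 / t\<^sup>2)) / 2"
      by linarith+
    then have "exp (- a + - (ln (\<phi> (1 / t\<^sup>2)) / 2)) \<le> exp (- log_kappa (1 / t))"
      "exp (- log_kappa (1 / t)) \<le> exp (a + - (ln (\<phi> (1 / t\<^sup>2)) / 2))" by simp_all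
    then show "exp (- a) / sqrt (\<phi> (1 / t\<^sup>2)) \<le> exp (- log_kappa (1 / t))"
      "exp (- log_kappa (1 / t)) \<le> exp a / sqrt (\<phi> (1 / t\<^sup>2))"
      unfolding exp_add s[symmetric] by simp_all
  qed
  define K where "K = (1 + 96 * (2 ^ 47 * fact 47) :: real)"
  have K: "0 < K" unfolding K_def by (intro add_pos_nonneg) auto
  show ?thesis
  proof (rule that[of "exp (- a) / K" "exp 1 * exp a"])
    fix t :: real assume t: "0 < t"
    have "exp (- a) / sqrt (\<phi> (1 / t\<^sup>2)) \<le> K * V t" using b(1)[OF t] laplace_le_V[OF t] unfolding K_def by linarith
    then have "exp (- a) / sqrt (\<phi> (1 / t\<^sup>2)) / K \<le> V t" using K by (subst pos_divide_le_eq) (auto simp: mult.commute)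
    then show "exp (- a) / K / sqrt (\<phi> (1 / t\<^sup>2)) \<le> V t" by (simp add: mult.commute)
    have "V t \<le> exp 1 * exp (- log_kappa (1 / t))" by (rule V_le_laplace[OF t])
    also have "\<dots> \<le> exp 1 * (exp a / sqrt (\<phi> (1 / t\<^sup>2)))" using b(2)[OF t] by (intro mult_left_mono) auto
    finally show "V t \<le> exp 1 * exp a / sqrt (\<phi> (1 / t\<^sup>2))" by simp
  qed (use K in auto)
qed

end

section \<open>Power-like nonlinearities\<close>

lemma powr_tail_integral:
  fixes a t :: real assumes "0 < a" "0 < t"
  shows "set_integrable lborel {t<..} (\<lambda>s. (s / t) powr (- 1 - a))"
    "(LBINT s:{t<..}. (s / t) powr (- 1 - a)) = t / a"
proof -
  define F where "F s = - (t / a) * (s / t) powr - a" for s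
  have der: "(F has_real_derivative (s / t) powr (- 1 - a)) (at s)" if "0 < s" for s
  proof -
    have "((\<lambda>s. (s / t) powr - a) has_real_derivative - a * (s / t) powr (- a - 1) * (1 / t)) (at s)"
      by (intro DERIV_chain2[where f="\<lambda>z. z powr - a"] has_real_derivative_powr DERIV_cdivide DERIV_ident)
        (use that assms in auto)
    moreover have "- (t / a) * (- a * (s / t) powr (- a - 1) * (1 / t)) = (s / t) powr (- 1 - a)"
      using assms by (simp add: minus_diff_commute)
    ultimately show ?thesis
      unfolding F_def[abs_def] using DERIV_cmult[of "\<lambda>s. (s / t) powr - a" _ s UNIV "- (t / a)"] by metis
  qed
  have "isCont F t" by (rule DERIV_isCont[OF der[OF assms(2)]])
  then have l0: "(F \<longlongrightarrow> F t) (at_right t)" by (simp add: isCont_def filterlim_at_split)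
  have "filterlim (\<lambda>s. 1 / t * s) at_top at_top"
    using assms by (intro filterlim_tendsto_pos_mult_at_top[OF tendsto_const _ filterlim_ident]) auto
  then have "((\<lambda>s. (s / t) powr - a) \<longlongrightarrow> 0) at_top"
    using assms by (intro tendsto_neg_powr) (auto simp: field_simps)
  then have l1: "(F \<longlongrightarrow> - (t / a) * 0) at_top" unfolding F_def[abs_def] by (intro tendsto_intros)
  have c: "isCont (\<lambda>s. (s / t) powr (- 1 - a)) s" if "0 < s" for s
  proof (rule DERIV_isCont)
    show "((\<lambda>s. (s / t) powr (- 1 - a)) has_real_derivative (- 1 - a) * (s / t) powr (- 1 - a - 1) * (1 / t)) (at s)"
      by (intro DERIV_chain2[where f="\<lambda>z. z powr (- 1 - a)"] has_real_derivative_powr DERIV_cdivide DERIV_ident)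
        (use that assms in auto)
  qed
  show "set_integrable lborel {t<..} (\<lambda>s. (s / t) powr (- 1 - a))"
    by (rule set_integrable_FTC_greaterThan(1)[OF _ _ _ l0 l1]) (use assms der c in auto)
  have "(LBINT s:{t<..}. (s / t) powr (- 1 - a)) = - (t / a) * 0 - F t"
    by (rule set_integrable_FTC_greaterThan(2)[OF _ _ _ l0 l1]) (use assms der c in auto)
  then show "(LBINT s:{t<..}. (s / t) powr (- 1 - a)) = t / a" using assms by (simp add: F_def)
qed

locale power_like =
  fixes f :: "real \<Rightarrow> real" and m M :: real
  assumes f_nonneg: "\<And>t. 0 \<le> f t" and f_C1: "f C1_differentiable_on UNIV" and f_0: "f 0 = 0"
    and m: "0 < m" "m \<le> M"
    and f_growth: "\<And>t. (1 + m) * f t \<le> t * deriv f t" "\<And>t. t * deriv f t \<le> (1 + M) * f t"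
    and F_pos: "\<And>t. 0 < t \<Longrightarrow> 0 < primitive f t"
begin

abbreviation F :: "real \<Rightarrow> real" where "F \<equiv> primitive f"

lemma f_has_derivative: "(f has_real_derivative deriv f t) (at t)"
proof -
  obtain D where "(f has_vector_derivative D t) (at t)"
    using f_C1 by (auto simp: C1_differentiable_on_def)
  then show ?thesis
    by (metis DERIV_imp_deriv has_real_derivative_iff_has_vector_derivative)
qed

lemma isCont_f: "isCont f t"
  using f_has_derivative by (rule DERIV_isCont)

lemma F_0: "F 0 = 0"
  by (simp add: primitive_def zero_ereal_def[symmetric])

lemma F_has_derivative: "(F has_real_derivative f t) (at t)"
proof -
  define a b where "a = min 0 t - 1" and "b = max 0 t + 1"
  have "((\<lambda>u. LBINT y=ereal 0..u. f y) has_vector_derivative f t) (at t within {a..b})"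
    by (rule interval_integral_FTC2) (auto simp: a_def b_def intro!: continuous_at_imp_continuous_on isCont_f)
  then have "(F has_real_derivative f t) (at t within {a..b})"
    by (simp add: has_real_derivative_iff_has_vector_derivative primitive_def[abs_def] zero_ereal_def)
  then have "(F has_real_derivative f t) (at t within {a<..<b})"
    by (rule has_field_derivative_subset) auto
  moreover have "t \<in> {a<..<b}" by (auto simp: a_def b_def)
  ultimately show ?thesis using at_within_open[of t "{a<..<b}"] by simp
qed

text \<open>Integration of the growth condition for \<open>f\<close>: the derivative of \<open>t * f t - (2 + m) * F t\<close> is
  \<open>t * f' t - (1 + m) * f t\<close>, and similarly for the upper bound.\<close>

lemma F_growth:
  assumes "0 < t" shows "(2 + m) * F t \<le> t * f t" "t * f t \<le> (2 + M) * F t"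
proof -
  have d: "((\<lambda>t. t * f t - c * F t) has_real_derivative (t * deriv f t + f t - c * f t)) (at t)" for c t
    by (auto intro!: derivative_eq_intros f_has_derivative F_has_derivative)
  have "(\<lambda>t. t * f t - (2 + m) * F t) 0 \<le> (\<lambda>t. t * f t - (2 + m) * F t) t"
  proof (rule DERIV_nonneg_imp_nondecreasing[where f="\<lambda>t. t * f t - (2 + m) * F t"])
    show "\<exists>y. ((\<lambda>t. t * f t - (2 + m) * F t) has_real_derivative y) (at x) \<and> 0 \<le> y" for x
      using d[of "2 + m" x] f_growth(1)[of x] by (intro exI conjI) (auto simp: algebra_simps)
  qed (use assms in simp)
  then show "(2 + m) * F t \<le> t * f t" by (simp add: F_0)
  have "(\<lambda>t. t * f t - (2 + M) * F t) t \<le> (\<lambda>t. t * f t - (2 + M) * F t) 0"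
  proof (rule DERIV_nonpos_imp_nonincreasing[where f="\<lambda>t. t * f t - (2 + M) * F t"])
    show "\<exists>y. ((\<lambda>t. t * f t - (2 + M) * F t) has_real_derivative y) (at x) \<and> y \<le> 0" for x
      using d[of "2 + M" x] f_growth(2)[of x] by (intro exI conjI) (auto simp: algebra_simps)
  qed (use assms in simp)
  then show "t * f t \<le> (2 + M) * F t" by (simp add: F_0)
qed

text \<open>\<open>F t / t powr (2 + m)\<close> increases and \<open>F t / t powr (2 + M)\<close> decreases, by \<open>F_growth\<close>.\<close>

lemma F_power:
  assumes t: "0 < t" "t \<le> s"
  shows "F t * (s / t) powr (2 + m) \<le> F s" "F s \<le> F t * (s / t) powr (2 + M)"
proof -
  have d: "((\<lambda>x. ln (F x) - c * ln x) has_real_derivative (f x / F x - c / x)) (at x)" if "0 < x" for x c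
    using that F_pos[OF that]
    by (auto intro!: derivative_eq_intros F_has_derivative)
  have s: "0 < s" using t by simp
  have "ln (F t) - (2 + m) * ln t \<le> ln (F s) - (2 + m) * ln s"
  proof (rule DERIV_nonneg_imp_nondecreasing[OF t(2)])
    fix x assume "t \<le> x" "x \<le> s"
    then have x: "0 < x" using t by simp
    have "0 \<le> f x / F x - (2 + m) / x" using F_growth(1)[OF x] F_pos[OF x] x by (simp add: field_simps)
    then show "\<exists>y. ((\<lambda>x. ln (F x) - (2 + m) * ln x) has_real_derivative y) (at x) \<and> 0 \<le> y"
      using d[OF x] by blast
  qed
  then have "ln (F t) + (2 + m) * ln (s / t) \<le> ln (F s)" using t s by (simp add: ln_div algebra_simps)
  then have "exp (ln (F t) + (2 + m) * ln (s / t)) \<le> exp (ln (F s))" by simp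
  then show "F t * (s / t) powr (2 + m) \<le> F s" using F_pos[OF t(1)] F_pos[OF s] t s by (simp add: exp_add powr_def)
  have "ln (F s) - (2 + M) * ln s \<le> ln (F t) - (2 + M) * ln t"
  proof (rule DERIV_nonpos_imp_nonincreasing[OF t(2)])
    fix x assume "t \<le> x" "x \<le> s"
    then have x: "0 < x" using t by simp
    have "f x / F x - (2 + M) / x \<le> 0" using F_growth(2)[OF x] F_pos[OF x] x by (simp add: field_simps)
    then show "\<exists>y. ((\<lambda>x. ln (F x) - (2 + M) * ln x) has_real_derivative y) (at x) \<and> y \<le> 0"
      using d[OF x] by blast
  qed
  then have "ln (F s) \<le> ln (F t) + (2 + M) * ln (s / t)" using t s by (simp add: ln_div algebra_simps)
  then have "exp (ln (F s)) \<le> exp (ln (F t) + (2 + M) * ln (s / t))" by simp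
  then show "F s \<le> F t * (s / t) powr (2 + M)" using F_pos[OF t(1)] F_pos[OF s] t s by (simp add: exp_add powr_def)
qed

lemma isCont_F: "isCont F t"
  using F_has_derivative by (rule DERIV_isCont)

lemma isCont_inverse_sqrt_F: "0 < t \<Longrightarrow> isCont (\<lambda>s. 1 / sqrt (F s)) t"
  using F_pos[of t] by (intro continuous_intros isCont_F) auto

lemma sqrt_F_power:
  assumes t: "0 < t" "t \<le> s"
  shows "1 / sqrt (F s) \<le> 1 / sqrt (F t) * (s / t) powr (- 1 - m / 2)"
    "1 / sqrt (F t) * (s / t) powr (- 1 - M / 2) \<le> 1 / sqrt (F s)"
proof -
  have s: "0 < s" "0 < s / t" using t by auto
  have r: "sqrt (F t * (s / t) powr (2 + c)) = sqrt (F t) * (s / t) powr (1 + c / 2)" for c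
  proof -
    have "sqrt ((s / t) powr (2 + c)) = (s / t) powr (1 + c / 2)"
      using s by (simp add: powr_half_sqrt[symmetric] powr_powr add_divide_distrib)
    then show ?thesis by (simp add: real_sqrt_mult)
  qed
  have i: "1 / (sqrt (F t) * (s / t) powr (1 + c / 2)) = 1 / sqrt (F t) * (s / t) powr (- 1 - c / 2)" for c
  proof -
    have "(s / t) powr (- 1 - c / 2) = 1 / (s / t) powr (1 + c / 2)"
      using powr_minus_divide[of "s / t" "1 + c / 2"] by simp
    then show ?thesis by simp
  qed
  have "sqrt (F t) * (s / t) powr (1 + m / 2) \<le> sqrt (F s)"
    using F_power(1)[OF t] unfolding r[symmetric] by simp
  then have "1 / sqrt (F s) \<le> 1 / (sqrt (F t) * (s / t) powr (1 + m / 2))"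
    using F_pos[OF t(1)] s by (intro divide_left_mono mult_pos_pos) (auto simp: F_pos)
  then show "1 / sqrt (F s) \<le> 1 / sqrt (F t) * (s / t) powr (- 1 - m / 2)" unfolding i .
  have "sqrt (F s) \<le> sqrt (F t) * (s / t) powr (1 + M / 2)"
    using F_power(2)[OF t] unfolding r[symmetric] by simp
  then have "1 / (sqrt (F t) * (s / t) powr (1 + M / 2)) \<le> 1 / sqrt (F s)"
    using F_pos[OF t(1)] F_pos[OF s(1)] s by (intro divide_left_mono mult_pos_pos) auto
  then show "1 / sqrt (F t) * (s / t) powr (- 1 - M / 2) \<le> 1 / sqrt (F s)" unfolding i .
qed

lemma varphi_integrable:
  assumes t: "0 < t" shows "set_integrable lborel {t<..} (\<lambda>s. 1 / sqrt (F s))"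
proof -
  have "set_integrable lborel {t<..} (\<lambda>s. 1 / sqrt (F t) * (s / t) powr (- 1 - m / 2))"
    using powr_tail_integral(1)[of "m / 2" t] m t by (intro set_integrable_mult_right) auto
  then show ?thesis
  proof (rule set_integrable_bound)
    have "continuous_on {t<..} (\<lambda>s. 1 / sqrt (F s))"
      using t isCont_inverse_sqrt_F by (auto intro!: continuous_at_imp_continuous_on)
    then show "set_borel_measurable lborel {t<..} (\<lambda>s. 1 / sqrt (F s))"
      unfolding set_borel_measurable_def using borel_measurable_continuous_on_indicator[of "{t<..}" "\<lambda>s. 1 / sqrt (F s)"] by simp
    show "AE s in lborel. s \<in> {t<..} \<longrightarrow> norm (1 / sqrt (F s)) \<le> norm (1 / sqrt (F t) * (s / t) powr (- 1 - m / 2))"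
    proof (intro AE_I2 impI)
      fix s assume "s \<in> {t<..}"
      then have s: "t \<le> s" "0 \<le> F s" using t F_pos[of s] by auto
      show "norm (1 / sqrt (F s)) \<le> norm (1 / sqrt (F t) * (s / t) powr (- 1 - m / 2))"
        using sqrt_F_power(1)[OF t s(1)] s(2) unfolding real_norm_def
        by (intro order_trans[OF _ abs_ge_self]) simp
    qed
  qed
qed

text \<open>Integration of the lower power bound for \<open>F\<close>: the exponent \<open>- 1 - m / 2\<close> has the tail
  integral \<open>2 * t / m\<close>. The lower bound for \<open>varphi\<close> below is the same computation with \<open>M\<close>.\<close>

lemma varphi_le: assumes t: "0 < t" shows "varphi f t \<le> 2 / m * t / sqrt (F t)"
proof -
  have "varphi f t \<le> (LBINT s:{t<..}. 1 / sqrt (F t) * (s / t) powr (- 1 - m / 2))"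
    unfolding varphi_def
    using powr_tail_integral(1)[of "m / 2" t] m t sqrt_F_power(1)[OF t]
    by (intro set_integral_mono varphi_integrable set_integrable_mult_right) auto
  also have "\<dots> = 1 / sqrt (F t) * (t / (m / 2))"
    unfolding set_integral_mult_right using m t by (subst powr_tail_integral(2)) auto
  finally show ?thesis by (simp add: mult_ac)
qed

lemma varphi_ge: assumes t: "0 < t" shows "2 / M * t / sqrt (F t) \<le> varphi f t"
proof -
  have "1 / sqrt (F t) * (t / (M / 2)) = (LBINT s:{t<..}. 1 / sqrt (F t) * (s / t) powr (- 1 - M / 2))"
    unfolding set_integral_mult_right using m t by (subst powr_tail_integral(2)) auto
  also have "\<dots> \<le> varphi f t"
    unfolding varphi_def
    using powr_tail_integral(1)[of "M / 2" t] m t sqrt_F_power(2)[OF t]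
    by (intro set_integral_mono varphi_integrable set_integrable_mult_right) auto
  finally show ?thesis by (simp add: mult_ac)
qed

lemma varphi_pos: assumes t: "0 < t" shows "0 < varphi f t"
proof -
  have "0 < 2 / M * t / sqrt (F t)" using m t F_pos[OF t] by simp
  then show ?thesis using varphi_ge[OF t] by linarith
qed

lemma varphi_has_derivative:
  assumes t: "0 < t" shows "(varphi f has_real_derivative - (1 / sqrt (F t))) (at t)"
proof -
  define h where "h s = 1 / sqrt (F s)" for s
  have hc: "continuous_on {a..b} h" if "0 < a" for a b
    unfolding h_def using that by (auto intro!: continuous_at_imp_continuous_on isCont_inverse_sqrt_F)
  have split: "varphi f x = varphi f (t / 2) - integral {t/2..x} h" if x: "t / 2 < x" for x
  proof -
    have i1: "set_integrable lborel {t/2<..x} h"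
      unfolding h_def[abs_def] by (rule set_integrable_subset[OF varphi_integrable[of "t / 2"]]) (use t in auto)
    have i2: "set_integrable lborel {x<..} h"
      using varphi_integrable[of x] t x unfolding h_def[abs_def] by simp
    have "{t/2<..} = {t/2<..x} \<union> {x<..}" using x by auto
    then have "(LBINT s:{t/2<..}. h s) = (LBINT s:{t/2<..x}. h s) + (LBINT s:{x<..}. h s)"
      using i1 i2 by (simp add: set_integral_Un Int_def)
    moreover have "(LBINT s:{t/2<..x}. h s) = integral {t/2<..x} h"
      using i1 by (rule set_borel_integral_eq_integral)
    moreover have "integral {t/2<..x} h = integral {t/2..x} h"
      by (rule integral_subset_negligible) (auto intro: negligible_subset[of "{t/2}"])
    ultimately show ?thesis by (simp add: varphi_def h_def)
  qed
  have "((\<lambda>x. integral {t/2..x} h) has_real_derivative h t) (at t within {t/2..2*t})"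
    using t by (intro integral_has_real_derivative hc) auto
  then have "((\<lambda>x. integral {t/2..x} h) has_real_derivative h t) (at t within {t/2<..<2*t})"
    by (rule has_field_derivative_subset) auto
  then have "((\<lambda>x. integral {t/2..x} h) has_real_derivative h t) (at t)"
    using t at_within_open[of t "{t/2<..<2*t}"] by simp
  then have "((\<lambda>x. varphi f (t / 2) - integral {t/2..x} h) has_real_derivative 0 - h t) (at t)"
    by (intro DERIV_diff DERIV_const)
  then have "(varphi f has_real_derivative 0 - h t) (at t)"
    by (rule has_field_derivative_transform_within_open[where S="{t/2<..}"]) (use t split in auto)
  then show ?thesis by (simp add: h_def)
qed

lemma varphi_strict_antimono: assumes "0 < s" "s < t" shows "varphi f t < varphi f s"
proof (rule DERIV_neg_imp_decreasing[OF assms(2)])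
  fix x assume "s \<le> x" "x \<le> t"
  then have x: "0 < x" using assms by simp
  show "\<exists>y. (varphi f has_real_derivative y) (at x) \<and> y < 0"
    using varphi_has_derivative[OF x] F_pos[OF x] by (intro exI[of _ "- (1 / sqrt (F x))"]) auto
qed

lemma inj_on_varphi: "inj_on (varphi f) {0<..}"
  by (intro linorder_inj_onI) (auto dest: varphi_strict_antimono[of _ _])

text \<open>\<open>varphi\<close> is continuous and its two-sided bounds by powers force it to take arbitrarily large
  and arbitrarily small values.\<close>

lemma varphi_surj:
  assumes y: "0 < y" shows "\<exists>t>0. varphi f t = y"
proof -
  have "\<exists>s. 0 < s \<and> s \<le> 1 \<and> y \<le> varphi f s"
  proof -
    define K where "K = 2 / M / sqrt (F 1)"
    have K: "0 < K" using m F_pos[of 1] by (simp add: K_def)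
    define s where "s = min 1 ((K / y) powr (2 / m))"
    have s: "0 < s" "s \<le> 1" using K y m by (auto simp: s_def)
    have "s powr (m / 2) \<le> ((K / y) powr (2 / m)) powr (m / 2)"
      using s m by (intro powr_mono2) (auto simp: s_def)
    also have "\<dots> = K / y" using K y m by (simp add: powr_powr)
    finally have 1: "y \<le> K / s powr (m / 2)" using y s by (simp add: field_simps)
    have "F s * (1 / s) powr (2 + m) \<le> F 1" using F_power(1)[of s 1] s by simp
    then have "F s \<le> F 1 * s powr (2 + m)" using s by (simp add: powr_divide field_simps)
    then have "sqrt (F s) \<le> sqrt (F 1 * s powr (2 + m))" by simp
    also have "\<dots> = sqrt (F 1) * s powr (1 + m / 2)"
      using s by (simp add: real_sqrt_mult powr_half_sqrt[symmetric] powr_powr add_divide_distrib)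
    finally have "2 / M * s / (sqrt (F 1) * s powr (1 + m / 2)) \<le> 2 / M * s / sqrt (F s)"
      using s m F_pos[of s] F_pos[of 1] by (intro divide_left_mono mult_nonneg_nonneg mult_pos_pos) auto
    also have "2 / M * s / (sqrt (F 1) * s powr (1 + m / 2)) = K / s powr (m / 2)"
      using s by (simp add: K_def powr_add)
    finally show ?thesis using 1 varphi_ge[OF s(1)] s by (intro exI[of _ s]) auto
  qed
  moreover have "\<exists>t. 1 \<le> t \<and> varphi f t \<le> y"
  proof -
    define K where "K = 2 / m / sqrt (F 1)"
    have K: "0 < K" using m F_pos[of 1] by (simp add: K_def)
    define t where "t = max 1 ((K / y) powr (2 / m))"
    have t: "1 \<le> t" by (simp add: t_def)
    have "K / y = ((K / y) powr (2 / m)) powr (m / 2)" using K y m by (simp add: powr_powr)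
    also have "\<dots> \<le> t powr (m / 2)" using m by (intro powr_mono2) (auto simp: t_def)
    finally have 1: "K / t powr (m / 2) \<le> y" using y t by (simp add: field_simps)
    have "varphi f t \<le> 2 / m * t * (1 / sqrt (F t))" using varphi_le[of t] t by simp
    also have "\<dots> \<le> 2 / m * t * (1 / sqrt (F 1) * (t / 1) powr (- 1 - m / 2))"
      using t m sqrt_F_power(1)[of 1 t] by (intro mult_left_mono) auto
    also have "\<dots> = K / t powr (m / 2)"
    proof -
      have "t powr (- 1 - m / 2) = 1 / (t * t powr (m / 2))"
        using t powr_minus_divide[of t "1 + m / 2"] by (simp add: powr_add)
      then show ?thesis using t by (simp add: K_def)
    qed
    finally show ?thesis using 1 t by (intro exI[of _ t]) auto
  qed
  ultimately obtain s t where st: "0 < s" "s \<le> 1" "y \<le> varphi f s" "1 \<le> t" "varphi f t \<le> y" by blast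
  have "\<exists>x\<ge>s. x \<le> t \<and> varphi f x = y"
    by (rule IVT2) (use st in \<open>auto intro!: DERIV_isCont[OF varphi_has_derivative]\<close>)
  then obtain x where "s \<le> x" "varphi f x = y" by blast
  then show ?thesis using st(1) by (intro exI[of _ x]) auto
qed

lemma varphi_image: "varphi f ` {0<..} = {0<..}"
  using varphi_pos varphi_surj by (auto simp: image_iff)

lemma psi_pos: "0 < y \<Longrightarrow> 0 < psi f y"
  using the_inv_into_into[OF inj_on_varphi, of y "{0<..}"] varphi_image by (auto simp: psi_def)

lemma varphi_psi: "0 < y \<Longrightarrow> varphi f (psi f y) = y"
  using f_the_inv_into_f[OF inj_on_varphi, of y] varphi_image by (auto simp: psi_def)

lemma psi_varphi: "0 < t \<Longrightarrow> psi f (varphi f t) = t"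
  unfolding psi_def by (rule the_inv_into_f_f[OF inj_on_varphi]) auto

lemma psi_strict_antimono: assumes "0 < x" "x < y" shows "psi f y < psi f x"
proof (rule ccontr)
  assume "\<not> ?thesis"
  then have "varphi f (psi f y) \<le> varphi f (psi f x)"
    using varphi_strict_antimono[of "psi f x" "psi f y"] psi_pos[of x] assms
    by (cases "psi f x = psi f y") auto
  then show False using varphi_psi[of x] varphi_psi[of y] assms by simp
qed

lemma psi_has_derivative:
  assumes y: "0 < y" shows "(psi f has_real_derivative - sqrt (F (psi f y))) (at y)"
proof -
  define t where "t = psi f y"
  have t: "0 < t" "varphi f t = y" using psi_pos[OF y] varphi_psi[OF y] by (simp_all add: t_def)
  have "isCont (psi f) (varphi f t)"
  proof (rule isCont_inverse_function[where d="t / 2" and f="varphi f" and g="psi f" and x=t])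
    fix z assume "\<bar>z - t\<bar> \<le> t / 2"
    then have z: "0 < z" using t by linarith
    show "psi f (varphi f z) = z" using psi_varphi[OF z] .
    show "isCont (varphi f) z" by (rule DERIV_isCont[OF varphi_has_derivative[OF z]])
  qed (use t in auto)
  then have c: "isCont (psi f) y" by (simp add: t)
  have "(psi f has_real_derivative inverse (- (1 / sqrt (F (psi f y))))) (at y)"
    by (rule DERIV_inverse_function[where f="varphi f" and a="y / 2" and b="2 * y"])
      (use y c varphi_has_derivative[OF psi_pos[OF y]] F_pos[OF psi_pos[OF y]] varphi_psi in auto)
  then show ?thesis by simp
qed

end

section \<open>Inverting the exponent\<close>

locale levy_scaling = levy_exponent +
  fixes a1 a2 \<delta>1 \<delta>2 :: real
  assumes scaling_consts: "0 < a1" "0 < a2" "0 < \<delta>1" "\<delta>1 \<le> \<delta>2" "\<delta>2 < 1"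
    and scaling_lower: "\<And>c t. 1 \<le> c \<Longrightarrow> 1 \<le> t \<Longrightarrow> a1 * c powr \<delta>1 * \<phi> t \<le> \<phi> (c * t)"
    and scaling_upper: "\<And>c t. 1 \<le> c \<Longrightarrow> 1 \<le> t \<Longrightarrow> \<phi> (c * t) \<le> a2 * c powr \<delta>2 * \<phi> t"
begin

lemma powr_unbounded:
  fixes K b :: real assumes "0 < b" obtains c where "1 \<le> c" "K \<le> c powr b"
proof
  define c where "c = max 1 (max 1 K powr (1 / b))"
  show "1 \<le> c" by (simp add: c_def)
  have "K \<le> max 1 K" by simp
  also have "max 1 K = (max 1 K powr (1 / b)) powr b" using assms by (simp add: powr_powr)
  also have "\<dots> \<le> c powr b" using assms by (intro powr_mono2) (auto simp: c_def)
  finally show "K \<le> c powr b" .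
qed

text \<open>If the derivative vanished at one point, it would vanish from there on since it decreases,
  and \<open>\<phi>\<close> would be eventually constant. The lower scaling bound excludes that.\<close>

lemma moment_1_pos: assumes x: "0 < x" shows "0 < moment 1 x"
proof (rule ccontr)
  assume "\<not> ?thesis"
  then have z: "moment 1 x = 0" using moment_nonneg[OF x, of 1] by simp
  have z': "moment 1 y = 0" if "x \<le> y" for y
  proof -
    have y: "0 < y" using x that by simp
    have "moment 1 y \<le> moment 1 x"
      unfolding moment_def
    proof (rule set_integral_mono)
      show "set_integrable lborel {0<..} (\<lambda>s. s ^ 1 * exp (- y * s) * \<nu> s)" using moment_integrable[OF y, of 0] by simp
      show "set_integrable lborel {0<..} (\<lambda>s. s ^ 1 * exp (- x * s) * \<nu> s)" using moment_integrable[OF x, of 0] by simp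
      show "s ^ 1 * exp (- y * s) * \<nu> s \<le> s ^ 1 * exp (- x * s) * \<nu> s" if "s \<in> {0<..}" for s
        using that \<open>x \<le> y\<close> nu_nonneg[of s] by (intro mult_right_mono mult_left_mono) auto
    qed
    then show ?thesis using z moment_nonneg[OF y, of 1] by simp
  qed
  define X where "X = max 1 x"
  have le: "\<phi> y \<le> \<phi> X" if "X \<le> y" for y
  proof (rule DERIV_nonpos_imp_nonincreasing[OF that])
    fix w assume "X \<le> w" "w \<le> y"
    then have w: "0 < w" "x \<le> w" by (auto simp: X_def)
    show "\<exists>d. (\<phi> has_real_derivative d) (at w) \<and> d \<le> 0"
      using phi_has_derivative[OF w(1)] z'[OF w(2)] by (intro exI[of _ 0]) auto
  qed
  obtain c where c: "1 \<le> c" "2 / a1 \<le> c powr \<delta>1" using powr_unbounded[of \<delta>1 "2 / a1"] scaling_consts by auto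
  have pX: "0 < \<phi> X" by (rule phi_pos) (simp add: X_def)
  have "2 \<le> a1 * c powr \<delta>1" using c scaling_consts by (simp add: field_simps)
  then have "2 * \<phi> X \<le> a1 * c powr \<delta>1 * \<phi> X" using pX by (intro mult_right_mono) auto
  also have "\<dots> \<le> \<phi> (c * X)" using c by (intro scaling_lower) (auto simp: X_def)
  also have "\<dots> \<le> \<phi> X" by (rule le) (use c mult_right_mono[of 1 c X] in \<open>auto simp: X_def\<close>)
  finally show False using pX by simp
qed

lemma phi_strict_mono: assumes "0 \<le> x" "x < y" shows "\<phi> x < \<phi> y"
proof (cases "x = 0")
  case True then show ?thesis using phi_0 phi_pos[of y] assms by simp
next
  case False
  show ?thesis
  proof (rule DERIV_pos_imp_increasing[OF assms(2)])
    fix w assume "x \<le> w" "w \<le> y"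
    then have w: "0 < w" using False assms by simp
    show "\<exists>d. (\<phi> has_real_derivative d) (at w) \<and> 0 < d"
      using phi_has_derivative[OF w] moment_1_pos[OF w] by blast
  qed
qed

lemma phi_inv_phi: assumes "0 \<le> x" shows "phi_inv \<phi> (\<phi> x) = x"
  unfolding phi_inv_def
proof (rule the_inv_into_f_f)
  show "inj_on \<phi> {0..}"
    by (rule linorder_inj_onI) (auto dest: phi_strict_mono[rotated])
qed (use assms in auto)

end

section \<open>The boundary profile\<close>

locale blowup_profile = ladder_renewal + power_like f m M for f m M
begin

text \<open>The value of the barrier at distance \<open>t\<close> from the boundary.\<close>

definition u :: "real \<Rightarrow> real" where "u t = psi f (V t)"

text \<open>By the equation \<open>psi' = - sqrt (F psi)\<close> this is the factor in the chain rule
  \<open>u' = - P * V'\<close>.\<close>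

definition P :: "real \<Rightarrow> real" where "P t = sqrt (primitive f (u t))"

definition du :: "real \<Rightarrow> real" where "du t = - (P t * v t)"

lemma u_pos: "0 < t \<Longrightarrow> 0 < u t" unfolding u_def by (intro psi_pos V_pos)

lemma varphi_u: "0 < t \<Longrightarrow> varphi f (u t) = V t" unfolding u_def by (intro varphi_psi V_pos)

lemma P_pos: "0 < t \<Longrightarrow> 0 < P t" unfolding P_def by (simp add: F_pos u_pos)

lemma u_strict_antimono: "0 < s \<Longrightarrow> s < t \<Longrightarrow> u t < u s"
  unfolding u_def by (intro psi_strict_antimono V_pos V_strict_mono) auto

lemma u_antimono: "0 < s \<Longrightarrow> s \<le> t \<Longrightarrow> u t \<le> u s"
  using u_strict_antimono[of s t] by (cases "s = t") auto

lemma u_surj: assumes r: "0 < r" obtains t where "0 < t" "u t = r"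
proof -
  have y: "0 < varphi f r" by (rule varphi_pos[OF r])
  have "filterlim V at_top at_top" using renewal by (simp add: renewal_function_def)
  then obtain b where b: "varphi f r \<le> V b"
    unfolding filterlim_at_top eventually_at_top_linorder by blast
  have b0: "0 < b" using b y V_nonpos[of b] by (cases "b \<le> 0") auto
  have "\<exists>x\<ge>0. x \<le> b \<and> V x = varphi f r"
    by (rule IVT) (use V_nonpos[of 0] y b b0 V_cont in \<open>auto simp: continuous_on_eq_continuous_at\<close>)
  then obtain x where x: "0 \<le> x" "V x = varphi f r" by blast
  have "0 < x" using x y V_nonpos[of x] by (cases "x = 0") auto
  moreover have "u x = r" using x psi_varphi[OF r] by (simp add: u_def)
  ultimately show ?thesis using that by blast
qed

lemma u_has_derivative: assumes t: "0 < t" shows "(u has_real_derivative du t) (at t)"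
  using DERIV_chain2[OF psi_has_derivative[OF V_pos[OF t]] V_has_derivative[OF t]]
  by (simp add: u_def[abs_def] du_def P_def)

text \<open>The bounds for \<open>varphi\<close> at \<open>u t\<close>, where \<open>varphi f (u t) = V t\<close>.\<close>

lemma P_bounds:
  assumes t: "0 < t" shows "P t \<le> 2 / m * u t / V t" "2 / M * u t / V t \<le> P t"
proof -
  have p: "0 < P t" "0 < V t" using P_pos[OF t] V_pos[OF t] by auto
  have 1: "V t \<le> 2 / m * u t / P t" using varphi_le[OF u_pos[OF t]] varphi_u[OF t] by (simp add: P_def)
  have 2: "2 / M * u t / P t \<le> V t" using varphi_ge[OF u_pos[OF t]] varphi_u[OF t] by (simp add: P_def)
  have "V t * P t \<le> 2 / m * u t" using 1 p(1) by (simp only: pos_le_divide_eq)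
  then have "P t * V t \<le> 2 / m * u t" by (simp only: mult.commute)
  then show "P t \<le> 2 / m * u t / V t" using p(2) by (simp only: pos_le_divide_eq)
  have "2 / M * u t \<le> V t * P t" using 2 p(1) by (simp only: pos_divide_le_eq)
  then have "2 / M * u t \<le> P t * V t" by (simp only: mult.commute)
  then show "2 / M * u t / V t \<le> P t" using p(2) by (simp only: pos_divide_le_eq)
qed

text \<open>The constant is the product of \<open>2 / m\<close> from \<open>P_bounds\<close> and \<open>48\<close> from \<open>v_le\<close>.\<close>

lemma du_bound: assumes t: "0 < t" shows "\<bar>du t\<bar> \<le> 96 / m * (u t / t)"
proof -
  have "P t * v t \<le> (2 / m * u t / V t) * (48 * V t / t)"
    using P_bounds(1)[OF t] v_le[OF t] v_nonneg[OF t] P_pos[OF t] m u_pos[OF t] V_pos[OF t] t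
    by (intro mult_mono) auto
  also have "\<dots> = 96 / m * (u t / t)" using V_pos[OF t] by simp
  finally show ?thesis using v_nonneg[OF t] P_pos[OF t] by (simp add: du_def abs_mult)
qed

text \<open>By \<open>du_bound\<close> the function \<open>ln (u t) + (96 / m) * ln t\<close> increases, so that \<open>u\<close> is doubling.\<close>

lemma u_half: assumes t: "0 < t" shows "u (t / 2) \<le> 2 powr (96 / m) * u t"
proof -
  have "ln (u (t / 2)) + 96 / m * ln (t / 2) \<le> ln (u t) + 96 / m * ln t"
  proof (rule DERIV_nonneg_imp_nondecreasing[of "t/2" t "\<lambda>x. ln (u x) + 96 / m * ln x"])
    fix x assume "t / 2 \<le> x" "x \<le> t"
    then have x: "0 < x" using t by simp
    have "((\<lambda>x. ln (u x) + 96 / m * ln x) has_real_derivative 1 / u x * du x + 96 / m * (1 / x)) (at x)"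
      by (intro DERIV_add DERIV_cmult DERIV_ln_divide x DERIV_chain2[OF DERIV_ln_divide[OF u_pos[OF x]] u_has_derivative[OF x]])
    moreover have "0 \<le> 1 / u x * du x + 96 / m * (1 / x)"
    proof -
      have "- du x \<le> 96 / m * (u x / x)" using du_bound[OF x] by linarith
      then have "1 / u x * (- du x) \<le> 1 / u x * (96 / m * (u x / x))" using u_pos[OF x] by (intro mult_left_mono) auto
      also have "\<dots> = 96 / m * (1 / x)" using u_pos[OF x] by simp
      finally show ?thesis by simp
    qed
    ultimately show "\<exists>y. ((\<lambda>x. ln (u x) + 96 / m * ln x) has_real_derivative y) (at x) \<and> 0 \<le> y" by blast
  qed (use t in simp)
  then have "ln (u (t / 2)) \<le> ln (u t) + 96 / m * ln 2" using t by (simp add: ln_div right_diff_distrib diff_divide_distrib)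
  then have "exp (ln (u (t / 2))) \<le> exp (ln (u t) + 96 / m * ln 2)" by simp
  then show ?thesis using u_pos[of t] u_pos[of "t/2"] t by (simp add: exp_add powr_def mult.commute)
qed

lemma P_has_derivative: assumes t: "0 < t" shows "(P has_real_derivative - (f (u t) * v t / 2)) (at t)"
proof -
  have p: "0 < primitive f (u t)" by (rule F_pos[OF u_pos[OF t]])
  have "(P has_real_derivative inverse (sqrt (primitive f (u t))) / 2 * (f (u t) * du t)) (at t)"
    unfolding P_def[abs_def]
    by (intro DERIV_chain2[where f=sqrt and g="\<lambda>x. primitive f (u x)"] DERIV_real_sqrt p
        DERIV_chain2[where f="primitive f" and g=u] F_has_derivative u_has_derivative t)
  also have "inverse (sqrt (primitive f (u t))) / 2 * (f (u t) * du t) = - (f (u t) * v t / 2)"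
    using p by (simp add: du_def P_def)
  finally show ?thesis .
qed

lemma P_antimono: assumes "0 < s" "s \<le> t" shows "P t \<le> P s"
proof (rule DERIV_nonpos_imp_nonincreasing[OF assms(2)])
  fix x assume "s \<le> x" "x \<le> t"
  then have x: "0 < x" using assms by simp
  show "\<exists>y. (P has_real_derivative y) (at x) \<and> y \<le> 0"
    using P_has_derivative[OF x] f_nonneg[of "u x"] v_nonneg[OF x] by (intro exI[of _ "- (f (u x) * v x / 2)"]) auto
qed

lemma P_derivative_bound: assumes t: "0 < t" shows "f (u t) * v t / 2 \<le> (2 + M) * (48 / m) * (P t / t)"
proof -
  have u0: "0 < u t" by (rule u_pos[OF t])
  have "f (u t) \<le> (2 + M) * primitive f (u t) / u t" using F_growth(2)[OF u0] u0 by (simp add: field_simps)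
  also have "primitive f (u t) = P t * P t" using F_pos[OF u0] by (simp add: P_def)
  finally have 1: "f (u t) \<le> (2 + M) * P t / u t * P t" by simp
  also have "\<dots> \<le> (2 + M) * P t / u t * (2 / m * u t / V t)"
    using P_bounds(1)[OF t] P_pos[OF t] u0 m by (intro mult_left_mono) auto
  also have "\<dots> = (2 + M) * (2 / m) * P t / V t" using u0 by simp
  finally have "f (u t) * v t \<le> ((2 + M) * (2 / m) * P t / V t) * (48 * V t / t)"
    using v_le[OF t] v_nonneg[OF t] f_nonneg m P_pos[OF t] V_pos[OF t] by (intro mult_mono) auto
  also have "\<dots> = 2 * ((2 + M) * (48 / m) * (P t / t))" using V_pos[OF t] by simp
  finally have "f (u t) * v t / 2 \<le> 2 * ((2 + M) * (48 / m) * (P t / t)) / 2" by (rule divide_right_mono) simp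
  then show ?thesis by (simp only: nonzero_mult_div_cancel_left zero_neq_numeral[symmetric] not_False_eq_True simp_thms)
qed

lemma P_V_bound: assumes t: "0 < t" shows "P (t / 2) * V (2 * t) \<le> 2 / m * 4 ^ 48 * 2 powr (96 / m) * u t"
proof -
  have t2: "0 < t / 2" using t by simp
  have "V (2 * t) / (2 * t) ^ 48 \<le> V (t / 2) / (t / 2) ^ 48" by (rule V_quotient_antimono) (use t in auto)
  then have "V (2 * t) \<le> V (t / 2) / (t / 2) ^ 48 * (2 * t) ^ 48" using t by (simp only: pos_divide_le_eq zero_less_power mult_pos_pos zero_less_numeral)
  also have "\<dots> = 4 ^ 48 * V (t / 2)"
  proof -
    have "(2 * t) ^ 48 = 4 ^ 48 * (t / 2) ^ 48" by (simp only: power_mult_distrib[symmetric]) simp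
    then show ?thesis using t by simp
  qed
  finally have 1: "V (2 * t) \<le> 4 ^ 48 * V (t / 2)" .
  have "P (t / 2) * V (2 * t) \<le> (2 / m * u (t / 2) / V (t / 2)) * (4 ^ 48 * V (t / 2))"
    using P_bounds(1)[OF t2] 1 m u_pos[OF t2] V_pos[OF t2] V_nonneg by (intro mult_mono) auto
  also have "\<dots> = 2 / m * 4 ^ 48 * u (t / 2)" using V_pos[OF t2] by simp
  also have "\<dots> \<le> 2 / m * 4 ^ 48 * (2 powr (96 / m) * u t)" using u_half[OF t] m by (intro mult_left_mono) auto
  finally show ?thesis by (simp only: mult.assoc)
qed

text \<open>The product rule for \<open>u' = - P * v\<close>. The factor \<open>P\<close> is Lipschitz with constant of order
  \<open>P / t\<close> by \<open>P_derivative_bound\<close>, and \<open>v\<close> is Hoelder continuous by \<open>v_hoelder\<close>. The window around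
  \<open>t\<close> has endpoints with ratio two, as the latter requires, and lies in \<open>[t / 2, 2 * t]\<close>; the
  doubling properties of \<open>u\<close> and \<open>V\<close> then reduce everything to the value of \<open>u\<close> at \<open>t\<close>.\<close>

lemma du_hoelder:
  assumes b: "0 < b" "b < 1"
  obtains C where "0 < C" "\<And>t s s'. 0 < t \<Longrightarrow> 2 * t / 3 \<le> s \<Longrightarrow> s \<le> s' \<Longrightarrow> s' \<le> 4 * t / 3 \<Longrightarrow>
     \<bar>du s' - du s\<bar> \<le> C * (u t / t) * ((s' - s) / t) powr b"
proof -
  obtain C where C: "0 < C" "\<And>t t'. 0 < t \<Longrightarrow> t \<le> t' \<Longrightarrow> t' \<le> 2 * t \<Longrightarrow>
     \<bar>v t' - v t\<bar> \<le> C * V t' / t * ((t' - t) / t) powr b"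
    using v_hoelder[OF b] by blast
  define A where "A = (2 + M) * (48 / m)"
  define B where "B = 2 / m * 4 ^ 48 * 2 powr (96 / m)"
  have A: "0 < A" and B: "0 < B" using m by (auto simp: A_def B_def)
  define D where "D = A * 2 * 96 * B + 4 * C * B"
  have D: "0 < D" using A B C(1) by (simp add: D_def add_pos_pos)
  have "\<bar>du s' - du s\<bar> \<le> D * (u t / t) * ((s' - s) / t) powr b"
    if t: "0 < t" and s: "2 * t / 3 \<le> s" "s \<le> s'" "s' \<le> 4 * t / 3" for t s s'
  proof -
    have s0: "0 < s" "t / 2 \<le> s" "s' \<le> 2 * t" "s' \<le> 2 * s" "0 < s'" using t s by auto
    define r where "r = ((s' - s) / t) powr b"
    have "(s' - s) / t = ((s' - s) / t) powr 1" using t s by simp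
    also have "\<dots> \<le> r" unfolding r_def using t s b by (intro powr_mono') (auto simp: field_simps)
    finally have r: "(s' - s) / t \<le> r" .
    have r0: "0 \<le> r" by (simp add: r_def)
    have PV: "P (t / 2) * V (2 * t) \<le> B * u t" using P_V_bound[OF t] by (simp add: B_def)
    have "norm (P s' - P s) \<le> A * (2 * P (t / 2) / t) * norm (s' - s)"
    proof (rule field_differentiable_bound[where S="{s..s'}" and f'="\<lambda>x. - (f (u x) * v x / 2)"])
      fix x assume x: "x \<in> {s..s'}"
      then have x0: "0 < x" "t / 2 \<le> x" using s0 by auto
      show "(P has_field_derivative - (f (u x) * v x / 2)) (at x within {s..s'})"
        by (rule has_field_derivative_at_within[OF P_has_derivative[OF x0(1)]])
      have "f (u x) * v x / 2 \<le> A * (P x / x)" using P_derivative_bound[OF x0(1)] by (simp add: A_def)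
      also have "\<dots> \<le> A * (P (t / 2) / (t / 2))"
        using A P_antimono[of "t/2" x] x0 t P_pos[OF x0(1)] P_pos[of "t/2"] by (intro mult_left_mono frac_le) auto
      finally have "f (u x) * v x / 2 \<le> A * (2 * P (t / 2) / t)" by simp
      moreover have "norm (- (f (u x) * v x / 2)) = f (u x) * v x / 2"
        using f_nonneg[of "u x"] v_nonneg[OF x0(1)] by simp
      ultimately show "norm (- (f (u x) * v x / 2)) \<le> A * (2 * P (t / 2) / t)" by linarith
    qed (use s in auto)
    then have P1: "\<bar>P s' - P s\<bar> \<le> A * 2 * P (t / 2) * ((s' - s) / t)" using s by simp
    have "v s' \<le> 48 * V s' / s'" by (rule v_le) (use s0 in auto)
    also have "\<dots> \<le> 48 * V (2 * t) / (t / 2)"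
      using V_mono[of s' "2 * t"] s0 t V_nonneg s by (intro frac_le) auto
    finally have v1: "v s' \<le> 96 * V (2 * t) / t" by simp
    have "\<bar>v s' - v s\<bar> \<le> C * V s' / s * ((s' - s) / s) powr b" by (rule C(2)) (use s0 s in auto)
    also have "\<dots> \<le> C * V (2 * t) / (t / 2) * ((s' - s) / (t / 2)) powr b"
      using V_mono[of s' "2 * t"] s0 t V_nonneg s C(1) b
      by (intro mult_mono frac_le powr_mono2 divide_left_mono mult_left_mono) auto
    also have "((s' - s) / (t / 2)) powr b = 2 powr b * r"
    proof -
      have "(s' - s) / (t / 2) = 2 * ((s' - s) / t)" by simp
      then show ?thesis using s t by (simp only: r_def powr_mult)
    qed
    also have "C * V (2 * t) / (t / 2) * (2 powr b * r) \<le> C * V (2 * t) / (t / 2) * (2 powr 1 * r)"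
      using b r0 C(1) V_nonneg t by (intro mult_left_mono mult_right_mono powr_mono) auto
    finally have v2: "\<bar>v s' - v s\<bar> \<le> 4 * C * V (2 * t) / t * r" by simp
    have eq: "du s' - du s = - ((P s' - P s) * v s') - P s * (v s' - v s)" by (simp add: du_def algebra_simps)
    have "\<bar>du s' - du s\<bar> \<le> \<bar>(P s' - P s) * v s'\<bar> + \<bar>P s * (v s' - v s)\<bar>" unfolding eq by linarith
    also have "\<dots> = \<bar>P s' - P s\<bar> * v s' + P s * \<bar>v s' - v s\<bar>"
      using v_nonneg[OF s0(5)] P_pos[OF s0(1)] by (simp add: abs_mult)
    also have "\<dots> \<le> (A * 2 * P (t / 2) * r) * (96 * V (2 * t) / t) + P (t / 2) * (4 * C * V (2 * t) / t * r)"
    proof (intro add_mono)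
      have "A * 2 * P (t / 2) * ((s' - s) / t) \<le> A * 2 * P (t / 2) * r"
        using r A P_pos[of "t/2"] t by (intro mult_left_mono) auto
      then have "\<bar>P s' - P s\<bar> \<le> A * 2 * P (t / 2) * r" using P1 by linarith
      then show "\<bar>P s' - P s\<bar> * v s' \<le> (A * 2 * P (t / 2) * r) * (96 * V (2 * t) / t)"
        using v1 v_nonneg[OF s0(5)] A P_pos[of "t/2"] t r0 by (intro mult_mono) auto
      show "P s * \<bar>v s' - v s\<bar> \<le> P (t / 2) * (4 * C * V (2 * t) / t * r)"
        using v2 P_antimono[of "t/2" s] s0 t P_pos[of "t/2"] by (intro mult_mono) auto
    qed
    also have "\<dots> = (A * 2 * 96 + 4 * C) * (P (t / 2) * V (2 * t)) * (r / t)" by (simp add: algebra_simps add_divide_distrib)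
    also have "\<dots> \<le> (A * 2 * 96 + 4 * C) * (B * u t) * (r / t)"
      using PV A C(1) r0 t by (intro mult_right_mono mult_left_mono) auto
    also have "\<dots> = D * (u t / t) * r" by (simp add: D_def algebra_simps add_divide_distrib)
    finally show ?thesis by (simp only: r_def)
  qed
  then show ?thesis using that D by blast
qed

text \<open>From \<open>t * f t \<ge> 2 * F t\<close> and \<open>sqrt (F (u t)) \<ge> (2 / M) * u t / V t\<close>, together with
  \<open>V_comparable\<close>.\<close>

lemma f_lower:
  obtains c where "0 < c" "\<And>t. 0 < t \<Longrightarrow> c * (u t * \<phi> (1 / t\<^sup>2)) \<le> f (u t)"
proof -
  obtain c C where C: "0 < c" "0 < C" "\<And>t. 0 < t \<Longrightarrow> c / sqrt (\<phi> (1 / t\<^sup>2)) \<le> V t"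
    "\<And>t. 0 < t \<Longrightarrow> V t \<le> C / sqrt (\<phi> (1 / t\<^sup>2))"
    by (rule V_comparable) (rule that; assumption)
  have "8 / M\<^sup>2 / C\<^sup>2 * (u t * \<phi> (1 / t\<^sup>2)) \<le> f (u t)" if t: "0 < t" for t
  proof -
    have p: "0 < \<phi> (1 / t\<^sup>2)" using t by (intro phi_pos) simp
    have u0: "0 < u t" and V0: "0 < V t" using u_pos[OF t] V_pos[OF t] by auto
    have "V t ^ 2 \<le> (C / sqrt (\<phi> (1 / t\<^sup>2))) ^ 2" using C(4)[OF t] V0 by (intro power_mono) auto
    then have "V t ^ 2 \<le> C\<^sup>2 / \<phi> (1 / t\<^sup>2)" using p by (simp add: power_divide)
    then have "V t ^ 2 * \<phi> (1 / t\<^sup>2) \<le> C\<^sup>2" using p by (simp only: pos_le_divide_eq)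
    then have 1: "\<phi> (1 / t\<^sup>2) / C\<^sup>2 \<le> 1 / V t ^ 2" using V0 C(2) by (simp add: field_simps)
    have "(2 / M * u t / V t)\<^sup>2 \<le> P t ^ 2" using P_bounds(2)[OF t] m u0 V0 by (intro power_mono) auto
    also have "P t ^ 2 = primitive f (u t)" using F_pos[OF u0] by (simp add: P_def)
    finally have 2: "(2 / M * u t / V t)\<^sup>2 \<le> primitive f (u t)" .
    have "2 * primitive f (u t) \<le> (2 + m) * primitive f (u t)" using F_pos[OF u0] m by (intro mult_right_mono) auto
    then have "2 * primitive f (u t) \<le> u t * f (u t)" using F_growth(1)[OF u0] by linarith
    then have "2 * (2 / M * u t / V t)\<^sup>2 \<le> u t * f (u t)" using 2 by linarith
    moreover have "2 * (2 / M * u t / V t)\<^sup>2 = u t * (8 / M\<^sup>2 * u t * (1 / V t ^ 2))"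
      by (simp add: power_divide power_mult_distrib power2_eq_square mult_ac)
    ultimately have "u t * (8 / M\<^sup>2 * u t * (1 / V t ^ 2)) \<le> u t * f (u t)" by (simp only:)
    then have "8 / M\<^sup>2 * u t * (1 / V t ^ 2) \<le> f (u t)" using u0 by (rule mult_left_le_imp_le)
    moreover have "8 / M\<^sup>2 * u t * (\<phi> (1 / t\<^sup>2) / C\<^sup>2) \<le> 8 / M\<^sup>2 * u t * (1 / V t ^ 2)"
      using 1 u0 by (intro mult_left_mono) auto
    ultimately show ?thesis by simp
  qed
  moreover have "0 < 8 / M\<^sup>2 / C\<^sup>2" using m C(2) by simp
  ultimately show ?thesis using that by blast
qed

end

locale scaled_profile = blowup_profile + levy_scaling
begin

text \<open>Put \<open>X = 1 / t\<^sup>2\<close>. By \<open>V_comparable\<close>, \<open>1 / (V t)\<^sup>2\<close> is comparable with \<open>\<phi> X\<close>, and by the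
  lower scaling bound a constant factor of \<open>\<phi>\<close> is made up by a constant factor \<open>A\<close> of its
  argument. Hence the preimage of \<open>1 / (V t)\<^sup>2\<close> lies between \<open>X / A\<close> and \<open>A * X\<close>. The restriction
  on \<open>t\<close> keeps \<open>X / A\<close> in the range \<open>[1, \<infinity>)\<close> of the scaling condition.\<close>

lemma inverse_profile_comparable:
  obtains A t0 where "0 < A" "0 < t0"
    "\<And>t. 0 < t \<Longrightarrow> t \<le> t0 \<Longrightarrow> t \<le> A * (1 / sqrt (phi_inv \<phi> (1 / (varphi f (u t))\<^sup>2)))"
    "\<And>t. 0 < t \<Longrightarrow> t \<le> t0 \<Longrightarrow> 1 / sqrt (phi_inv \<phi> (1 / (varphi f (u t))\<^sup>2)) \<le> A * t"
proof -
  obtain c C where C: "0 < c" "0 < C" "\<And>t. 0 < t \<Longrightarrow> c / sqrt (\<phi> (1 / t\<^sup>2)) \<le> V t"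
     "\<And>t. 0 < t \<Longrightarrow> V t \<le> C / sqrt (\<phi> (1 / t\<^sup>2))"
    by (rule V_comparable) (rule that; assumption)
  obtain A where A: "1 \<le> A" "max (1 / c\<^sup>2) (C\<^sup>2) / a1 \<le> A powr \<delta>1"
    using powr_unbounded[of \<delta>1] scaling_consts by blast
  have A': "1 / c\<^sup>2 \<le> a1 * A powr \<delta>1" "C\<^sup>2 \<le> a1 * A powr \<delta>1"
    using A(2) scaling_consts by (auto simp: pos_divide_le_eq mult.commute)
  have main: "t / sqrt A \<le> 1 / sqrt (phi_inv \<phi> (1 / (V t)\<^sup>2)) \<and> 1 / sqrt (phi_inv \<phi> (1 / (V t)\<^sup>2)) \<le> sqrt A * t"
    if t: "0 < t" "t \<le> 1 / sqrt A" for t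
  proof -
    define X where "X = 1 / t\<^sup>2"
    define y where "y = 1 / (V t)\<^sup>2"
    have "t\<^sup>2 \<le> (1 / sqrt A)\<^sup>2" using t by (intro power_mono) auto
    then have "t\<^sup>2 \<le> 1 / A" using A by (simp add: power_divide)
    then have X: "1 \<le> X / A" "0 < X" using t A(1) by (auto simp: X_def field_simps)
    have X1: "1 \<le> X" using X A(1) by (simp add: field_simps)
    have p: "0 < \<phi> X" by (rule phi_pos[OF X(2)])
    have V0: "0 < V t" by (rule V_pos[OF t(1)])
    have "(c / sqrt (\<phi> X))\<^sup>2 \<le> (V t)\<^sup>2" using C(3)[OF t(1)] C(1) p unfolding X_def by (intro power_mono) auto
    then have "c\<^sup>2 / \<phi> X \<le> (V t)\<^sup>2" using p by (simp add: power_divide)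
    then have "y \<le> 1 / c\<^sup>2 * \<phi> X" using V0 C(1) p by (simp add: y_def field_simps)
    also have "\<dots> \<le> a1 * A powr \<delta>1 * \<phi> X" using A'(1) p by (intro mult_right_mono) auto
    also have "\<dots> \<le> \<phi> (A * X)" by (rule scaling_lower[OF A(1) X1])
    finally have y1: "y \<le> \<phi> (A * X)" .
    have "(V t)\<^sup>2 \<le> (C / sqrt (\<phi> X))\<^sup>2" using C(4)[OF t(1)] V0 unfolding X_def by (intro power_mono) auto
    then have "(V t)\<^sup>2 \<le> C\<^sup>2 / \<phi> X" using p by (simp add: power_divide)
    then have y2: "\<phi> X / C\<^sup>2 \<le> y" using V0 C(2) p by (simp add: y_def field_simps)
    have "a1 * A powr \<delta>1 * \<phi> (X / A) \<le> \<phi> (A * (X / A))" by (rule scaling_lower[OF A(1) X(1)])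
    then have "C\<^sup>2 * \<phi> (X / A) \<le> \<phi> X"
      using A'(2) A(1) mult_right_mono[of "C\<^sup>2" "a1 * A powr \<delta>1" "\<phi> (X / A)"] phi_nonneg[of "X / A"] X by simp
    then have "\<phi> (X / A) \<le> \<phi> X / C\<^sup>2" using C(2) by (simp add: field_simps)
    then have y3: "\<phi> (X / A) \<le> y" using y2 by linarith
    have "\<exists>x\<ge>X / A. x \<le> A * X \<and> \<phi> x = y"
    proof (rule IVT[where f=\<phi>, OF y3 y1])
      have "X / A \<le> X / 1" using A(1) X by (intro divide_left_mono) auto
      also have "\<dots> \<le> A * X" using A(1) X mult_right_mono[of 1 A X] by simp
      finally show "X / A \<le> A * X" .
      show "\<forall>x. X / A \<le> x \<and> x \<le> A * X \<longrightarrow> isCont \<phi> x"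
        using X by (auto intro!: DERIV_isCont[OF phi_has_derivative])
    qed
    then obtain x where x: "X / A \<le> x" "x \<le> A * X" "\<phi> x = y" by blast
    have x0: "0 < x" using x(1) X by linarith
    have inv: "phi_inv \<phi> y = x" using phi_inv_phi[of x] x x0 by simp
    have "sqrt x \<le> sqrt (A * X)" using x(2) by simp
    also have "\<dots> = sqrt A / t" using t by (simp add: X_def real_sqrt_mult real_sqrt_divide)
    finally have 1: "t / sqrt A \<le> 1 / sqrt x" using x0 t A(1) by (simp add: field_simps)
    have "sqrt (X / A) \<le> sqrt x" using x(1) by simp
    moreover have "sqrt (X / A) = 1 / (t * sqrt A)" using t by (simp add: X_def real_sqrt_mult real_sqrt_divide)
    ultimately have "1 / (t * sqrt A) \<le> sqrt x" by simp
    then have 2: "1 / sqrt x \<le> sqrt A * t" using x0 t A(1) by (simp add: field_simps)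
    show ?thesis using 1 2 inv by (simp add: y_def)
  qed
  show ?thesis
  proof (rule that[of "sqrt A" "1 / sqrt A"])
    fix t assume t: "0 < t" "t \<le> 1 / sqrt A"
    show "t \<le> sqrt A * (1 / sqrt (phi_inv \<phi> (1 / (varphi f (u t))\<^sup>2)))"
      "1 / sqrt (phi_inv \<phi> (1 / (varphi f (u t))\<^sup>2)) \<le> sqrt A * t"
      using main[OF t] varphi_u[OF t(1)] A(1) by (auto simp: field_simps)
  qed (use A in auto)
qed

end

section \<open>The jump kernel\<close>

text \<open>With \<open>x = r\<^sup>2 / s\<close> the left-hand side is at most \<open>x powr (d / 2) * exp (- x / 4) / r ^ d\<close>,
  whereas the factor \<open>1 - exp (- 1 / x)\<close> on the right is at least \<open>1 / 2\<close> for \<open>x \<le> 1\<close> and at least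
  \<open>1 / (2 * x)\<close> otherwise. The right-hand side integrates against \<open>\<nu>\<close> to \<open>\<phi> (1 / r\<^sup>2)\<close>.\<close>

lemma heat_kernel_le:
  fixes d :: nat and r s :: real
  assumes r: "0 < r" and s: "0 < s"
  shows "(4 * pi * s) powr (- real d / 2) * exp (- (r\<^sup>2) / (4 * s))
     \<le> 2 * (4 ^ Suc d * fact (Suc d)) / r ^ d * (1 - exp (- (1 / r\<^sup>2) * s))"
proof -
  define x where "x = r\<^sup>2 / s"
  define K where "K = (4 ^ Suc d * fact (Suc d) :: real)"
  have x: "0 < x" using r s by (simp add: x_def)
  have K1: "1 \<le> K" unfolding K_def
    using mult_mono[of 1 "4 ^ Suc d :: real" 1 "fact (Suc d)"] one_le_power[of "4::real" "Suc d"] fact_ge_1[of "Suc d", where 'a=real] by simp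
  have e1: "exp (1 / x) \<ge> 1 + 1 / x" by (rule exp_ge_add_one_self)
  have y: "(1 / x) / (1 + 1 / x) \<le> 1 - exp (- (1 / x))"
  proof -
    have "exp (- (1 / x)) \<le> 1 / (1 + 1 / x)"
      using e1 x by (simp add: exp_minus inverse_eq_divide) (intro divide_left_mono mult_pos_pos add_pos_pos; simp)
    moreover have "1 - 1 / (1 + 1 / x) = (1 / x) / (1 + 1 / x)"
    proof -
      have "1 + 1 / x \<noteq> 0" using x by (smt (verit) divide_pos_pos)
      then show ?thesis by (simp add: diff_divide_eq_iff)
    qed
    ultimately show ?thesis by linarith
  qed
  have main: "x powr (real d / 2) * exp (- (x / 4)) \<le> 2 * K * (1 - exp (- (1 / x)))"
  proof (cases "x \<le> 1")
    case True
    have "x powr (real d / 2) \<le> 1 powr (real d / 2)" using True x by (intro powr_mono2) auto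
    then have "x powr (real d / 2) * exp (- (x / 4)) \<le> 1 * 1" using x by (intro mult_mono) auto
    moreover have "1 / 2 \<le> (1 / x) / (1 + 1 / x)" using True x by (simp add: field_simps)
    then have "1 / 2 \<le> 1 - exp (- (1 / x))" using y by linarith
    then have "2 * 1 * (1 / 2) \<le> 2 * K * (1 - exp (- (1 / x)))" using K1 by (intro mult_mono) auto
    ultimately show ?thesis by simp
  next
    case False
    have "x powr (real d / 2) \<le> x powr real d" using False by (intro powr_mono) auto
    also have "\<dots> = x ^ d" using x by (simp add: powr_realpow)
    finally have 1: "x powr (real d / 2) \<le> x ^ d" .
    have "(x / 4) ^ Suc d * exp (- (x / 4)) \<le> fact (Suc d)"
      using x by (intro power_exp_minus_le) auto
    then have "4 ^ Suc d * ((x / 4) ^ Suc d * exp (- (x / 4))) \<le> K" unfolding K_def by (intro mult_left_mono) auto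
    then have "x * (x ^ d * exp (- (x / 4))) \<le> K" by (simp add: power_divide mult.assoc)
    then have "x ^ d * exp (- (x / 4)) \<le> K / x" using x by (simp add: field_simps)
    moreover have "x powr (real d / 2) * exp (- (x / 4)) \<le> x ^ d * exp (- (x / 4))" using 1 by (intro mult_right_mono) auto
    moreover have "1 / (2 * x) \<le> (1 / x) / (1 + 1 / x)" using False x by (simp add: field_simps)
    then have "2 * K * (1 / (2 * x)) \<le> 2 * K * (1 - exp (- (1 / x)))" using y K1 by (intro mult_left_mono) auto
    moreover have "2 * K * (1 / (2 * x)) = K / x" by simp
    ultimately show ?thesis by linarith
  qed
  have "(4 * pi * s) powr (- real d / 2) \<le> s powr (- real d / 2)"
  proof -
    have "1 * s \<le> 4 * pi * s" using s pi_ge_two by (intro mult_right_mono) auto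
    then show ?thesis using s by (intro powr_mono2') auto
  qed
  also have "s powr (- real d / 2) = x powr (real d / 2) / r ^ d"
  proof -
    have "(r powr 2) powr (real d / 2) = r powr real d" unfolding powr_powr by simp
    then have "(r\<^sup>2) powr (real d / 2) = r ^ d" using r by (simp add: powr_realpow)
    then show ?thesis using r s by (simp add: x_def powr_divide powr_minus_divide)
  qed
  finally have "(4 * pi * s) powr (- real d / 2) * exp (- (r\<^sup>2) / (4 * s)) \<le> x powr (real d / 2) / r ^ d * exp (- (r\<^sup>2) / (4 * s))"
    by (intro mult_right_mono) auto
  also have "\<dots> = (x powr (real d / 2) * exp (- (x / 4))) / r ^ d" by (simp add: x_def mult.commute)
  also have "\<dots> \<le> (2 * K * (1 - exp (- (1 / x)))) / r ^ d" using main r by (intro divide_right_mono) auto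
  also have "\<dots> = 2 * K / r ^ d * (1 - exp (- (1 / r\<^sup>2) * s))" by (simp add: x_def)
  finally show ?thesis by (simp add: K_def)
qed

lemma borel_measurable_scaled_indicator:
  assumes [measurable]: "A \<in> sets borel"
  shows "(\<lambda>z. c * indicator A z :: ennreal) \<in> borel_measurable lborel"
  by measurable

lemma ennreal_le_suminf: "g k \<le> (\<Sum>k. g k)" for g :: "nat \<Rightarrow> ennreal"
  using sum_le_suminf[of g "{k}"] by simp

text \<open>On the annulus with radii \<open>2 ^ k * a\<close> and \<open>2 ^ (k + 1) * a\<close> the integrand is at most
  \<open>(2 ^ k * a)\<close> to the power \<open>- d\<close>, and the set has volume of the order \<open>(2 ^ k * a) ^ (d - 1)\<close>.
  The terms of the series are of order \<open>2 ^ (- k) / a\<close>.\<close>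

lemma nn_integral_dyadic_tail:
  fixes x :: "'a::euclidean_space" and S :: "'a set"
  assumes [measurable]: "S \<in> sets borel" and a: "0 < a" and c: "0 \<le> c" and n: "DIM('a) = Suc n"
    and vol: "\<And>r. a \<le> r \<Longrightarrow> emeasure lborel (S \<inter> ball x r) \<le> ennreal (c * r ^ n)"
  shows "(\<integral>\<^sup>+y. indicator (S - ball x a) y * ennreal (1 / norm (y - x) ^ DIM('a)) \<partial>lborel) \<le> ennreal (2 ^ Suc n * c / a)"
proof -
  have pt: "indicator (S - ball x a) y * ennreal (1 / norm (y - x) ^ Suc n)
     \<le> (\<Sum>k. ennreal (1 / (2 ^ k * a) ^ Suc n) * indicator (S \<inter> ball x (2 ^ Suc k * a)) y)" for y
  proof (cases "y \<in> S - ball x a")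
    case True
    define q where "q = norm (y - x)"
    have q: "a \<le> q" using True by (simp add: q_def dist_norm norm_minus_commute)
    obtain N where N: "q / a < 2 ^ N" using real_arch_pow[of 2 "q / a"] by auto
    define k where "k = (LEAST k. q < 2 ^ Suc k * a)"
    have "q < 2 ^ Suc N * a"
    proof -
      have "q < 2 ^ N * a" using N a by (simp only: pos_divide_less_eq)
      also have "\<dots> \<le> 2 ^ Suc N * a" using a by (intro mult_right_mono) auto
      finally show ?thesis .
    qed
    then have k1: "q < 2 ^ Suc k * a" unfolding k_def by (rule LeastI)
    have k2: "2 ^ k * a \<le> q"
    proof (cases k)
      case 0 then show ?thesis using q by simp
    next
      case (Suc l)
      have "\<not> q < 2 ^ Suc l * a" by (rule not_less_Least) (use Suc in \<open>simp add: k_def\<close>)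
      then show ?thesis using Suc by simp
    qed
    have "1 / q ^ Suc n \<le> 1 / (2 ^ k * a) ^ Suc n"
      using k2 a q by (intro divide_left_mono power_mono mult_pos_pos zero_less_power) auto
    then have "ennreal (1 / q ^ Suc n) \<le> ennreal (1 / (2 ^ k * a) ^ Suc n)" by (rule ennreal_leI)
    also have "\<dots> = (\<lambda>k. ennreal (1 / (2 ^ k * a) ^ Suc n) * indicator (S \<inter> ball x (2 ^ Suc k * a)) y) k"
      using True k1 by (simp add: q_def dist_norm norm_minus_commute)
    also have "\<dots> \<le> (\<Sum>k. ennreal (1 / (2 ^ k * a) ^ Suc n) * indicator (S \<inter> ball x (2 ^ Suc k * a)) y)"
      by (rule ennreal_le_suminf)
    finally show ?thesis using True by (simp add: q_def)
  qed simp
  have "(\<integral>\<^sup>+y. indicator (S - ball x a) y * ennreal (1 / norm (y - x) ^ Suc n) \<partial>lborel)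
     \<le> (\<integral>\<^sup>+y. (\<Sum>k. ennreal (1 / (2 ^ k * a) ^ Suc n) * indicator (S \<inter> ball x (2 ^ Suc k * a)) y) \<partial>lborel)"
    by (intro nn_integral_mono pt)
  also have "\<dots> = (\<Sum>k. \<integral>\<^sup>+y. ennreal (1 / (2 ^ k * a) ^ Suc n) * indicator (S \<inter> ball x (2 ^ Suc k * a)) y \<partial>lborel)"
    by (intro nn_integral_suminf borel_measurable_scaled_indicator) auto
  also have "\<dots> = (\<Sum>k. ennreal (1 / (2 ^ k * a) ^ Suc n) * emeasure lborel (S \<inter> ball x (2 ^ Suc k * a)))"
    by (intro suminf_cong nn_integral_cmult_indicator) auto
  also have "\<dots> \<le> (\<Sum>k. ennreal (2 ^ n * c / a * (1 / 2) ^ k))"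
  proof (intro suminf_le allI)
    fix k
    have "1 * a \<le> 2 ^ Suc k * a" using a by (intro mult_right_mono one_le_power) auto
    then have "emeasure lborel (S \<inter> ball x (2 ^ Suc k * a)) \<le> ennreal (c * (2 ^ Suc k * a) ^ n)" by (intro vol) simp
    then have "ennreal (1 / (2 ^ k * a) ^ Suc n) * emeasure lborel (S \<inter> ball x (2 ^ Suc k * a))
      \<le> ennreal (1 / (2 ^ k * a) ^ Suc n) * ennreal (c * (2 ^ Suc k * a) ^ n)" by (rule mult_left_mono) simp
    also have "\<dots> = ennreal (1 / (2 ^ k * a) ^ Suc n * (c * (2 ^ Suc k * a) ^ n))"
      using a c by (intro ennreal_mult[symmetric]) auto
    also have "1 / (2 ^ k * a) ^ Suc n * (c * (2 ^ Suc k * a) ^ n) = 2 ^ n * c / a * (1 / 2) ^ k"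
    proof -
      define y where "y = 2 ^ k * a"
      have y: "0 < y" using a by (simp add: y_def)
      have e: "2 ^ Suc k * a = 2 * y" by (simp add: y_def)
      have "1 / y ^ Suc n * (c * (2 * y) ^ n) = 2 ^ n * c / y"
        unfolding power_mult_distrib using y by simp
      also have "2 ^ n * c / y = 2 ^ n * c / a * (1 / 2) ^ k" by (simp add: y_def power_one_over)
      finally show ?thesis unfolding e y_def[symmetric] .
    qed
    finally show "ennreal (1 / (2 ^ k * a) ^ Suc n) * emeasure lborel (S \<inter> ball x (2 ^ Suc k * a)) \<le> ennreal (2 ^ n * c / a * (1 / 2) ^ k)" .
  qed auto
  also have "\<dots> = ennreal (2 ^ Suc n * c / a)"
  proof -
    have "(\<lambda>k. 2 ^ n * c / a * (1 / 2) ^ k) sums (2 ^ n * c / a * (1 / (1 - 1 / 2)))"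
      by (intro sums_mult geometric_sums) auto
    then show ?thesis using a c by (subst suminf_ennreal2) (auto simp: sums_iff)
  qed
  finally show ?thesis by (simp add: n)
qed

text \<open>The same decomposition inwards, with a geometric series of ratio \<open>(1 / 2) powr q\<close>.\<close>

lemma nn_integral_dyadic_near:
  fixes q :: real
  assumes q: "0 < q"
  obtains C where "0 < C" "\<And>t. 0 < t \<Longrightarrow>
    (\<integral>\<^sup>+z. indicator (ball 0 t - {0}) z * ennreal (norm z powr q / norm z ^ DIM('a)) \<partial>(lborel :: 'a::euclidean_space measure)) \<le> ennreal (C * t powr q)"
proof -
  define D where "D = DIM('a)"
  define b where "b = (1 / 2) powr q"
  have b: "0 < b" "b < 1" using q powr_less_mono2[of q "1/2" 1] by (simp_all add: b_def)
  define C where "C = 2 ^ D * unit_ball_vol (real D) / (1 - b)"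
  have C: "0 < C" using b by (simp add: C_def unit_ball_vol_pos)
  have "(\<integral>\<^sup>+z. indicator (ball 0 t - {0}) z * ennreal (norm z powr q / norm z ^ D) \<partial>(lborel :: 'a measure)) \<le> ennreal (C * t powr q)"
    if t: "0 < t" for t
  proof -
    define w where "w k = ((1 / 2) ^ k * t) powr q / ((1 / 2) ^ Suc k * t) ^ D" for k
    have w0: "0 \<le> w k" for k using t by (simp add: w_def)
    have pt: "indicator (ball 0 t - {0}) z * ennreal (norm z powr q / norm z ^ D)
       \<le> (\<Sum>k. ennreal (w k) * indicator (ball 0 ((1 / 2) ^ k * t)) z)" for z :: 'a
    proof (cases "z \<in> ball 0 t - {0}")
      case True
      define r where "r = norm z"
      have r: "0 < r" "r < t" using True by (auto simp: r_def)
      obtain N where N: "(1 / 2) ^ N < r / t" using real_arch_pow_inv[of "r / t" "1 / 2"] r t by auto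
      define k where "k = (LEAST k. (1 / 2) ^ Suc k * t \<le> r)"
      have "(1 / 2) ^ Suc N * t \<le> r"
      proof -
        have "(1 / 2) ^ N * t < r" using N t by (simp add: field_simps)
        moreover have "(1 / 2) ^ Suc N * t \<le> (1 / 2) ^ N * t" using t by (intro mult_right_mono) auto
        ultimately show ?thesis by linarith
      qed
      then have k1: "(1 / 2) ^ Suc k * t \<le> r" unfolding k_def by (rule LeastI)
      have k2: "r < (1 / 2) ^ k * t"
      proof (cases k)
        case 0 then show ?thesis using r by simp
      next
        case (Suc l)
        have "\<not> (1 / 2) ^ Suc l * t \<le> r" by (rule not_less_Least) (use Suc in \<open>simp add: k_def\<close>)
        then show ?thesis using Suc by simp
      qed
      have "r powr q / r ^ D \<le> w k"
        unfolding w_def using k1 k2 r t q by (intro frac_le powr_mono2 power_mono) auto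
      then have "ennreal (r powr q / r ^ D) \<le> ennreal (w k)" by (rule ennreal_leI)
      also have "\<dots> = (\<lambda>k. ennreal (w k) * indicator (ball 0 ((1 / 2) ^ k * t)) z) k"
        using k2 by (simp add: r_def)
      also have "\<dots> \<le> (\<Sum>k. ennreal (w k) * indicator (ball 0 ((1 / 2) ^ k * t)) z)"
        by (rule ennreal_le_suminf)
      finally show ?thesis using True by (simp add: r_def)
    qed simp
    have "(\<integral>\<^sup>+z. indicator (ball 0 t - {0}) z * ennreal (norm z powr q / norm z ^ D) \<partial>(lborel :: 'a measure))
       \<le> (\<integral>\<^sup>+z. (\<Sum>k. ennreal (w k) * indicator (ball 0 ((1 / 2) ^ k * t)) z) \<partial>(lborel :: 'a measure))"
      by (intro nn_integral_mono pt)
    also have "\<dots> = (\<Sum>k. \<integral>\<^sup>+z. ennreal (w k) * indicator (ball 0 ((1 / 2) ^ k * t)) z \<partial>(lborel :: 'a measure))"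
      by (intro nn_integral_suminf borel_measurable_scaled_indicator) auto
    also have "\<dots> = (\<Sum>k. ennreal (w k) * emeasure lborel (ball (0::'a) ((1 / 2) ^ k * t)))"
      by (intro suminf_cong nn_integral_cmult_indicator) auto
    also have "\<dots> = (\<Sum>k. ennreal (2 ^ D * unit_ball_vol (real D) * t powr q * b ^ k))"
    proof (intro suminf_cong)
      fix k
      define y where "y = (1 / 2) ^ k * t"
      have y: "0 < y" using t by (simp add: y_def)
      have "emeasure lborel (ball (0::'a) y) = ennreal (unit_ball_vol (real D) * y ^ D)"
        using y by (simp add: emeasure_ball D_def)
      then have "ennreal (w k) * emeasure lborel (ball (0::'a) y) = ennreal (w k * (unit_ball_vol (real D) * y ^ D))"
        using w0 y by (simp add: ennreal_mult unit_ball_vol_nonneg)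
      also have "w k * (unit_ball_vol (real D) * y ^ D) = 2 ^ D * unit_ball_vol (real D) * y powr q"
      proof -
        have e: "(1 / 2) ^ Suc k * t = y / 2" by (simp add: y_def)
        have "w k = y powr q / (y / 2) ^ D" unfolding w_def e y_def[symmetric] ..
        then show ?thesis using y by (simp add: power_divide)
      qed
      also have "y powr q = t powr q * b ^ k"
        unfolding y_def b_def using t by (simp add: powr_mult powr_realpow[symmetric] powr_powr mult.commute)
      finally show "ennreal (w k) * emeasure lborel (ball (0::'a) ((1 / 2) ^ k * t)) = ennreal (2 ^ D * unit_ball_vol (real D) * t powr q * b ^ k)"
        by (simp add: y_def mult_ac)
    qed
    also have "\<dots> = ennreal (C * t powr q)"
    proof -
      have "(\<lambda>k. 2 ^ D * unit_ball_vol (real D) * t powr q * b ^ k) sums (2 ^ D * unit_ball_vol (real D) * t powr q * (1 / (1 - b)))"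
        using b by (intro sums_mult geometric_sums) auto
      then show ?thesis using b
        by (subst suminf_ennreal2) (auto simp: sums_iff C_def unit_ball_vol_nonneg)
    qed
    finally show ?thesis .
  qed
  then show ?thesis using that[of C] C by (simp add: D_def)
qed

text \<open>The Gaussian factorises over the coordinates, and \<open>exp (- x\<^sup>2) \<le> 1 / (1 + x\<^sup>2)\<close> bounds each
  factor by \<open>pi * sqrt c\<close>.\<close>

lemma nn_integral_gaussian_le:
  fixes c :: real assumes c: "0 < c"
  shows "(\<integral>\<^sup>+z. ennreal (exp (- (norm z)\<^sup>2 / c)) \<partial>(lborel :: 'a::euclidean_space measure)) \<le> ennreal ((pi * sqrt c) ^ DIM('a))"
proof -
  have one: "(\<integral>\<^sup>+x. ennreal (exp (- x\<^sup>2 / c)) \<partial>lborel) \<le> ennreal (pi * sqrt c)"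
  proof -
    have lims: "((arctan \<circ> real_of_ereal) \<longlongrightarrow> - (pi / 2)) (at_right (- \<infinity>))" "((arctan \<circ> real_of_ereal) \<longlongrightarrow> pi / 2) (at_left \<infinity>)"
      using tendsto_arctan_at_top tendsto_arctan_at_bot by (simp_all add: ereal_tendsto_simps1)
    have p: "1 + x\<^sup>2 \<noteq> 0" for x :: real by (smt (verit) zero_le_power2)
    have "set_integrable lborel (einterval (- \<infinity>) \<infinity>) (\<lambda>x. 1 / (1 + x\<^sup>2)) \<and> (LBINT x=-\<infinity>..\<infinity>. 1 / (1 + x\<^sup>2)) = pi / 2 - - (pi / 2)"
      by (intro conjI interval_integral_FTC_nonneg[of "-\<infinity>" "\<infinity>" arctan])
        (use lims p in \<open>auto intro!: derivative_eq_intros continuous_intros simp: inverse_eq_divide\<close>)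
    moreover have "einterval (- \<infinity>) \<infinity> = UNIV" by (auto simp: einterval_def)
    ultimately have i: "integrable lborel (\<lambda>x::real. 1 / (1 + x\<^sup>2))" "(LBINT x. 1 / (1 + x\<^sup>2)) = pi"
      by (auto simp: set_integrable_def interval_lebesgue_integral_def set_lebesgue_integral_def)
    have "(\<integral>\<^sup>+x. ennreal (exp (- x\<^sup>2 / c)) \<partial>lborel) = ennreal \<bar>sqrt c\<bar> * (\<integral>\<^sup>+x. ennreal (exp (- (0 + sqrt c * x)\<^sup>2 / c)) \<partial>lborel)"
      by (rule nn_integral_real_affine) (use c in auto)
    also have "\<dots> \<le> ennreal (sqrt c) * (\<integral>\<^sup>+x. ennreal (1 / (1 + x\<^sup>2)) \<partial>lborel)"
    proof (intro mult_mono nn_integral_mono ennreal_leI)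
      fix x :: real
      have "exp (x\<^sup>2) \<ge> 1 + x\<^sup>2" by (rule exp_ge_add_one_self)
      then have "exp (- (x\<^sup>2)) \<le> 1 / (1 + x\<^sup>2)"
        using p[of x] by (simp add: exp_minus inverse_eq_divide) (intro divide_left_mono mult_pos_pos; simp add: add_pos_nonneg)
      then show "exp (- (0 + sqrt c * x)\<^sup>2 / c) \<le> 1 / (1 + x\<^sup>2)" using c by (simp add: power_mult_distrib)
    qed (use c in auto)
    also have "(\<integral>\<^sup>+x. ennreal (1 / (1 + x\<^sup>2)) \<partial>lborel) = ennreal pi"
      using nn_integral_eq_integral[OF i(1)] i(2) by simp
    also have "ennreal (sqrt c) * ennreal pi = ennreal (pi * sqrt c)" using c by (simp add: ennreal_mult[symmetric] mult.commute)
    finally show ?thesis .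
  qed
  have "exp (- (norm z)\<^sup>2 / c) = (\<Prod>b\<in>Basis. exp (- (z \<bullet> b)\<^sup>2 / c))" for z :: 'a
  proof -
    have "(norm z)\<^sup>2 = (\<Sum>b\<in>Basis. (z \<bullet> b)\<^sup>2)"
      unfolding power2_norm_eq_inner using euclidean_inner[of z z] by (simp add: power2_eq_square)
    then show ?thesis by (simp add: exp_sum[symmetric] sum_negf sum_divide_distrib)
  qed
  then have "(\<integral>\<^sup>+z. ennreal (exp (- (norm z)\<^sup>2 / c)) \<partial>(lborel :: 'a measure)) = (\<integral>\<^sup>+z. (\<Prod>b\<in>Basis. ennreal (exp (- (z \<bullet> b)\<^sup>2 / c))) \<partial>(lborel :: 'a measure))"
    by (simp add: prod_ennreal)
  also have "\<dots> = (\<Prod>b\<in>(Basis :: 'a set). \<integral>\<^sup>+x. ennreal (exp (- x\<^sup>2 / c)) \<partial>lborel)"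
    by (rule nn_integral_lborel_prod) auto
  also have "\<dots> \<le> (\<Prod>b\<in>(Basis :: 'a set). ennreal (pi * sqrt c))"
  proof -
    have "p ^ k \<le> q ^ k" if "p \<le> q" for p q :: ennreal and k
      by (induction k) (auto intro: mult_mono that)
    then show ?thesis using one by (simp only: prod_constant)
  qed
  also have "\<dots> = ennreal ((pi * sqrt c) ^ DIM('a))" using c by (simp add: ennreal_power)
  finally show ?thesis .
qed

context levy_exponent begin

abbreviation heat :: "nat \<Rightarrow> real \<Rightarrow> real \<Rightarrow> real" where
  "heat d r s \<equiv> (4 * pi * s) powr (- real d / 2) * exp (- (r\<^sup>2) / (4 * s))"

definition kernel_const :: "nat \<Rightarrow> real" where
  "kernel_const d = 2 * (4 ^ Suc d * fact (Suc d))"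

lemma kernel_const_pos: "0 < kernel_const d"
  by (simp add: kernel_const_def)

lemma jump_kernel_integrable:
  assumes r: "0 < r"
  shows "set_integrable lborel {0<..} (\<lambda>s. heat d r s * \<nu> s)"
proof (rule nu_integrable[where C="kernel_const d / r ^ d * max 1 (1 / r\<^sup>2)"])
  fix s :: real assume s: "0 < s"
  have "heat d r s \<le> kernel_const d / r ^ d * (1 - exp (- (1 / r\<^sup>2) * s))"
    using heat_kernel_le[OF r s, of d] by (simp add: kernel_const_def)
  also have "\<dots> \<le> kernel_const d / r ^ d * (max 1 (1 / r\<^sup>2) * min 1 s)"
    using r s kernel_const_pos[of d] by (intro mult_left_mono one_minus_exp_le) auto
  finally show "\<bar>heat d r s\<bar> \<le> kernel_const d / r ^ d * max 1 (1 / r\<^sup>2) * min 1 s"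
    by (simp add: abs_mult mult.assoc)
qed measurable

lemma jump_kernel_nonneg: "0 \<le> jump_kernel d \<nu> r"
  unfolding jump_kernel_def set_lebesgue_integral_def
  by (intro Bochner_Integration.integral_nonneg) (auto simp: indicator_def nu_nonneg)

lemma jump_kernel_le:
  assumes r: "0 < r" shows "jump_kernel d \<nu> r \<le> kernel_const d / r ^ d * \<phi> (1 / r\<^sup>2)"
proof -
  have "jump_kernel d \<nu> r \<le> (LBINT s:{0<..}. kernel_const d / r ^ d * ((1 - exp (- (1 / r\<^sup>2) * s)) * \<nu> s))"
    unfolding jump_kernel_def
  proof (rule set_integral_mono)
    show "set_integrable lborel {0<..} (\<lambda>s. kernel_const d / r ^ d * ((1 - exp (- (1 / r\<^sup>2) * s)) * \<nu> s))"
      using r by (intro set_integrable_mult_right phi_integrable) auto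
    fix s :: real assume "s \<in> {0<..}"
    then have s: "0 < s" by simp
    have "heat d r s * \<nu> s \<le> kernel_const d / r ^ d * (1 - exp (- (1 / r\<^sup>2) * s)) * \<nu> s"
      using heat_kernel_le[OF r s, of d] nu_nonneg[OF s] by (intro mult_right_mono) (simp_all add: kernel_const_def)
    then show "heat d r s * \<nu> s \<le> kernel_const d / r ^ d * ((1 - exp (- (1 / r\<^sup>2) * s)) * \<nu> s)"
      by (simp only: mult.assoc)
  qed (rule jump_kernel_integrable[OF r])
  also have "\<dots> = kernel_const d / r ^ d * \<phi> (1 / r\<^sup>2)"
    unfolding set_integral_mult_right by (subst phi_eq) auto
  finally show ?thesis .
qed

lemma jump_kernel_measurable [measurable]: "jump_kernel d \<nu> \<in> borel_measurable borel"
proof -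
  have [measurable]: "(\<lambda>s. indicator {0<..} s * \<nu> s) \<in> borel_measurable borel" by (rule nu_measurable)
  have "jump_kernel d \<nu> = (\<lambda>r. LBINT s. heat d r s * (indicator {0<..} s * \<nu> s))"
    by (simp add: fun_eq_iff jump_kernel_def set_lebesgue_integral_def mult_ac)
  also have "\<dots> \<in> borel_measurable borel" by measurable
  finally show ?thesis .
qed

text \<open>Tonelli in space and \<open>s\<close>. Half of the Gaussian exponent is integrated over space, which
  cancels the normalisation of the heat kernel; on \<open>\<bar>z\<bar> > e\<close> the other half is at most
  \<open>exp (- e\<^sup>2 / (8 * s)) \<le> C * min 1 s\<close>, which \<open>\<nu>\<close> integrates.\<close>

lemma jump_kernel_tail:
  assumes e: "0 < e"
  shows "(\<integral>\<^sup>+z. indicator {z. e < norm z} z * ennreal (jump_kernel CARD('n) \<nu> (norm z)) \<partial>(lborel :: (real ^ 'n) measure)) < \<infinity>"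
proof -
  define d where "d = CARD('n)"
  define n where "n s = indicator {0<..} s * \<nu> s" for s
  have [measurable]: "n \<in> borel_measurable borel" unfolding n_def[abs_def] by (rule nu_measurable)
  have n0: "0 \<le> n s" for s by (simp add: n_def indicator_def nu_nonneg)
  define G where "G = (pi * sqrt 8 / sqrt (4 * pi)) ^ d"
  define K where "K = G * (1 + 8 / e\<^sup>2)"
  have G: "0 \<le> G" by (simp add: G_def)
  have eq: "indicator {z. e < norm z} z * ennreal (jump_kernel d \<nu> (norm z))
     = (\<integral>\<^sup>+s. indicator {z. e < norm z} z * ennreal (heat d (norm z) s * n s) \<partial>lborel)" for z :: "real ^ 'n"
  proof (cases "e < norm z")
    case True
    then have r: "0 < norm z" using e by linarith
    have "integrable lborel (\<lambda>s. heat d (norm z) s * n s)"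
      using jump_kernel_integrable[OF r, of d] by (simp add: set_integrable_def n_def mult_ac)
    then have "(\<integral>\<^sup>+s. ennreal (heat d (norm z) s * n s) \<partial>lborel) = ennreal (LBINT s. heat d (norm z) s * n s)"
      using n0 by (intro nn_integral_eq_integral) auto
    also have "(LBINT s. heat d (norm z) s * n s) = jump_kernel d \<nu> (norm z)"
      by (simp add: jump_kernel_def set_lebesgue_integral_def n_def mult_ac)
    finally show ?thesis using True by simp
  qed simp
  have inner: "(\<integral>\<^sup>+z. indicator {z. e < norm z} z * ennreal (heat d (norm z) s * n s) \<partial>(lborel :: (real ^ 'n) measure))
     \<le> ennreal (K * (indicator {0<..} s *\<^sub>R (min 1 s * \<nu> s)))" for s
  proof (cases "0 < s")
    case s: True
    define q where "q = (4 * pi * s) powr (- real d / 2) * exp (- e\<^sup>2 / (8 * s)) * \<nu> s"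
    have q0: "0 \<le> q" using nu_nonneg[OF s] by (simp add: q_def)
    have "(\<integral>\<^sup>+z. indicator {z. e < norm z} z * ennreal (heat d (norm z) s * n s) \<partial>(lborel :: (real ^ 'n) measure))
       \<le> (\<integral>\<^sup>+z. ennreal q * ennreal (exp (- (norm z)\<^sup>2 / (8 * s))) \<partial>(lborel :: (real ^ 'n) measure))"
    proof (intro nn_integral_mono)
      fix z :: "real ^ 'n"
      show "indicator {z. e < norm z} z * ennreal (heat d (norm z) s * n s) \<le> ennreal q * ennreal (exp (- (norm z)\<^sup>2 / (8 * s)))"
      proof (cases "e < norm z")
        case True
        have "e\<^sup>2 \<le> (norm z)\<^sup>2" using True e by (intro power_mono) auto
        then have "- (norm z)\<^sup>2 / (4 * s) \<le> - e\<^sup>2 / (8 * s) + - (norm z)\<^sup>2 / (8 * s)"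
          using s by (simp add: field_simps)
        then have "exp (- (norm z)\<^sup>2 / (4 * s)) \<le> exp (- e\<^sup>2 / (8 * s)) * exp (- (norm z)\<^sup>2 / (8 * s))"
          unfolding exp_add[symmetric] by simp
        then have "(4 * pi * s) powr (- real d / 2) * exp (- (norm z)\<^sup>2 / (4 * s)) * \<nu> s
           \<le> (4 * pi * s) powr (- real d / 2) * (exp (- e\<^sup>2 / (8 * s)) * exp (- (norm z)\<^sup>2 / (8 * s))) * \<nu> s"
          using nu_nonneg[OF s] by (intro mult_right_mono mult_left_mono) auto
        then have "heat d (norm z) s * n s \<le> q * exp (- (norm z)\<^sup>2 / (8 * s))"
          using s by (simp add: q_def n_def mult_ac)
        then show ?thesis using True q0 by (simp add: ennreal_mult[symmetric] ennreal_leI)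
      qed simp
    qed
    also have "\<dots> = ennreal q * (\<integral>\<^sup>+z. ennreal (exp (- (norm z)\<^sup>2 / (8 * s))) \<partial>(lborel :: (real ^ 'n) measure))"
      by (rule nn_integral_cmult) measurable
    also have "\<dots> \<le> ennreal q * ennreal ((pi * sqrt (8 * s)) ^ d)"
      using nn_integral_gaussian_le[of "8 * s", where 'a="real ^ 'n"] s by (intro mult_left_mono) (auto simp: d_def)
    also have "\<dots> = ennreal (q * (pi * sqrt (8 * s)) ^ d)" using q0 s by (intro ennreal_mult[symmetric]) auto
    also have "\<dots> \<le> ennreal (K * (indicator {0<..} s *\<^sub>R (min 1 s * \<nu> s)))"
    proof (rule ennreal_leI)
      have "(4 * pi * s) powr (- real d / 2) = 1 / sqrt (4 * pi * s) ^ d"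
      proof -
        have "(4 * pi * s) powr (real d / 2) = ((4 * pi * s) powr (1 / 2)) powr real d" by (simp only: powr_powr) simp
        also have "\<dots> = sqrt (4 * pi * s) ^ d" using s by (simp add: powr_half_sqrt powr_realpow)
        finally show ?thesis using powr_minus_divide[of "4 * pi * s" "real d / 2"] by simp
      qed
      then have "(4 * pi * s) powr (- real d / 2) * (pi * sqrt (8 * s)) ^ d = (pi * sqrt (8 * s) / sqrt (4 * pi * s)) ^ d"
        by (simp add: power_divide)
      also have "pi * sqrt (8 * s) / sqrt (4 * pi * s) = pi * sqrt 8 / sqrt (4 * pi)"
        using s by (simp only: real_sqrt_mult[of _ s]) simp
      finally have 1: "(4 * pi * s) powr (- real d / 2) * (pi * sqrt (8 * s)) ^ d = G" by (simp only: G_def)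
      have "exp (- e\<^sup>2 / (8 * s)) \<le> (1 + 8 / e\<^sup>2) * min 1 s"
      proof -
        define y where "y = e\<^sup>2 / (8 * s)"
        have y: "0 < y" using e s by (simp add: y_def)
        have "y * exp (- y) \<le> 1" using power_exp_minus_le[of y 1] y by simp
        then have a: "exp (- y) \<le> 1 / y" using y by (simp add: field_simps)
        have b: "1 / y = 8 / e\<^sup>2 * s" by (simp add: y_def)
        have c: "exp (- y) \<le> 1" using y by simp
        have "8 / e\<^sup>2 * s \<le> (1 + 8 / e\<^sup>2) * s" using s by (intro mult_right_mono) auto
        moreover have "1 \<le> (1 + 8 / e\<^sup>2) * 1" by simp
        moreover have "0 \<le> 8 / e\<^sup>2" by simp
        ultimately have "exp (- y) \<le> (1 + 8 / e\<^sup>2) * s" "exp (- y) \<le> (1 + 8 / e\<^sup>2) * 1"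
          using a b c by linarith+
        then have "exp (- y) \<le> (1 + 8 / e\<^sup>2) * min 1 s" by (simp add: min_def)
        then show ?thesis by (simp add: y_def)
      qed
      then have "G * \<nu> s * exp (- e\<^sup>2 / (8 * s)) \<le> G * \<nu> s * ((1 + 8 / e\<^sup>2) * min 1 s)"
        using G nu_nonneg[OF s] by (intro mult_left_mono) auto
      moreover have "q * (pi * sqrt (8 * s)) ^ d = G * \<nu> s * exp (- e\<^sup>2 / (8 * s))"
        unfolding 1[symmetric] q_def by (simp only: mult_ac)
      ultimately show "q * (pi * sqrt (8 * s)) ^ d \<le> K * (indicator {0<..} s *\<^sub>R (min 1 s * \<nu> s))"
        using s by (simp add: K_def mult_ac)
    qed
    finally show ?thesis .
  qed (simp add: n_def)
  have "(\<integral>\<^sup>+z. indicator {z. e < norm z} z * ennreal (jump_kernel d \<nu> (norm z)) \<partial>(lborel :: (real ^ 'n) measure))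
     = (\<integral>\<^sup>+s. \<integral>\<^sup>+z. indicator {z. e < norm z} z * ennreal (heat d (norm z) s * n s) \<partial>(lborel :: (real ^ 'n) measure) \<partial>lborel)"
    unfolding eq
    by (rule lborel_pair.Fubini'[symmetric, of "\<lambda>z s. indicator {z. e < norm z} z * ennreal (heat d (norm z) s * n s)"]) measurable
  also have "\<dots> \<le> (\<integral>\<^sup>+s. ennreal (K * (indicator {0<..} s *\<^sub>R (min 1 s * \<nu> s))) \<partial>lborel)"
    by (intro nn_integral_mono inner)
  also have "\<dots> = ennreal (LBINT s. K * (indicator {0<..} s *\<^sub>R (min 1 s * \<nu> s)))"
  proof (rule nn_integral_eq_integral)
    show "integrable lborel (\<lambda>s. K * (indicator {0<..} s *\<^sub>R (min 1 s * \<nu> s)))"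
      using levy by (intro integrable_mult_right) (simp add: levy_density_def set_integrable_def)
    show "AE s in lborel. 0 \<le> K * (indicator {0<..} s *\<^sub>R (min 1 s * \<nu> s))"
      using G by (intro AE_I2 mult_nonneg_nonneg) (auto simp: K_def indicator_def nu_nonneg)
  qed
  also have "\<dots> < \<infinity>" by simp
  finally show ?thesis by (simp add: d_def)
qed

text \<open>The kernel is at most \<open>\<phi> (1 / a\<^sup>2)\<close> times the power \<open>- d\<close> of the distance, since \<open>\<phi>\<close> is
  monotone.\<close>

lemma jump_kernel_far:
  fixes S :: "(real ^ 'n) set"
  assumes S: "S \<in> sets borel" and a: "0 < a" and c: "0 \<le> c"
    and vol: "\<And>r. a \<le> r \<Longrightarrow> emeasure lborel (S \<inter> ball x r) \<le> ennreal (c * r ^ (CARD('n) - 1))"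
  shows "(\<integral>\<^sup>+y. indicator (S - ball x a) y * ennreal (jump_kernel CARD('n) \<nu> (norm (y - x))) \<partial>lborel)
    \<le> ennreal (kernel_const CARD('n) * \<phi> (1 / a\<^sup>2) * (2 ^ CARD('n) * c / a))"
proof -
  define d where "d = CARD('n)"
  have d: "DIM(real ^ 'n) = Suc (d - 1)" "Suc (d - 1) = d" by (simp_all add: d_def Suc_diff_1 zero_less_card_finite)
  define K where "K = kernel_const d * \<phi> (1 / a\<^sup>2)"
  have K: "0 \<le> K" using kernel_const_pos[of d] phi_nonneg[of "1 / a\<^sup>2"] by (simp add: K_def)
  have "(\<integral>\<^sup>+y. indicator (S - ball x a) y * ennreal (jump_kernel d \<nu> (norm (y - x))) \<partial>lborel)
     \<le> (\<integral>\<^sup>+y. ennreal K * (indicator (S - ball x a) y * ennreal (1 / norm (y - x) ^ DIM(real ^ 'n))) \<partial>lborel)"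
  proof (intro nn_integral_mono)
    fix y :: "real ^ 'n"
    show "indicator (S - ball x a) y * ennreal (jump_kernel d \<nu> (norm (y - x)))
       \<le> ennreal K * (indicator (S - ball x a) y * ennreal (1 / norm (y - x) ^ DIM(real ^ 'n)))"
    proof (cases "y \<in> S - ball x a")
      case True
      define r where "r = norm (y - x)"
      have r: "a \<le> r" "0 < r" using True a by (auto simp: r_def dist_norm norm_minus_commute)
      have "1 / r\<^sup>2 \<le> 1 / a\<^sup>2" using r a by (intro divide_left_mono power_mono) auto
      then have "\<phi> (1 / r\<^sup>2) \<le> \<phi> (1 / a\<^sup>2)" by (intro phi_mono) auto
      then have "kernel_const d / r ^ d * \<phi> (1 / r\<^sup>2) \<le> kernel_const d / r ^ d * \<phi> (1 / a\<^sup>2)"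
        using kernel_const_pos[of d] r by (intro mult_left_mono) auto
      then have "jump_kernel d \<nu> r \<le> K * (1 / r ^ d)"
        using jump_kernel_le[OF r(2), of d] by (simp add: K_def)
      then have "ennreal (jump_kernel d \<nu> r) \<le> ennreal (K * (1 / r ^ d))" by (rule ennreal_leI)
      also have "\<dots> = ennreal K * ennreal (1 / r ^ d)" using K r by (intro ennreal_mult) auto
      finally show ?thesis using True by (simp add: r_def d_def)
    qed simp
  qed
  also have "\<dots> = ennreal K * (\<integral>\<^sup>+y. indicator (S - ball x a) y * ennreal (1 / norm (y - x) ^ DIM(real ^ 'n)) \<partial>lborel)"
  proof -
    have [measurable]: "S \<in> sets borel" "ball x a \<in> sets borel" using S by auto
    show ?thesis by (rule nn_integral_cmult) measurable
  qed
  also have "\<dots> \<le> ennreal K * ennreal (2 ^ Suc (d - 1) * c / a)"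
    using vol by (intro mult_left_mono nn_integral_dyadic_tail[OF S a c d(1)]) (auto simp: d_def)
  also have "\<dots> = ennreal (K * (2 ^ d * c / a))"
    unfolding d(2) using K a c by (simp add: ennreal_mult[symmetric])
  finally show ?thesis by (simp add: K_def d_def)
qed

end

context levy_scaling begin

text \<open>By the upper scaling bound, \<open>\<phi> (1 / r\<^sup>2) \<le> a2 * (t / r) powr (2 * \<delta>2) * \<phi> (1 / t\<^sup>2)\<close> for
  \<open>r \<le> t\<close>. The integrand is thus a multiple of \<open>r powr (1 + b - 2 * \<delta>2)\<close> over \<open>r ^ d\<close>.\<close>

lemma jump_kernel_near:
  fixes b :: real
  assumes b: "2 * \<delta>2 < 1 + b"
  obtains C where "0 < C" "\<And>t. 0 < t \<Longrightarrow> t \<le> 1 \<Longrightarrow>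
    (\<integral>\<^sup>+z. indicator (ball 0 t - {0}) z * ennreal (norm z powr (1 + b) * jump_kernel CARD('n) \<nu> (norm z)) \<partial>(lborel :: (real ^ 'n) measure))
      \<le> ennreal (C * t powr (1 + b) * \<phi> (1 / t\<^sup>2))"
proof -
  define d where "d = CARD('n)"
  define q where "q = 1 + b - 2 * \<delta>2"
  have q: "0 < q" using b by (simp add: q_def)
  obtain C where C: "0 < C" "\<And>t. 0 < t \<Longrightarrow>
    (\<integral>\<^sup>+z. indicator (ball 0 t - {0}) z * ennreal (norm z powr q / norm z ^ DIM(real ^ 'n)) \<partial>(lborel :: (real ^ 'n) measure)) \<le> ennreal (C * t powr q)"
    using nn_integral_dyadic_near[OF q, where 'a="real ^ 'n"] by blast
  define K where "K = kernel_const d * a2"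
  have K: "0 < K" using kernel_const_pos[of d] scaling_consts by (simp add: K_def)
  have "(\<integral>\<^sup>+z. indicator (ball 0 t - {0}) z * ennreal (norm z powr (1 + b) * jump_kernel d \<nu> (norm z)) \<partial>(lborel :: (real ^ 'n) measure))
      \<le> ennreal (K * C * t powr (1 + b) * \<phi> (1 / t\<^sup>2))" if t: "0 < t" "t \<le> 1" for t
  proof -
    have p: "0 < \<phi> (1 / t\<^sup>2)" using t by (intro phi_pos) simp
    define Q where "Q = K * t powr (2 * \<delta>2) * \<phi> (1 / t\<^sup>2)"
    have Q: "0 \<le> Q" using K p by (simp add: Q_def)
    have "(\<integral>\<^sup>+z. indicator (ball 0 t - {0}) z * ennreal (norm z powr (1 + b) * jump_kernel d \<nu> (norm z)) \<partial>(lborel :: (real ^ 'n) measure))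
       \<le> (\<integral>\<^sup>+z. ennreal Q * (indicator (ball 0 t - {0}) z * ennreal (norm z powr q / norm z ^ DIM(real ^ 'n))) \<partial>(lborel :: (real ^ 'n) measure))"
    proof (intro nn_integral_mono)
      fix z :: "real ^ 'n"
      show "indicator (ball 0 t - {0}) z * ennreal (norm z powr (1 + b) * jump_kernel d \<nu> (norm z))
         \<le> ennreal Q * (indicator (ball 0 t - {0}) z * ennreal (norm z powr q / norm z ^ DIM(real ^ 'n)))"
      proof (cases "z \<in> ball 0 t - {0}")
        case True
        define r where "r = norm z"
        have r: "0 < r" "r < t" using True by (auto simp: r_def)
        have "\<phi> ((t / r)\<^sup>2 * (1 / t\<^sup>2)) \<le> a2 * ((t / r)\<^sup>2) powr \<delta>2 * \<phi> (1 / t\<^sup>2)"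
        proof (rule scaling_upper)
          show "1 \<le> (t / r)\<^sup>2" using r by (intro one_le_power) (simp add: field_simps)
          have "t\<^sup>2 \<le> 1" using t by (simp add: power_le_one)
          then show "1 \<le> 1 / t\<^sup>2" using t by (simp add: field_simps)
        qed
        moreover have "(t / r)\<^sup>2 * (1 / t\<^sup>2) = 1 / r\<^sup>2" using t by (simp add: power_divide)
        moreover have "((t / r)\<^sup>2) powr \<delta>2 = t powr (2 * \<delta>2) / r powr (2 * \<delta>2)"
        proof -
          have "((t / r) powr 2) powr \<delta>2 = (t / r) powr (2 * \<delta>2)" by (simp only: powr_powr)
          also have "(t / r) powr 2 = (t / r)\<^sup>2" by (rule powr_numeral) (use t r in simp)
          also have "(t / r) powr (2 * \<delta>2) = t powr (2 * \<delta>2) / r powr (2 * \<delta>2)"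
            using t r by (simp add: powr_divide)
          finally show ?thesis .
        qed
        ultimately have ph: "\<phi> (1 / r\<^sup>2) \<le> a2 * (t powr (2 * \<delta>2) / r powr (2 * \<delta>2)) * \<phi> (1 / t\<^sup>2)" by simp
        have "jump_kernel d \<nu> r \<le> kernel_const d / r ^ d * \<phi> (1 / r\<^sup>2)" by (rule jump_kernel_le[OF r(1)])
        also have "\<dots> \<le> kernel_const d / r ^ d * (a2 * (t powr (2 * \<delta>2) / r powr (2 * \<delta>2)) * \<phi> (1 / t\<^sup>2))"
          using ph kernel_const_pos[of d] r by (intro mult_left_mono) auto
        finally have "r powr (1 + b) * jump_kernel d \<nu> r
           \<le> r powr (1 + b) * (kernel_const d / r ^ d * (a2 * (t powr (2 * \<delta>2) / r powr (2 * \<delta>2)) * \<phi> (1 / t\<^sup>2)))"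
          by (intro mult_left_mono) auto
        also have "\<dots> = Q * (r powr q / r ^ d)"
        proof -
          have "r powr q = r powr (1 + b) / r powr (2 * \<delta>2)" by (simp add: q_def powr_diff)
          then show ?thesis by (simp add: Q_def K_def mult_ac)
        qed
        finally have "ennreal (r powr (1 + b) * jump_kernel d \<nu> r) \<le> ennreal (Q * (r powr q / r ^ d))" by (rule ennreal_leI)
        also have "\<dots> = ennreal Q * ennreal (r powr q / r ^ d)" using Q r by (intro ennreal_mult) auto
        finally show ?thesis using True by (simp add: r_def d_def)
      qed simp
    qed
    also have "\<dots> = ennreal Q * (\<integral>\<^sup>+z. indicator (ball 0 t - {0}) z * ennreal (norm z powr q / norm z ^ DIM(real ^ 'n)) \<partial>(lborel :: (real ^ 'n) measure))"
    proof -
      have [measurable]: "ball (0 :: real ^ 'n) t \<in> sets borel" by simp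
      show ?thesis by (rule nn_integral_cmult) measurable
    qed
    also have "\<dots> \<le> ennreal Q * ennreal (C * t powr q)" by (intro mult_left_mono C(2) t) simp
    also have "\<dots> = ennreal (Q * (C * t powr q))" using Q C(1) by (intro ennreal_mult[symmetric]) auto
    also have "Q * (C * t powr q) = K * C * t powr (1 + b) * \<phi> (1 / t\<^sup>2)"
    proof -
      have "t powr (2 * \<delta>2) * t powr q = t powr (1 + b)" by (simp add: powr_add[symmetric] q_def)
      then show ?thesis by (simp add: Q_def mult_ac)
    qed
    finally show ?thesis .
  qed
  then show ?thesis using that[of "K * C"] K C(1) by (simp add: d_def)
qed

end

section \<open>Volume of boundary collars\<close>

lemma bdist_attained:
  fixes \<Omega> :: "(real ^ 'n) set"
  assumes "bounded \<Omega>" "y \<in> \<Omega>"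
  obtains z where "z \<in> frontier \<Omega>" "bdist \<Omega> y = dist y z"
proof -
  have "\<Omega> \<noteq> UNIV" using assms(1) not_bounded_UNIV by auto
  then have "frontier \<Omega> \<noteq> {}" using frontier_not_empty assms(2) by auto
  then show ?thesis using infdist_attains_inf[OF frontier_closed, of \<Omega> y] that by (auto simp: bdist_def)
qed

lemma bdist_pos:
  fixes \<Omega> :: "(real ^ 'n) set"
  assumes "bounded \<Omega>" "open \<Omega>" "y \<in> \<Omega>" shows "0 < bdist \<Omega> y"
proof -
  obtain z where z: "z \<in> frontier \<Omega>" "bdist \<Omega> y = dist y z" using bdist_attained[OF assms(1,3)] .
  have "frontier \<Omega> \<inter> \<Omega> = {}" using assms(2) by (simp add: frontier_disjoint_eq)
  then show ?thesis using z assms(3) by auto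
qed

lemma bdist_lipschitz: "\<bar>bdist \<Omega> x - bdist \<Omega> y\<bar> \<le> dist x y"
  unfolding bdist_def using infdist_triangle_abs[of x "frontier \<Omega>" y] by simp

text \<open>A segment that leaves the set crosses its boundary.\<close>

lemma ball_bdist_subset:
  fixes \<Omega> :: "(real ^ 'n) set"
  assumes "x \<in> \<Omega>" "dist x y < bdist \<Omega> x" shows "y \<in> \<Omega>"
proof (rule ccontr)
  assume y: "y \<notin> \<Omega>"
  have "closed_segment x y \<inter> frontier \<Omega> \<noteq> {}"
    using connected_Int_frontier[OF connected_segment(1)[of x y], of \<Omega>] assms y by auto
  then obtain z where z: "z \<in> closed_segment x y" "z \<in> frontier \<Omega>" by auto
  have "bdist \<Omega> x \<le> dist x z" unfolding bdist_def using z by (intro infdist_le)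
  also have "\<dots> \<le> dist x y" using dist_in_closed_segment[OF z(1)] by (simp add: dist_commute)
  finally show False using assms by simp
qed

lemma C11_graph_lipschitz:
  assumes "C11_graph \<Lambda> e \<Gamma>" shows "\<bar>\<Gamma> u - \<Gamma> v\<bar> \<le> \<Lambda> * norm (u - v)"
proof -
  obtain G where G: "\<And>v. GDERIV \<Gamma> v :> G v" "\<And>v. norm (G v) \<le> \<Lambda>"
    using assms by (auto simp: C11_graph_def)
  have "norm (\<Gamma> u - \<Gamma> v) \<le> \<Lambda> * norm (u - v)"
  proof (rule differentiable_bound[where S=UNIV and f'="\<lambda>x h. h \<bullet> G x"])
    show "(\<Gamma> has_derivative (\<lambda>h. h \<bullet> G x)) (at x within UNIV)" for x
      using G(1)[of x] by (simp add: gderiv_def)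
    show "onorm (\<lambda>h. h \<bullet> G x) \<le> \<Lambda>" for x
    proof (rule onorm_bound)
      show "0 \<le> \<Lambda>" using G(2)[of x] norm_ge_zero[of "G x"] by linarith
      show "norm (h \<bullet> G x) \<le> \<Lambda> * norm h" for h
        using Cauchy_Schwarz_ineq2[of h "G x"] mult_left_mono[OF G(2)[of x], of "norm h"]
        by (simp add: mult.commute)
    qed
  qed auto
  then show ?thesis by simp
qed

lemma open_collar: "open \<Omega> \<Longrightarrow> open (collar \<Omega> \<tau>)"
proof -
  assume "open \<Omega>"
  moreover have "open {y. bdist \<Omega> y < \<tau>}"
    unfolding bdist_def by (intro open_Collect_less continuous_intros)
  ultimately have "open (\<Omega> \<inter> {y. bdist \<Omega> y < \<tau>})" by (rule open_Int)
  then show ?thesis by (simp add: collar_def Int_def)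
qed

text \<open>Let \<open>w\<close> be the height above the boundary graph in a chart around a nearby boundary point,
  measured along the axis \<open>e\<close>. On the part \<open>A\<close> of the collar in the ball, \<open>w\<close> lies between \<open>0\<close> and
  \<open>L = (1 + \<Lambda>) * \<tau>\<close>, because \<open>w\<close> is positive inside the set, vanishes on the boundary and is
  Lipschitz continuous. Hence the translates of \<open>A\<close> by multiples of \<open>L\<close> along \<open>e\<close> are disjoint.
  About \<open>r / L\<close> of them fit into the ball of twice the radius, so that \<open>A\<close> has at most the
  fraction \<open>L / r\<close> of its volume.\<close>

lemma collar_volume_local:
  fixes \<Omega> :: "(real ^ 'n) set"
  assumes bnd: "bounded \<Omega>" and op: "open \<Omega>" and \<Lambda>: "0 < \<Lambda>"
    and chart: "\<And>z. z \<in> frontier \<Omega> \<Longrightarrow> \<exists>e \<Gamma>. norm e = 1 \<and> C11_graph \<Lambda> e \<Gamma> \<and>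
        \<Omega> \<inter> ball z \<rho> = {y \<in> ball z \<rho>. (y - z) \<bullet> e > \<Gamma> (y - z)}"
    and \<tau>: "0 < \<tau>" "\<tau> \<le> r" and r: "r \<le> \<rho> / 8"
  shows "measure lebesgue (collar \<Omega> \<tau> \<inter> ball x r)
     \<le> unit_ball_vol (real CARD('n)) * 2 ^ CARD('n) * (1 + \<Lambda>) * \<tau> * r ^ (CARD('n) - 1)"
proof (cases "collar \<Omega> \<tau> \<inter> ball x r = {}")
  case True
  then show ?thesis using \<tau> \<Lambda> by (simp add: unit_ball_vol_nonneg)
next
  case False
  define A where "A = collar \<Omega> \<tau> \<inter> ball x r"
  define L where "L = (1 + \<Lambda>) * \<tau>"
  have L: "0 < L" using \<tau> \<Lambda> by (simp add: L_def)
  have r0: "0 < r" using \<tau> by simp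
  obtain y0 where y0: "y0 \<in> \<Omega>" "bdist \<Omega> y0 < \<tau>" "dist x y0 < r" using False by (auto simp: collar_def)
  obtain z where z: "z \<in> frontier \<Omega>" "bdist \<Omega> y0 = dist y0 z" using bdist_attained[OF bnd y0(1)] .
  obtain e \<Gamma> where e: "norm e = 1" and \<Gamma>: "C11_graph \<Lambda> e \<Gamma>"
    and ch: "\<Omega> \<inter> ball z \<rho> = {y \<in> ball z \<rho>. (y - z) \<bullet> e > \<Gamma> (y - z)}"
    using chart[OF z(1)] by blast
  define w where "w y = (y - z) \<bullet> e - \<Gamma> (y - z)" for y
  have w_lip: "\<bar>w y - w y'\<bar> \<le> (1 + \<Lambda>) * dist y y'" for y y'
  proof -
    have "w y - w y' = (y - y') \<bullet> e - (\<Gamma> (y - z) - \<Gamma> (y' - z))" by (simp add: w_def inner_diff_left)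
    moreover have "\<bar>(y - y') \<bullet> e\<bar> \<le> dist y y'" using Cauchy_Schwarz_ineq2[of "y - y'" e] e by (simp add: dist_norm)
    moreover have "\<bar>\<Gamma> (y - z) - \<Gamma> (y' - z)\<bar> \<le> \<Lambda> * dist y y'"
      using C11_graph_lipschitz[OF \<Gamma>, of "y - z" "y' - z"] by (simp add: dist_norm)
    ultimately show ?thesis by (simp add: distrib_right)
  qed
  have w_cont: "continuous_on UNIV w"
  proof (rule continuous_onI)
    fix y and d :: real assume d: "0 < d"
    show "\<exists>da>0. \<forall>x'\<in>UNIV. dist x' y < da \<longrightarrow> dist (w x') (w y) \<le> d"
    proof (intro exI[of _ "d / (1 + \<Lambda>)"] conjI ballI impI)
      show "0 < d / (1 + \<Lambda>)" using d \<Lambda> by simp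
      fix x' assume "dist x' y < d / (1 + \<Lambda>)"
      then have "(1 + \<Lambda>) * dist x' y \<le> d" using \<Lambda> by (simp add: field_simps)
      then show "dist (w x') (w y) \<le> d" using w_lip[of x' y] by (simp add: dist_real_def)
    qed
  qed
  have w_shift: "w (y + c *\<^sub>R e) = w y + c" for y c
  proof -
    have "e \<bullet> e = 1" using e by (simp add: dot_square_norm)
    moreover have "\<Gamma> (y - z + c *\<^sub>R e) = \<Gamma> (y - z)" using \<Gamma> by (simp add: C11_graph_def)
    moreover have "y + c *\<^sub>R e - z = (y - z) + c *\<^sub>R e" by simp
    ultimately show ?thesis unfolding w_def by (simp only: inner_add_left inner_scaleR_left)
  qed
  have w_frontier: "w z' = 0" if z': "z' \<in> frontier \<Omega>" "z' \<in> ball z \<rho>" for z'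
  proof (rule ccontr)
    assume "w z' \<noteq> 0"
    then consider "0 < w z'" | "w z' < 0" by linarith
    then show False
    proof cases
      case 1
      then have "z' \<in> \<Omega> \<inter> ball z \<rho>" using z'(2) unfolding ch by (simp add: w_def)
      moreover have "frontier \<Omega> \<inter> \<Omega> = {}" using op by (simp add: frontier_disjoint_eq)
      ultimately show False using z'(1) by auto
    next
      case 2
      define S where "S = ball z \<rho> \<inter> {y. w y < 0}"
      have "open S" unfolding S_def using w_cont by (intro open_Int open_ball open_Collect_less) auto
      moreover have "S \<inter> \<Omega> = {}"
      proof -
        have "w y > 0" if "y \<in> \<Omega>" "y \<in> ball z \<rho>" for y
        proof -
          have "y \<in> \<Omega> \<inter> ball z \<rho>" using that by simp
          then show ?thesis unfolding ch by (simp add: w_def)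
        qed
        then show ?thesis by (force simp: S_def)
      qed
      ultimately have "S \<inter> closure \<Omega> = {}" by (simp add: open_Int_closure_eq_empty)
      then show False using z' 2 by (auto simp: S_def frontier_def)
    qed
  qed
  have wA: "0 < w y \<and> w y < L" if y: "y \<in> A" for y
  proof -
    have y': "y \<in> \<Omega>" "bdist \<Omega> y < \<tau>" "dist x y < r" using y by (auto simp: A_def collar_def)
    obtain z' where z': "z' \<in> frontier \<Omega>" "bdist \<Omega> y = dist y z'" using bdist_attained[OF bnd y'(1)] .
    \<comment> \<open>The ball meets the collar, so all relevant boundary points are within \<open>4 * r \<le> \<rho> / 2\<close> of
      the centre \<open>z\<close> of the chart.\<close>
    have d1: "dist y z < 3 * r"
      using dist_triangle[of y z x] dist_triangle[of x z y0] y' y0 z \<tau> by (simp add: dist_commute)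
    have d2: "dist z' z < 4 * r"
      using dist_triangle[of z' z y] d1 y' z' \<tau> by (simp add: dist_commute)
    have "z' \<in> ball z \<rho>" "y \<in> ball z \<rho>" using d1 d2 r r0 by (auto simp: dist_commute)
    then have "w z' = 0" "y \<in> \<Omega> \<inter> ball z \<rho>" using w_frontier z' y' by auto
    then have "0 < w y" unfolding ch by (simp add: w_def)
    moreover have "w y \<le> (1 + \<Lambda>) * dist y z'" using w_lip[of y z'] \<open>w z' = 0\<close> by simp
    moreover have "(1 + \<Lambda>) * dist y z' < L" unfolding L_def using y' z' \<Lambda> by (intro mult_strict_left_mono) auto
    ultimately show ?thesis by simp
  qed
  define N where "N = nat \<lfloor>r / L\<rfloor> + 1"
  have N: "r / L \<le> real N"
    unfolding N_def using r0 L by (simp add: le_nat_floor) linarith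
  have kL: "real k * L \<le> r" if "k < N" for k
  proof -
    have "real k \<le> r / L" using that r0 L unfolding N_def by (metis Suc_eq_plus1 divide_nonneg_pos le_nat_floor less_Suc_eq_le less_imp_le of_nat_floor of_nat_mono order_trans)
    then show ?thesis using L by (simp add: field_simps)
  qed
  define B where "B k = (\<lambda>y. (real k * L) *\<^sub>R e + y) ` A" for k
  have opA: "open A" unfolding A_def using open_collar[OF op] by auto
  have lmA: "A \<in> lmeasurable"
    using opA bounded_subset[of "ball x r" A] by (intro lmeasurable_open) (auto simp: A_def)
  have lmB: "B k \<in> lmeasurable" for k unfolding B_def using lmA by (rule measurable_translation)
  have mB: "measure lebesgue (B k) = measure lebesgue A" for k unfolding B_def by (rule measure_translation)
  have disj: "disjoint_family_on B {..<N}"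
    unfolding disjoint_family_on_def
  proof (intro ballI impI)
    fix k l :: nat assume kl: "k \<noteq> l"
    show "B k \<inter> B l = {}"
    proof (rule ccontr)
      assume "B k \<inter> B l \<noteq> {}"
      then obtain y y' where y: "y \<in> A" "y' \<in> A" "(real k * L) *\<^sub>R e + y = (real l * L) *\<^sub>R e + y'" by (auto simp: B_def)
      then have "w y + real k * L = w y' + real l * L"
        using w_shift[of y "real k * L"] w_shift[of y' "real l * L"] by (simp add: add.commute)
      then have eq: "(real k - real l) * L = w y' - w y" by (simp add: algebra_simps)
      have "\<bar>w y' - w y\<bar> < 1 * L" using wA[OF y(1)] wA[OF y(2)] by linarith
      then have "\<bar>real k - real l\<bar> * L < 1 * L" unfolding eq[symmetric] using L by (simp add: abs_mult)
      then have "\<bar>real k - real l\<bar> < 1" using L by (simp add: mult_less_cancel_right)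
      then show False using kl by linarith
    qed
  qed
  have sub: "(\<Union>k<N. B k) \<subseteq> ball x (2 * r)"
  proof
    fix u assume "u \<in> (\<Union>k<N. B k)"
    then obtain k y where k: "k < N" "y \<in> A" "u = (real k * L) *\<^sub>R e + y" by (auto simp: B_def)
    have "dist u y = real k * L" using k(3) e L by (simp add: dist_norm)
    then show "u \<in> ball x (2 * r)"
      using kL[OF k(1)] k(2) dist_triangle[of x u y] by (auto simp: A_def dist_commute)
  qed
  have "real N * measure lebesgue A = (\<Sum>k<N. measure lebesgue (B k))" by (simp add: mB)
  also have "\<dots> = measure lebesgue (\<Union>k<N. B k)"
    by (rule measure_finite_Union[symmetric])
      (use fmeasurableD[OF lmB] fmeasurableD2[OF lmB] disj in \<open>auto simp del: emeasure_completion\<close>)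
  also have "\<dots> \<le> measure lebesgue (ball x (2 * r))"
    using sub lmB by (intro measure_mono_fmeasurable) (auto intro!: fmeasurableD)
  also have "\<dots> = unit_ball_vol (real CARD('n)) * (2 * r) ^ CARD('n)"
    using r0 content_ball[of "2 * r" x] by (simp add: measure_completion)
  finally have "real N * measure lebesgue A \<le> unit_ball_vol (real CARD('n)) * (2 * r) ^ CARD('n)" .
  moreover have "r / L * measure lebesgue A \<le> real N * measure lebesgue A"
    using N by (intro mult_right_mono) auto
  ultimately have "r / L * measure lebesgue A \<le> unit_ball_vol (real CARD('n)) * (2 * r) ^ CARD('n)" by linarith
  then have "measure lebesgue A \<le> unit_ball_vol (real CARD('n)) * ((2 * r) ^ CARD('n) * (L / r))"
    using r0 L by (simp add: field_simps)
  also have "(2 * r) ^ CARD('n) * (L / r) = 2 ^ CARD('n) * L * r ^ (CARD('n) - 1)"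
  proof -
    obtain n where n: "CARD('n) = Suc n" using zero_less_card_finite by (metis gr0_conv_Suc)
    show ?thesis unfolding n using r0 by (simp add: power_mult_distrib)
  qed
  finally show ?thesis by (simp add: A_def L_def mult.assoc)
qed

text \<open>For radii beyond the scale of the charts, the collar is covered by finitely many balls on
  that scale.\<close>

lemma collar_volume:
  fixes \<Omega> :: "(real ^ 'n) set"
  assumes bnd: "bounded \<Omega>" and C11: "C11_set \<Omega>"
  obtains C \<tau>0 where "0 < C" "0 < \<tau>0"
    "\<And>x \<tau> r. 0 < \<tau> \<Longrightarrow> \<tau> \<le> \<tau>0 \<Longrightarrow> \<tau> \<le> r \<Longrightarrow>
       emeasure lborel (collar \<Omega> \<tau> \<inter> ball x r) \<le> ennreal (C * \<tau> * r ^ (CARD('n) - 1))"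
proof -
  have op: "open \<Omega>" using C11 by (simp add: C11_set_def)
  obtain \<rho> \<Lambda> where \<rho>: "0 < \<rho>" and \<Lambda>: "0 < \<Lambda>"
    and chart: "\<And>z. z \<in> frontier \<Omega> \<Longrightarrow> \<exists>e \<Gamma>. norm e = 1 \<and> C11_graph \<Lambda> e \<Gamma> \<and>
        \<Omega> \<inter> ball z \<rho> = {y \<in> ball z \<rho>. (y - z) \<bullet> e > \<Gamma> (y - z)}"
    using C11 unfolding C11_set_def by (elim conjE exE) blast
  define c where "c = unit_ball_vol (real CARD('n)) * 2 ^ CARD('n) * (1 + \<Lambda>)"
  have c: "0 < c" using \<Lambda> by (simp add: c_def unit_ball_vol_pos)
  have loc: "measure lebesgue (collar \<Omega> \<tau> \<inter> ball x r) \<le> c * \<tau> * r ^ (CARD('n) - 1)"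
    if "0 < \<tau>" "\<tau> \<le> r" "r \<le> \<rho> / 8" for \<tau> r x
    using collar_volume_local[OF bnd op \<Lambda> chart that] by (simp add: c_def)
  have "compact (closure \<Omega>)" using bnd by (simp add: compact_closure)
  then obtain K where K: "finite K" "closure \<Omega> \<subseteq> (\<Union>x\<in>K. ball x (\<rho> / 8))"
    using \<rho> unfolding compact_eq_totally_bounded by (meson divide_pos_pos zero_less_numeral)
  have lm: "collar \<Omega> \<tau> \<inter> ball x r \<in> lmeasurable" for \<tau> x r
    using bounded_subset[of "ball x r" "collar \<Omega> \<tau> \<inter> ball x r"] open_collar[OF op, of \<tau>]
    by (intro lmeasurable_open) auto
  have glob: "measure lebesgue (collar \<Omega> \<tau> \<inter> ball x r) \<le> real (card K) * c * \<tau> * r ^ (CARD('n) - 1)"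
    if \<tau>: "0 < \<tau>" "\<tau> \<le> \<rho> / 8" and r: "\<rho> / 8 \<le> r" for \<tau> r x
  proof -
    have "collar \<Omega> \<tau> \<inter> ball x r \<subseteq> (\<Union>y\<in>K. collar \<Omega> \<tau> \<inter> ball y (\<rho> / 8))"
      using K(2) closure_subset[of \<Omega>] by (fastforce simp: collar_def)
    then have "measure lebesgue (collar \<Omega> \<tau> \<inter> ball x r) \<le> measure lebesgue (\<Union>y\<in>K. collar \<Omega> \<tau> \<inter> ball y (\<rho> / 8))"
      using lm K(1) by (intro measure_mono_fmeasurable fmeasurable.finite_UN) (auto intro: fmeasurableD)
    also have "\<dots> \<le> (\<Sum>y\<in>K. measure lebesgue (collar \<Omega> \<tau> \<inter> ball y (\<rho> / 8)))"
      using K(1) lm by (intro measure_UNION_le) (auto intro: fmeasurableD)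
    also have "\<dots> \<le> (\<Sum>y\<in>K. c * \<tau> * (\<rho> / 8) ^ (CARD('n) - 1))"
      using \<tau> by (intro sum_mono loc) auto
    also have "\<dots> \<le> (\<Sum>y\<in>K. c * \<tau> * r ^ (CARD('n) - 1))"
      using \<tau> c r \<rho> by (intro sum_mono mult_left_mono power_mono) auto
    finally show ?thesis by simp
  qed
  have both: "measure lebesgue (collar \<Omega> \<tau> \<inter> ball x r) \<le> (real (card K) + 1) * c * \<tau> * r ^ (CARD('n) - 1)"
    if \<tau>: "0 < \<tau>" "\<tau> \<le> \<rho> / 8" "\<tau> \<le> r" for \<tau> r x
  proof -
    have p: "0 \<le> c * \<tau> * r ^ (CARD('n) - 1)" using \<tau> c by simp
    have q: "0 \<le> real (card K) * (c * \<tau> * r ^ (CARD('n) - 1))" using p by simp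
    show ?thesis
    proof (cases "r \<le> \<rho> / 8")
      case True
      then show ?thesis using loc[OF \<tau>(1,3) True, of x] q by (simp add: algebra_simps)
    next
      case False
      then show ?thesis using glob[OF \<tau>(1,2), of r x] p by (simp add: algebra_simps)
    qed
  qed
  show ?thesis
  proof (rule that[of "(real (card K) + 1) * c" "\<rho> / 8"])
    fix x \<tau> r assume \<tau>: "0 < \<tau>" "\<tau> \<le> \<rho> / 8" "\<tau> \<le> r"
    have b: "collar \<Omega> \<tau> \<inter> ball x r \<in> sets lborel" using open_collar[OF op, of \<tau>] by auto
    have "emeasure lborel (collar \<Omega> \<tau> \<inter> ball x r) = emeasure lebesgue (collar \<Omega> \<tau> \<inter> ball x r)"
      using b by simp
    also have "\<dots> = ennreal (measure lebesgue (collar \<Omega> \<tau> \<inter> ball x r))"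
      using lm[of \<tau> x r] by (intro emeasure_eq_measure2) (auto simp: fmeasurable_def)
    finally show "emeasure lborel (collar \<Omega> \<tau> \<inter> ball x r) \<le> ennreal ((real (card K) + 1) * c * \<tau> * r ^ (CARD('n) - 1))"
      using both[OF \<tau>, of x] by (simp add: ennreal_leI)
  qed (use c \<rho> in auto)
qed

section \<open>Jumps far from the point\<close>

lemma lborel_integral_translate:
  fixes f :: "'a::euclidean_space \<Rightarrow> real"
  assumes [measurable]: "f \<in> borel_measurable borel"
  shows "integral\<^sup>L lborel f = (LBINT z. f (c + z))" "integrable lborel f \<longleftrightarrow> integrable lborel (\<lambda>z. f (c + z))"
proof -
  have d: "lborel = distr lborel borel ((+) c)" by (rule lborel_distr_plus[symmetric])
  show "integral\<^sup>L lborel f = (LBINT z. f (c + z))"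
    by (subst d, subst integral_distr) auto
  show "integrable lborel f \<longleftrightarrow> integrable lborel (\<lambda>z. f (c + z))"
    by (subst d, subst integrable_distr_eq) auto
qed

lemma lborel_nn_integral_translate:
  fixes f :: "'a::euclidean_space \<Rightarrow> ennreal"
  assumes [measurable]: "f \<in> borel_measurable borel"
  shows "(\<integral>\<^sup>+y. f y \<partial>lborel) = (\<integral>\<^sup>+z. f (c + z) \<partial>lborel)"
proof -
  have d: "lborel = distr lborel borel ((+) c)" by (rule lborel_distr_plus[symmetric])
  show ?thesis by (subst d, subst nn_integral_distr) auto
qed

lemma lborel_distr_uminus_euclidean: "distr lborel borel uminus = (lborel :: 'a::euclidean_space measure)"
proof -
  have "(lborel :: 'a measure) = density (distr lborel borel (\<lambda>x. 0 + (- 1) *\<^sub>R x)) (\<lambda>_. ennreal (\<bar>- 1\<bar> ^ DIM('a)))"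
    by (rule lborel_affine) simp
  also have "\<dots> = distr lborel borel uminus" by (simp add: density_1)
  finally show ?thesis by (rule sym)
qed

lemma lborel_integral_odd:
  fixes f :: "'a::euclidean_space \<Rightarrow> real"
  assumes [measurable]: "f \<in> borel_measurable borel" and odd: "\<And>z. f (- z) = - f z"
  shows "integral\<^sup>L lborel f = 0"
proof -
  have "integral\<^sup>L lborel f = integral\<^sup>L (distr lborel borel uminus) f" by (simp only: lborel_distr_uminus_euclidean)
  also have "\<dots> = (LBINT z. f (- z))" by (rule integral_distr) auto
  also have "\<dots> = - integral\<^sup>L lborel f" by (simp add: odd)
  finally show ?thesis by simp
qed

context scaled_profile begin

abbreviation j :: "real ^ 'n \<Rightarrow> real" where "j z \<equiv> jump_kernel CARD('n) \<nu> (norm z)"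

lemma U_fun_eq:
  fixes \<Omega> :: "(real ^ 'n) set"
  shows "U_fun f V \<Omega> x = (if x \<in> \<Omega> then u (bdist \<Omega> x) else 0)"
  by (simp add: U_fun_def u_def)

lemma U_fun_nonneg:
  fixes \<Omega> :: "(real ^ 'n) set"
  assumes "bounded \<Omega>" "open \<Omega>" shows "0 \<le> U_fun f V \<Omega> x"
  using bdist_pos[OF assms, of x] u_pos[of "bdist \<Omega> x"] by (auto simp: U_fun_eq less_imp_le)

lemma U_fun_measurable:
  fixes \<Omega> :: "(real ^ 'n) set"
  assumes "bounded \<Omega>" "open \<Omega>" shows "U_fun f V \<Omega> \<in> borel_measurable borel"
proof -
  have cu: "continuous_on {0<..} u"
    by (intro continuous_at_imp_continuous_on ballI DERIV_isCont[OF u_has_derivative]) simp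
  have "continuous_on \<Omega> (\<lambda>x. u (bdist \<Omega> x))"
    unfolding bdist_def
    by (rule continuous_on_compose2[OF cu])
      (use bdist_pos[OF assms] in \<open>auto simp: bdist_def intro!: continuous_intros\<close>)
  then have "(\<lambda>x. indicator \<Omega> x *\<^sub>R u (bdist \<Omega> x)) \<in> borel_measurable borel"
    using assms by (intro borel_measurable_continuous_on_indicator) auto
  moreover have "(\<lambda>x. indicator \<Omega> x *\<^sub>R u (bdist \<Omega> x)) = U_fun f V \<Omega>"
    by (auto simp: fun_eq_iff U_fun_eq indicator_def)
  ultimately show ?thesis by simp
qed

text \<open>The layer-cake formula: the positive part of \<open>U y - U x\<close> is the length of the set of levels
  \<open>r\<close> with \<open>U x < r < U y\<close>.\<close>

lemma superlevel_integral:
  fixes \<Omega> :: "(real ^ 'n) set"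
  assumes bnd: "bounded \<Omega>" and op: "open \<Omega>"
  shows "(\<integral>\<^sup>+y. indicator (- ball x a) y * (ennreal (U_fun f V \<Omega> y - U_fun f V \<Omega> x) * ennreal (j (y - x))) \<partial>lborel)
    = (\<integral>\<^sup>+r. indicator {U_fun f V \<Omega> x<..} r *
        (\<integral>\<^sup>+y. indicator ({y. r < U_fun f V \<Omega> y} - ball x a) y * ennreal (j (y - x)) \<partial>lborel) \<partial>lborel)"
proof -
  define U where "U = U_fun f V \<Omega>"
  have [measurable]: "U \<in> borel_measurable borel" unfolding U_def by (rule U_fun_measurable[OF bnd op])
  have [measurable]: "ball x a \<in> sets borel" by simp
  have pt: "ennreal (U y - U x) = (\<integral>\<^sup>+r. indicator {U x<..} r * indicator {r. r < U y} r \<partial>lborel)" for y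
  proof -
    have "(\<integral>\<^sup>+r. indicator {U x<..} r * indicator {r. r < U y} r \<partial>lborel) = (\<integral>\<^sup>+r. indicator {U x<..<U y} r \<partial>lborel)"
      by (intro nn_integral_cong) (auto simp: indicator_def)
    also have "\<dots> = emeasure lborel {U x<..<U y}" by simp
    also have "\<dots> = ennreal (U y - U x)" by (cases "U x \<le> U y") (auto simp: ennreal_neg)
    finally show ?thesis by simp
  qed
  define H where "H y r = indicator (- ball x a) y * (indicator {U x<..} r * indicator {p. snd p < U (fst p)} (y, r) * ennreal (j (y - x)))" for y r
  have Hm: "case_prod H \<in> borel_measurable (lborel \<Otimes>\<^sub>M lborel)"
    unfolding H_def by measurable
  have "(\<integral>\<^sup>+y. indicator (- ball x a) y * (ennreal (U y - U x) * ennreal (j (y - x))) \<partial>lborel) = (\<integral>\<^sup>+y. \<integral>\<^sup>+r. H y r \<partial>lborel \<partial>lborel)"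
  proof (intro nn_integral_cong)
    fix y
    have "(\<integral>\<^sup>+r. H y r \<partial>lborel) = (\<integral>\<^sup>+r. (indicator (- ball x a) y * ennreal (j (y - x))) * (indicator {U x<..} r * indicator {r. r < U y} r) \<partial>lborel)"
      by (intro nn_integral_cong) (auto simp: H_def indicator_def)
    also have "\<dots> = (indicator (- ball x a) y * ennreal (j (y - x))) * ennreal (U y - U x)"
      unfolding pt by (rule nn_integral_cmult) measurable
    finally show "indicator (- ball x a) y * (ennreal (U y - U x) * ennreal (j (y - x))) = (\<integral>\<^sup>+r. H y r \<partial>lborel)"
      by (simp add: mult_ac)
  qed
  also have "\<dots> = (\<integral>\<^sup>+r. \<integral>\<^sup>+y. H y r \<partial>lborel \<partial>lborel)" by (rule lborel_pair.Fubini'[symmetric, OF Hm])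
  also have "\<dots> = (\<integral>\<^sup>+r. indicator {U x<..} r *
        (\<integral>\<^sup>+y. indicator ({y. r < U y} - ball x a) y * ennreal (j (y - x)) \<partial>lborel) \<partial>lborel)"
  proof (intro nn_integral_cong)
    fix r
    have "(\<integral>\<^sup>+y. H y r \<partial>lborel) = (\<integral>\<^sup>+y. indicator {U x<..} r * (indicator ({y. r < U y} - ball x a) y * ennreal (j (y - x))) \<partial>lborel)"
      by (intro nn_integral_cong) (auto simp: H_def indicator_def)
    also have "\<dots> = indicator {U x<..} r * (\<integral>\<^sup>+y. indicator ({y. r < U y} - ball x a) y * ennreal (j (y - x)) \<partial>lborel)"
      by (rule nn_integral_cmult) measurable
    finally show "(\<integral>\<^sup>+y. H y r \<partial>lborel) = indicator {U x<..} r * (\<integral>\<^sup>+y. indicator ({y. r < U y} - ball x a) y * ennreal (j (y - x)) \<partial>lborel)" .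
  qed
  finally show ?thesis by (simp only: U_def)
qed

lemma phi_quadratic: "0 < t \<Longrightarrow> \<phi> (1 / (t / 3)\<^sup>2) \<le> 9 * \<phi> (1 / t\<^sup>2)"
  using phi_mult_le[of 9 "1 / t\<^sup>2"] by (simp add: power_divide)

text \<open>A level \<open>r > u t\<close> is \<open>u \<tau>\<close> for some \<open>\<tau> < t\<close>, and \<open>{U > r}\<close> is the collar of width \<open>\<tau>\<close>. Its
  jump mass outside the ball is at most a multiple of \<open>\<phi> (1 / t\<^sup>2) * \<tau> / t\<close> by \<open>jump_kernel_far\<close>,
  and \<open>\<tau>\<close> is at most a multiple of the integrand in the hypothesis at \<open>r\<close>. The hypothesis at \<open>u t\<close>
  bounds the integral over the levels by a multiple of \<open>u t * t\<close>.\<close>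

lemma far_estimate:
  fixes \<Omega> :: "(real ^ 'n) set"
  assumes bnd: "bounded \<Omega>" and C11: "C11_set \<Omega>" and R: "0 < R" and C1: "0 < C\<^sub>1"
    and integrable: "\<And>r. r \<ge> R \<Longrightarrow>
          set_integrable lborel {r<..} (\<lambda>t. 1 / sqrt (phi_inv \<phi> (1 / (varphi f t)\<^sup>2)))"
    and bound: "\<And>r. r \<ge> R \<Longrightarrow>
          (LBINT t:{r<..}. 1 / sqrt (phi_inv \<phi> (1 / (varphi f t)\<^sup>2)))
            \<le> C\<^sub>1 * (r / sqrt (phi_inv \<phi> (1 / (varphi f r)\<^sup>2)))"
  obtains C t0 where "0 < C" "0 < t0"
    "\<And>x t. x \<in> \<Omega> \<Longrightarrow> bdist \<Omega> x = t \<Longrightarrow> t \<le> t0 \<Longrightarrow>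
      (\<integral>\<^sup>+y. indicator (- ball x (t / 3)) y * (ennreal (U_fun f V \<Omega> y - U_fun f V \<Omega> x) * ennreal (j (y - x))) \<partial>lborel)
        \<le> ennreal (C * (u t * \<phi> (1 / t\<^sup>2)))"
proof -
  define d where "d = CARD('n)"
  have op: "open \<Omega>" using C11 by (simp add: C11_set_def)
  define E where "E r = 1 / sqrt (phi_inv \<phi> (1 / (varphi f r)\<^sup>2))" for r
  obtain Cv \<tau>0 where Cv: "0 < Cv" "0 < \<tau>0"
    "\<And>x \<tau> r. 0 < \<tau> \<Longrightarrow> \<tau> \<le> \<tau>0 \<Longrightarrow> \<tau> \<le> r \<Longrightarrow>
       emeasure lborel (collar \<Omega> \<tau> \<inter> ball x r) \<le> ennreal (Cv * \<tau> * r ^ (CARD('n) - 1))"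
    by (rule collar_volume[OF bnd C11]) (rule that; assumption)
  obtain A t1 where A: "0 < A" "0 < t1"
    "\<And>t. 0 < t \<Longrightarrow> t \<le> t1 \<Longrightarrow> t \<le> A * (1 / sqrt (phi_inv \<phi> (1 / (varphi f (u t))\<^sup>2)))"
    "\<And>t. 0 < t \<Longrightarrow> t \<le> t1 \<Longrightarrow> 1 / sqrt (phi_inv \<phi> (1 / (varphi f (u t))\<^sup>2)) \<le> A * t"
    by (rule inverse_profile_comparable) (rule that; assumption)
  note A = A[folded E_def]
  obtain t2 where t2: "0 < t2" "u t2 = R" using u_surj[OF R] .
  \<comment> \<open>The bound \<open>t \<le> t2\<close> puts \<open>u t\<close> into the range \<open>r \<ge> R\<close> of the hypothesis.\<close>
  define t0 where "t0 = min \<tau>0 (min t1 t2)"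
  have t0: "0 < t0" "t0 \<le> \<tau>0" "t0 \<le> t1" "t0 \<le> t2" using Cv A t2 by (auto simp: t0_def)
  define K where "K = kernel_const d * 9 * (2 ^ d * (Cv * 3 ^ (d - 1)) * 3)"
  have K: "0 < K" using kernel_const_pos[of d] Cv by (simp add: K_def)
  define C where "C = K * A * C\<^sub>1 * A"
  have C: "0 < C" using K A C1 by (simp add: C_def)
  have main: "(\<integral>\<^sup>+y. indicator (- ball x (t / 3)) y * (ennreal (U_fun f V \<Omega> y - U_fun f V \<Omega> x) * ennreal (j (y - x))) \<partial>lborel)
        \<le> ennreal (C * (u t * \<phi> (1 / t\<^sup>2)))"
    if x: "x \<in> \<Omega>" and tx: "bdist \<Omega> x = t" and tt: "t \<le> t0" for x t
  proof -
    have t: "0 < t" using bdist_pos[OF bnd op x] tx by simp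
    have Ux: "U_fun f V \<Omega> x = u t" using x tx by (simp add: U_fun_eq)
    have p: "0 < \<phi> (1 / t\<^sup>2)" using t by (intro phi_pos) simp
    define k where "k = K * \<phi> (1 / t\<^sup>2) / t * A"
    have k: "0 \<le> k" using K p t A by (simp add: k_def)
    have E0: "0 \<le> E r" if "u t < r" for r
    proof -
      have r0: "0 < r" using that u_pos[OF t] by linarith
      obtain \<tau> where \<tau>: "0 < \<tau>" "u \<tau> = r" using u_surj[OF r0] .
      have "\<tau> < t" using \<tau> that u_antimono[OF t, of \<tau>] by (cases "\<tau> < t") auto
      then have "0 < A * E r" using A(3)[of \<tau>] \<tau> tt t0 by auto
      then show ?thesis using A(1) by (simp add: zero_less_mult_iff)
    qed
    have inner: "(\<integral>\<^sup>+y. indicator ({y. r < U_fun f V \<Omega> y} - ball x (t / 3)) y * ennreal (j (y - x)) \<partial>lborel) \<le> ennreal (k * E r)"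
      if r: "u t < r" for r
    proof -
      have r0: "0 < r" using r u_pos[OF t] by linarith
      obtain \<tau> where \<tau>: "0 < \<tau>" "u \<tau> = r" using u_surj[OF r0] .
      have \<tau>t: "\<tau> < t" using \<tau> r u_antimono[OF t, of \<tau>] by (cases "\<tau> < t") auto
      have sub: "{y. r < U_fun f V \<Omega> y} = collar \<Omega> \<tau>"
      proof (rule set_eqI)
        fix y
        show "y \<in> {y. r < U_fun f V \<Omega> y} \<longleftrightarrow> y \<in> collar \<Omega> \<tau>"
        proof (cases "y \<in> \<Omega>")
          case True
          have b: "0 < bdist \<Omega> y" by (rule bdist_pos[OF bnd op True])
          have "u \<tau> < u (bdist \<Omega> y) \<longleftrightarrow> bdist \<Omega> y < \<tau>"
            using u_strict_antimono[OF b, of \<tau>] u_antimono[OF \<tau>(1), of "bdist \<Omega> y"] by force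
          then show ?thesis using True \<tau> by (simp add: U_fun_eq collar_def)
        next
          case False
          then show ?thesis using r u_pos[OF t] by (simp add: U_fun_eq collar_def)
        qed
      qed
      have "(\<integral>\<^sup>+y. indicator (collar \<Omega> \<tau> - ball x (t / 3)) y * ennreal (j (y - x)) \<partial>lborel)
         \<le> ennreal (kernel_const d * \<phi> (1 / (t / 3)\<^sup>2) * (2 ^ d * (Cv * \<tau> * 3 ^ (d - 1)) / (t / 3)))"
        unfolding d_def
      proof (rule jump_kernel_far)
        show "collar \<Omega> \<tau> \<in> sets borel" using open_collar[OF op] by auto
        fix \<rho> assume \<rho>: "t / 3 \<le> \<rho>"
        \<comment> \<open>The volume bound requires a radius of at least \<open>\<tau>\<close>, and \<open>\<tau> < t \<le> 3 * \<rho>\<close>.\<close>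
        have "emeasure lborel (collar \<Omega> \<tau> \<inter> ball x \<rho>) \<le> emeasure lborel (collar \<Omega> \<tau> \<inter> ball x (3 * \<rho>))"
          using open_collar[OF op, of \<tau>] \<rho> t by (intro emeasure_mono) auto
        also have "\<dots> \<le> ennreal (Cv * \<tau> * (3 * \<rho>) ^ (CARD('n) - 1))"
          using \<tau> \<tau>t tt t0 \<rho> by (intro Cv(3)) auto
        finally show "emeasure lborel (collar \<Omega> \<tau> \<inter> ball x \<rho>) \<le> ennreal (Cv * \<tau> * 3 ^ (CARD('n) - 1) * \<rho> ^ (CARD('n) - 1))"
          by (simp add: power_mult_distrib mult_ac)
      qed (use t \<tau> Cv in auto)
      also have "\<dots> \<le> ennreal (k * E r)"
      proof (rule ennreal_leI)
        have "kernel_const d * \<phi> (1 / (t / 3)\<^sup>2) * (2 ^ d * (Cv * \<tau> * 3 ^ (d - 1)) / (t / 3))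
           \<le> kernel_const d * (9 * \<phi> (1 / t\<^sup>2)) * (2 ^ d * (Cv * \<tau> * 3 ^ (d - 1)) / (t / 3))"
          using phi_quadratic[OF t] kernel_const_pos[of d] t \<tau> Cv by (intro mult_right_mono mult_left_mono) auto
        also have "\<dots> = K * \<phi> (1 / t\<^sup>2) / t * \<tau>" by (simp add: K_def)
        also have "\<dots> \<le> K * \<phi> (1 / t\<^sup>2) / t * (A * E r)"
          using A(3)[of \<tau>] \<tau> \<tau>t tt t0 K p t by (intro mult_left_mono) auto
        finally show "kernel_const d * \<phi> (1 / (t / 3)\<^sup>2) * (2 ^ d * (Cv * \<tau> * 3 ^ (d - 1)) / (t / 3)) \<le> k * E r"
          by (simp add: k_def mult.assoc)
      qed
      finally show ?thesis unfolding sub .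
    qed
    have uR: "R \<le> u t" using u_antimono[OF t, of t2] tt t0 t2 by simp
    have Ei: "set_integrable lborel {u t<..} E" using integrable[OF uR] unfolding E_def[abs_def] .
    have "(\<integral>\<^sup>+y. indicator (- ball x (t / 3)) y * (ennreal (U_fun f V \<Omega> y - U_fun f V \<Omega> x) * ennreal (j (y - x))) \<partial>lborel)
       = (\<integral>\<^sup>+r. indicator {u t<..} r *
        (\<integral>\<^sup>+y. indicator ({y. r < U_fun f V \<Omega> y} - ball x (t / 3)) y * ennreal (j (y - x)) \<partial>lborel) \<partial>lborel)"
      using superlevel_integral[OF bnd op, of x "t / 3"] unfolding Ux by simp
    also have "\<dots> \<le> (\<integral>\<^sup>+r. ennreal (k * (indicator {u t<..} r *\<^sub>R E r)) \<partial>lborel)"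
    proof (intro nn_integral_mono)
      fix r
      show "indicator {u t<..} r * (\<integral>\<^sup>+y. indicator ({y. r < U_fun f V \<Omega> y} - ball x (t / 3)) y * ennreal (j (y - x)) \<partial>lborel)
        \<le> ennreal (k * (indicator {u t<..} r *\<^sub>R E r))"
        using inner[of r] by (cases "u t < r") auto
    qed
    also have "\<dots> = ennreal (LBINT r. k * (indicator {u t<..} r *\<^sub>R E r))"
    proof (rule nn_integral_eq_integral)
      show "integrable lborel (\<lambda>r. k * (indicator {u t<..} r *\<^sub>R E r))"
        using Ei unfolding set_integrable_def by (rule integrable_mult_right)
      show "AE r in lborel. 0 \<le> k * (indicator {u t<..} r *\<^sub>R E r)"
        using k E0 by (intro AE_I2) (auto simp: indicator_def)
    qed
    also have "(LBINT r. k * (indicator {u t<..} r *\<^sub>R E r)) = k * (LBINT r:{u t<..}. E r)"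
      by (simp add: set_lebesgue_integral_def)
    also have "ennreal (k * (LBINT r:{u t<..}. E r)) \<le> ennreal (C * (u t * \<phi> (1 / t\<^sup>2)))"
    proof (rule ennreal_leI)
      have "(LBINT r:{u t<..}. E r) \<le> C\<^sub>1 * (u t * E (u t))"
        using bound[OF uR] unfolding E_def by simp
      also have "\<dots> \<le> C\<^sub>1 * (u t * (A * t))"
        using A(4)[OF t] tt t0 C1 u_pos[OF t] by (intro mult_left_mono) auto
      finally have "k * (LBINT r:{u t<..}. E r) \<le> k * (C\<^sub>1 * (u t * (A * t)))" using k by (intro mult_left_mono) auto
      also have "\<dots> = C * (u t * \<phi> (1 / t\<^sup>2))" using t by (simp add: k_def C_def)
      finally show "k * (LBINT r:{u t<..}. E r) \<le> C * (u t * \<phi> (1 / t\<^sup>2))" .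
    qed
    finally show ?thesis .
  qed
  show ?thesis by (rule that[OF C t0(1) main])
qed

section \<open>Jumps near the point\<close>

text \<open>The gradient of \<open>U\<close> is \<open>u' (\<delta> y)\<close> times the gradient of \<open>\<delta>\<close>. Within distance \<open>t / 3\<close> of \<open>x\<close>
  the first factor is Hoelder continuous by \<open>du_hoelder\<close>, as \<open>\<delta>\<close> stays between \<open>2 * t / 3\<close> and
  \<open>4 * t / 3\<close>; the second is bounded and Lipschitz continuous, and for \<open>t \<le> 1\<close> a Lipschitz bound
  is a Hoelder bound on the scale \<open>t\<close>.\<close>

lemma near_expansion:
  fixes \<Omega> :: "(real ^ 'n) set"
  assumes bnd: "bounded \<Omega>" and op: "open \<Omega>" and C11: "C11_on (collar \<Omega> \<eta>\<^sub>0) (bdist \<Omega>)"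
    and b: "0 < b" "b < 1"
  obtains C where "0 < C" "\<And>x t. x \<in> \<Omega> \<Longrightarrow> bdist \<Omega> x = t \<Longrightarrow> t \<le> 1 \<Longrightarrow> 2 * t < \<eta>\<^sub>0 \<Longrightarrow>
     \<exists>g. \<forall>z. norm z < t / 3 \<longrightarrow> \<bar>U_fun f V \<Omega> (x + z) - U_fun f V \<Omega> x - z \<bullet> g\<bar> \<le> C * (u t / t) * (norm z * (norm z / t) powr b)"
proof -
  define S where "S = collar \<Omega> \<eta>\<^sub>0"
  obtain G \<Lambda> where G: "\<And>x. x \<in> S \<Longrightarrow> GDERIV (bdist \<Omega>) x :> G x" and \<Lambda>: "\<Lambda>-lipschitz_on S G"
    using C11 by (auto simp: C11_on_def S_def)
  have bS: "bounded S" using bnd by (rule bounded_subset) (auto simp: S_def collar_def)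
  have "bounded (G ` S)"
    by (rule bounded_uniformly_continuous_image[OF lipschitz_on_uniformly_continuous[OF \<Lambda>] bS])
  then obtain B where B: "0 < B" "\<And>y. y \<in> S \<Longrightarrow> norm (G y) \<le> B" unfolding bounded_pos by auto
  have \<Lambda>0: "0 \<le> \<Lambda>" using \<Lambda> by (simp add: lipschitz_on_def)
  obtain Cd where Cd: "0 < Cd" "\<And>t s s'. 0 < t \<Longrightarrow> 2 * t / 3 \<le> s \<Longrightarrow> s \<le> s' \<Longrightarrow> s' \<le> 4 * t / 3 \<Longrightarrow>
     \<bar>du s' - du s\<bar> \<le> Cd * (u t / t) * ((s' - s) / t) powr b"
    by (rule du_hoelder[OF b]) (rule that; assumption)
  define C where "C = B * Cd + 96 / m * \<Lambda>"
  have C: "0 < C" using B Cd m \<Lambda>0 by (auto simp: C_def intro!: add_pos_nonneg)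
  have main: "\<bar>U_fun f V \<Omega> (x + z) - U_fun f V \<Omega> x - z \<bullet> (du t *\<^sub>R G x)\<bar> \<le> C * (u t / t) * (norm z * (norm z / t) powr b)"
    if x: "x \<in> \<Omega>" and tx: "bdist \<Omega> x = t" and t1: "t \<le> 1" and t2: "2 * t < \<eta>\<^sub>0" and z: "norm z < t / 3" for x t z
  proof -
    have t: "0 < t" using bdist_pos[OF bnd op x] tx by simp
    have xS: "x \<in> S" using x tx t t2 by (simp add: S_def collar_def)
    define g where "g = du t *\<^sub>R G x"
    define r where "r = (norm z / t) powr b"
    define U where "U = U_fun f V \<Omega>"
    have ut: "0 < u t / t" using u_pos[OF t] t by simp
    have "norm ((U (x + z) - (x + z) \<bullet> g) - (U x - x \<bullet> g)) \<le> C * (u t / t) * r * norm ((x + z) - x)"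
    proof (rule differentiable_bound[where S="cball x (norm z)" and f'="\<lambda>y h. h \<bullet> (du (bdist \<Omega> y) *\<^sub>R G y - g)"])
      fix y assume "y \<in> cball x (norm z)"
      then have y: "dist x y \<le> norm z" by simp
      have y\<Omega>: "y \<in> \<Omega>" by (rule ball_bdist_subset[OF x]) (use y z tx t in linarith)
      define s where "s = bdist \<Omega> y"
      have st: "\<bar>s - t\<bar> \<le> dist x y" using bdist_lipschitz[of \<Omega> x y] tx by (simp add: s_def abs_minus_commute)
      have s: "2 * t / 3 \<le> s" "s \<le> 4 * t / 3" "0 < s" using st y z t by (auto simp: abs_le_iff)
      have yS: "y \<in> S" using y\<Omega> s t t2 by (simp add: S_def collar_def s_def[symmetric])
      have bd: "(bdist \<Omega> has_derivative (\<lambda>h. h \<bullet> G y)) (at y)" using G[OF yS] by (simp add: gderiv_def)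
      have "(u has_derivative (*) (du s)) (at (bdist \<Omega> y))"
        using u_has_derivative[OF s(3)] by (simp add: has_field_derivative_def s_def)
      from has_derivative_compose[OF bd this]
      have "((\<lambda>y. u (bdist \<Omega> y)) has_derivative (\<lambda>h. du s * (h \<bullet> G y))) (at y)" .
      then have "(U has_derivative (\<lambda>h. du s * (h \<bullet> G y))) (at y)"
        by (rule has_derivative_transform_within_open[OF _ op y\<Omega>]) (simp add: U_def U_fun_eq)
      then have "((\<lambda>y. U y - y \<bullet> g) has_derivative (\<lambda>h. du s * (h \<bullet> G y) - h \<bullet> g)) (at y)"
        by (intro has_derivative_diff has_derivative_inner_left has_derivative_ident)
      moreover have "(\<lambda>h. h \<bullet> (du (bdist \<Omega> y) *\<^sub>R G y - g)) = (\<lambda>h. du s * (h \<bullet> G y) - h \<bullet> g)"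
        unfolding s_def[symmetric] by (simp only: inner_diff_right inner_scaleR_right)
      ultimately show "((\<lambda>y. U y - y \<bullet> g) has_derivative (\<lambda>h. h \<bullet> (du (bdist \<Omega> y) *\<^sub>R G y - g))) (at y within cball x (norm z))"
        by (simp only: has_derivative_at_withinI)
      have "norm (du s *\<^sub>R G y - g) \<le> C * (u t / t) * r"
      proof -
        have eq: "du s *\<^sub>R G y - g = (du s - du t) *\<^sub>R G y + du t *\<^sub>R (G y - G x)"
          by (simp add: g_def algebra_simps)
        have h: "\<bar>s - t\<bar> \<le> norm z" using st y by linarith
        have "\<bar>du s - du t\<bar> \<le> Cd * (u t / t) * (\<bar>s - t\<bar> / t) powr b"
          using Cd(2)[of t t s] Cd(2)[of t s t] s t by (cases "t \<le> s") (auto simp: abs_minus_commute)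
        also have "\<dots> \<le> Cd * (u t / t) * r"
          unfolding r_def using h t b mult_pos_pos[OF Cd(1) ut] by (intro mult_left_mono powr_mono2 divide_right_mono) auto
        finally have 1: "\<bar>du s - du t\<bar> \<le> Cd * (u t / t) * r" .
        have "norm (G y - G x) \<le> \<Lambda> * dist y x" using lipschitz_onD[OF \<Lambda> yS xS] by (simp add: dist_norm)
        also have "\<dots> \<le> \<Lambda> * norm z" using y \<Lambda>0 by (intro mult_left_mono) (auto simp: dist_commute)
        also have "\<dots> \<le> \<Lambda> * r"
        proof (intro mult_left_mono \<Lambda>0)
          have "norm z * t \<le> norm z * 1" using t1 by (intro mult_left_mono) auto
          then have "norm z \<le> norm z / t" using t by (simp add: pos_le_divide_eq)
          also have "norm z / t = (norm z / t) powr 1" using t by simp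
          also have "\<dots> \<le> r" unfolding r_def using z t b by (intro powr_mono') auto
          finally show "norm z \<le> r" .
        qed
        finally have 2: "norm (G y - G x) \<le> \<Lambda> * r" .
        have "norm (du s *\<^sub>R G y - g) \<le> \<bar>du s - du t\<bar> * norm (G y) + \<bar>du t\<bar> * norm (G y - G x)"
          unfolding eq by (rule order_trans[OF norm_triangle_ineq]) simp
        also have "\<dots> \<le> (Cd * (u t / t) * r) * B + (96 / m * (u t / t)) * (\<Lambda> * r)"
          using 1 2 B(2)[OF yS] du_bound[OF t] ut m Cd(1) \<Lambda>0
          by (intro add_mono mult_mono) (auto simp: r_def)
        also have "\<dots> = C * (u t / t) * r" by (simp add: C_def algebra_simps)
        finally show ?thesis .
      qed
      then have bn: "norm (du (bdist \<Omega> y) *\<^sub>R G y - g) \<le> C * (u t / t) * r" by (simp add: s_def)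
      show "onorm (\<lambda>h. h \<bullet> (du (bdist \<Omega> y) *\<^sub>R G y - g)) \<le> C * (u t / t) * r"
      proof (rule onorm_bound)
        show "0 \<le> C * (u t / t) * r" unfolding r_def using C ut by (intro mult_nonneg_nonneg powr_ge_zero) linarith+
        fix h :: "real ^ 'n"
        show "norm (h \<bullet> (du (bdist \<Omega> y) *\<^sub>R G y - g)) \<le> C * (u t / t) * r * norm h"
          using Cauchy_Schwarz_ineq2[of h "du (bdist \<Omega> y) *\<^sub>R G y - g"] mult_left_mono[OF bn, of "norm h"]
          by (simp add: mult.commute)
      qed
    qed (auto simp: dist_norm)
    moreover have "(U (x + z) - (x + z) \<bullet> g) - (U x - x \<bullet> g) = U (x + z) - U x - z \<bullet> g"
      by (simp add: inner_add_left)
    ultimately show ?thesis by (simp add: U_def g_def r_def mult_ac)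
  qed
  show ?thesis by (rule that[OF C]) (use main in blast)
qed

text \<open>Subtracting the odd function \<open>z \<bullet> g\<close> on the ball of radius \<open>t / 3\<close> does not change any
  truncated integral and leaves an absolutely integrable function. The principal value is
  therefore the integral of that function, by dominated convergence. It is estimated by the
  remainder of the expansion on the ball and by the positive part of the increment outside.\<close>

lemma principal_value_bound:
  fixes \<Omega> :: "(real ^ 'n) set"
  assumes bnd: "bounded \<Omega>" and op: "open \<Omega>" and x: "x \<in> \<Omega>" and tx: "bdist \<Omega> x = t"
    and N: "0 \<le> N" and g: "\<And>z. norm z < t / 3 \<Longrightarrow> \<bar>U_fun f V \<Omega> (x + z) - U_fun f V \<Omega> x - z \<bullet> g\<bar> \<le> N * norm z powr (1 + b)"
    and near: "(\<integral>\<^sup>+z. indicator (ball 0 (t / 3) - {0}) z * ennreal (norm z powr (1 + b) * j z) \<partial>(lborel :: (real ^ 'n) measure)) \<le> ennreal CA"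
    and far: "(\<integral>\<^sup>+y. indicator (- ball x (t / 3)) y * (ennreal (U_fun f V \<Omega> y - U_fun f V \<Omega> x) * ennreal (j (y - x))) \<partial>lborel) \<le> ennreal CB"
    and C0: "0 \<le> CA" "0 \<le> CB"
  shows "L_defined_at \<nu> (U_fun f V \<Omega>) x" "L_op \<nu> (U_fun f V \<Omega>) x \<le> N * CA + CB"
proof -
  define U where "U = U_fun f V \<Omega>"
  have Um [measurable]: "U \<in> borel_measurable borel" unfolding U_def by (rule U_fun_measurable[OF bnd op])
  have t: "0 < t" using bdist_pos[OF bnd op x] tx by simp
  have U0: "0 \<le> U y" for y unfolding U_def by (rule U_fun_nonneg[OF bnd op])
  have j0: "0 \<le> j z" for z :: "real ^ 'n" by (rule jump_kernel_nonneg)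
  have [measurable]: "ball (0 :: real ^ 'n) (t / 3) \<in> sets borel" by simp
  \<comment> \<open>The odd linear part, and the integrand without it.\<close>
  define c where "c z = indicator (ball 0 (t / 3)) z * (z \<bullet> g)" for z
  have cm [measurable]: "c \<in> borel_measurable borel" unfolding c_def[abs_def] by measurable
  define k where "k z = (U (x + z) - U x - c z) * j z" for z
  have km [measurable]: "k \<in> borel_measurable borel" unfolding k_def[abs_def] by measurable
  \<comment> \<open>Majorants: the expansion near the origin, the positive part outside, and the negative part
    outside, which is at most \<open>U x\<close> because \<open>U\<close> is nonnegative. The last has to be integrable
    only; the radius \<open>t / 4\<close> lets its open region contain the sphere of radius \<open>t / 3\<close>.\<close>
  define n1 where "n1 z = ennreal N * (indicator (ball 0 (t / 3) - {0}) z * ennreal (norm z powr (1 + b) * j z))" for z :: "real ^ 'n"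
  define n2 where "n2 z = indicator (- ball 0 (t / 3)) z * (ennreal (U (x + z) - U x) * ennreal (j z))" for z
  define n3 where "n3 z = ennreal (U x) * (indicator {z. t / 4 < norm z} z * ennreal (j z))" for z :: "real ^ 'n"
  have nm [measurable]: "n1 \<in> borel_measurable borel" "n2 \<in> borel_measurable borel" "n3 \<in> borel_measurable borel"
    unfolding n1_def[abs_def] n2_def[abs_def] n3_def[abs_def] by measurable
  have pt: "ennreal (k z) \<le> n1 z + n2 z" "ennreal \<bar>k z\<bar> \<le> n1 z + n2 z + n3 z" for z
  proof -
    consider "z = 0" | "z \<noteq> 0" "norm z < t / 3" | "t / 3 \<le> norm z" by linarith
    then have "ennreal (k z) \<le> n1 z + n2 z \<and> ennreal \<bar>k z\<bar> \<le> n1 z + n2 z + n3 z"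
    proof cases
      case 1 then show ?thesis by (simp add: k_def c_def)
    next
      case 2
      have "\<bar>U (x + z) - U x - c z\<bar> \<le> N * norm z powr (1 + b)" using g[OF 2(2)] 2 by (simp add: c_def U_def)
      then have "\<bar>U (x + z) - U x - c z\<bar> * j z \<le> N * norm z powr (1 + b) * j z" using j0 by (intro mult_right_mono) auto
      then have "\<bar>k z\<bar> \<le> N * (norm z powr (1 + b) * j z)" using j0[of z] by (simp add: k_def abs_mult mult.assoc)
      then have "ennreal \<bar>k z\<bar> \<le> ennreal (N * (norm z powr (1 + b) * j z))" by (rule ennreal_leI)
      also have "\<dots> = n1 z" using 2 N j0[of z] by (simp add: n1_def ennreal_mult)
      finally have a: "ennreal \<bar>k z\<bar> \<le> n1 z" .
      have "ennreal (k z) \<le> ennreal \<bar>k z\<bar>" by (intro ennreal_leI) simp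
      then show ?thesis using a by (meson add_increasing2 order_trans zero_le)
    next
      case 3
      have c0: "c z = 0" using 3 by (simp add: c_def)
      have n2: "n2 z = ennreal ((U (x + z) - U x) * j z)"
        using 3 j0[of z] by (simp add: n2_def ennreal_mult'')
      have n3: "n3 z = ennreal (U x * j z)" using 3 t j0[of z] U0[of x] by (simp add: n3_def ennreal_mult)
      have kz: "k z = (U (x + z) - U x) * j z" by (simp add: k_def c0)
      have "ennreal (k z) \<le> n1 z + n2 z" unfolding kz n2 by (simp add: add_increasing)
      moreover have "ennreal \<bar>k z\<bar> \<le> n2 z + n3 z"
      proof (cases "U x \<le> U (x + z)")
        case True
        then have "\<bar>k z\<bar> = (U (x + z) - U x) * j z" using j0[of z] by (simp add: kz abs_mult)
        then show ?thesis unfolding n2 by (simp add: add_increasing2)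
      next
        case False
        then have "\<bar>k z\<bar> = (U x - U (x + z)) * j z" using j0[of z] by (simp add: kz abs_mult)
        also have "\<dots> \<le> U x * j z" using U0[of "x + z"] j0[of z] by (intro mult_right_mono) auto
        finally show ?thesis unfolding n3 by (simp add: add_increasing ennreal_leI)
      qed
      then have "ennreal \<bar>k z\<bar> \<le> n1 z + n2 z + n3 z" by (simp add: add.assoc add_increasing)
      ultimately show ?thesis by blast
    qed
    then show "ennreal (k z) \<le> n1 z + n2 z" "ennreal \<bar>k z\<bar> \<le> n1 z + n2 z + n3 z" by auto
  qed
  have I1: "(\<integral>\<^sup>+z. n1 z \<partial>lborel) \<le> ennreal (N * CA)"
  proof -
    have "(\<integral>\<^sup>+z. n1 z \<partial>lborel) = ennreal N * (\<integral>\<^sup>+z. indicator (ball 0 (t / 3) - {0}) z * ennreal (norm z powr (1 + b) * j z) \<partial>(lborel :: (real ^ 'n) measure))"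
      unfolding n1_def by (intro nn_integral_cmult) measurable
    also have "\<dots> \<le> ennreal N * ennreal CA" using near by (rule mult_left_mono) simp
    finally show ?thesis using N C0 by (simp add: ennreal_mult)
  qed
  have I2: "(\<integral>\<^sup>+z. n2 z \<partial>lborel) \<le> ennreal CB"
  proof -
    have [measurable]: "ball x (t / 3) \<in> sets borel" by simp
    have "(\<integral>\<^sup>+y. indicator (- ball x (t / 3)) y * (ennreal (U y - U x) * ennreal (j (y - x))) \<partial>lborel)
       = (\<integral>\<^sup>+z. indicator (- ball x (t / 3)) (x + z) * (ennreal (U (x + z) - U x) * ennreal (j (x + z - x))) \<partial>lborel)"
      by (rule lborel_nn_integral_translate) measurable
    also have "\<dots> = (\<integral>\<^sup>+z. n2 z \<partial>lborel)"
      by (intro nn_integral_cong) (auto simp: n2_def indicator_def dist_norm)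
    finally show ?thesis using far by (simp add: U_def)
  qed
  have I3: "(\<integral>\<^sup>+z. n3 z \<partial>lborel) < \<infinity>"
  proof -
    have "(\<integral>\<^sup>+z. n3 z \<partial>lborel) = ennreal (U x) * (\<integral>\<^sup>+z. indicator {z. t / 4 < norm z} z * ennreal (j z) \<partial>(lborel :: (real ^ 'n) measure))"
      unfolding n3_def by (intro nn_integral_cmult) measurable
    also have "\<dots> < \<infinity>" using jump_kernel_tail[of "t / 4", where 'n='n] t by (simp add: ennreal_mult_less_top)
    finally show ?thesis .
  qed
  have ki: "integrable lborel k"
  proof (rule integrableI_bounded)
    have "(\<integral>\<^sup>+z. ennreal (norm (k z)) \<partial>lborel) \<le> (\<integral>\<^sup>+z. n1 z + n2 z + n3 z \<partial>lborel)"
      using pt(2) by (intro nn_integral_mono) simp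
    also have "\<dots> = (\<integral>\<^sup>+z. n1 z \<partial>lborel) + (\<integral>\<^sup>+z. n2 z \<partial>lborel) + (\<integral>\<^sup>+z. n3 z \<partial>lborel)"
      by (simp add: nn_integral_add)
    also have "\<dots> < \<infinity>" using I1 I2 I3 by (auto simp: ennreal_add_less_top intro: le_less_trans)
    finally show "(\<integral>\<^sup>+z. ennreal (norm (k z)) \<partial>lborel) < \<infinity>" .
  qed simp
  have kb: "integral\<^sup>L lborel k \<le> N * CA + CB"
  proof -
    have "(\<integral>\<^sup>+z. ennreal (k z) \<partial>lborel) \<le> (\<integral>\<^sup>+z. n1 z + n2 z \<partial>lborel)"
      using pt(1) by (intro nn_integral_mono) simp
    also have "\<dots> = (\<integral>\<^sup>+z. n1 z \<partial>lborel) + (\<integral>\<^sup>+z. n2 z \<partial>lborel)" by (rule nn_integral_add) auto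
    also have "\<dots> \<le> ennreal (N * CA) + ennreal CB" using I1 I2 by (rule add_mono)
    also have "\<dots> = ennreal (N * CA + CB)" using N C0 by simp
    finally have "enn2real (\<integral>\<^sup>+z. ennreal (k z) \<partial>lborel) \<le> N * CA + CB"
      using N C0 by (intro enn2real_leI) auto
    moreover have "integral\<^sup>L lborel k \<le> enn2real (\<integral>\<^sup>+z. ennreal (k z) \<partial>lborel)"
      unfolding real_lebesgue_integral_def[OF ki] by simp
    ultimately show ?thesis by linarith
  qed
  \<comment> \<open>The truncated integrand, translated to the origin, splits into \<open>a\<close> and the odd part \<open>o1\<close>.\<close>
  define a where "a \<epsilon> z = indicator {z. \<epsilon> < norm z} z * k z" for \<epsilon> z
  define o1 where "o1 \<epsilon> z = indicator {z. \<epsilon> < norm z} z * (c z * j z)" for \<epsilon> z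
  have am [measurable]: "a \<epsilon> \<in> borel_measurable borel" "o1 \<epsilon> \<in> borel_measurable borel" for \<epsilon>
    unfolding a_def[abs_def] o1_def[abs_def] by measurable
  have ai: "integrable lborel (a \<epsilon>)" for \<epsilon>
    by (rule Bochner_Integration.integrable_bound[OF ki]) (auto simp: a_def indicator_def)
  have oi: "integrable lborel (o1 \<epsilon>)" if e: "0 < \<epsilon>" for \<epsilon>
  proof (rule integrableI_bounded)
    have "(\<integral>\<^sup>+z. ennreal (norm (o1 \<epsilon> z)) \<partial>lborel) \<le> (\<integral>\<^sup>+z. ennreal (t / 3 * norm g) * (indicator {z. \<epsilon> < norm z} z * ennreal (j z)) \<partial>(lborel :: (real ^ 'n) measure))"
    proof (intro nn_integral_mono)
      fix z :: "real ^ 'n"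
      have "\<bar>c z\<bar> \<le> t / 3 * norm g"
      proof (cases "norm z < t / 3")
        case True
        have "\<bar>z \<bullet> g\<bar> \<le> norm z * norm g" by (rule Cauchy_Schwarz_ineq2)
        also have "\<dots> \<le> t / 3 * norm g" using True by (intro mult_right_mono) auto
        finally show ?thesis using True by (simp add: c_def)
      qed (use t in \<open>simp add: c_def\<close>)
      then have "\<bar>c z\<bar> * j z \<le> t / 3 * norm g * j z" using j0 by (intro mult_right_mono) auto
      then have "ennreal (\<bar>c z\<bar> * j z) \<le> ennreal (t / 3 * norm g) * ennreal (j z)"
        using t j0[of z] by (subst ennreal_mult[symmetric]) (auto intro: ennreal_leI)
      then show "ennreal (norm (o1 \<epsilon> z)) \<le> ennreal (t / 3 * norm g) * (indicator {z. \<epsilon> < norm z} z * ennreal (j z))"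
        using j0[of z] by (cases "\<epsilon> < norm z") (auto simp: o1_def abs_mult)
    qed
    also have "\<dots> = ennreal (t / 3 * norm g) * (\<integral>\<^sup>+z. indicator {z. \<epsilon> < norm z} z * ennreal (j z) \<partial>(lborel :: (real ^ 'n) measure))"
      by (intro nn_integral_cmult) measurable
    also have "\<dots> < \<infinity>" using jump_kernel_tail[OF e, where 'n='n] by (simp add: ennreal_mult_less_top)
    finally show "(\<integral>\<^sup>+z. ennreal (norm (o1 \<epsilon> z)) \<partial>lborel) < \<infinity>" .
  qed simp
  have o0: "integral\<^sup>L lborel (o1 \<epsilon>) = 0" for \<epsilon>
    by (rule lborel_integral_odd) (auto simp: o1_def c_def indicator_def)
  define T where "T \<epsilon> y = indicator {y. norm (y - x) > \<epsilon>} y *\<^sub>R L_integrand \<nu> U x y" for \<epsilon> y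
  have Tm [measurable]: "T \<epsilon> \<in> borel_measurable borel" for \<epsilon>
    unfolding T_def[abs_def] L_integrand_def by measurable
  have Tz: "T \<epsilon> (x + z) = a \<epsilon> z + o1 \<epsilon> z" for \<epsilon> z
    by (simp add: T_def a_def o1_def k_def L_integrand_def indicator_def algebra_simps)
  have Ti: "integrable lborel (T \<epsilon>)" "integral\<^sup>L lborel (T \<epsilon>) = integral\<^sup>L lborel (a \<epsilon>)" if e: "0 < \<epsilon>" for \<epsilon>
  proof -
    show "integrable lborel (T \<epsilon>)"
      using lborel_integral_translate(2)[OF Tm, of \<epsilon> x] ai oi[OF e] by (simp add: Tz)
    show "integral\<^sup>L lborel (T \<epsilon>) = integral\<^sup>L lborel (a \<epsilon>)"
      using lborel_integral_translate(1)[OF Tm, of \<epsilon> x] Bochner_Integration.integral_add[OF ai oi[OF e], of \<epsilon>] by (simp add: Tz o0)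
  qed
  have trunc: "L_truncated \<nu> U x \<epsilon> = integral\<^sup>L lborel (a \<epsilon>)" if "0 < \<epsilon>" for \<epsilon>
    using Ti(2)[OF that] by (simp add: L_truncated_def set_lebesgue_integral_def T_def[abs_def])
  have lim: "(L_truncated \<nu> U x \<longlongrightarrow> integral\<^sup>L lborel k) (at_right 0)"
    unfolding tendsto_at_iff_sequentially
  proof (intro allI impI)
    fix X :: "nat \<Rightarrow> real" assume X: "\<forall>i. X i \<in> {0<..} - {0}" "X \<longlonglongrightarrow> 0"
    have "(\<lambda>i. integral\<^sup>L lborel (a (X i))) \<longlonglongrightarrow> integral\<^sup>L lborel k"
    proof (rule integral_dominated_convergence[where w="\<lambda>z. norm (k z)"])
      show "AE z in lborel. (\<lambda>i. a (X i) z) \<longlonglongrightarrow> k z"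
      proof (intro AE_I2)
        fix z
        show "(\<lambda>i. a (X i) z) \<longlonglongrightarrow> k z"
        proof (cases "z = 0")
          case True then show ?thesis by (simp add: a_def k_def c_def)
        next
          case False
          have "eventually (\<lambda>i. X i < norm z) sequentially" using X(2) False by (intro order_tendstoD) auto
          then have "eventually (\<lambda>i. a (X i) z = k z) sequentially" by eventually_elim (simp add: a_def)
          then show ?thesis by (rule tendsto_eventually)
        qed
      qed
      show "AE z in lborel. norm (a (X i) z) \<le> norm (k z)" for i by (intro AE_I2) (auto simp: a_def indicator_def)
    qed (use ki in auto)
    moreover have "(L_truncated \<nu> U x \<circ> X) = (\<lambda>i. integral\<^sup>L lborel (a (X i)))"
      using X(1) trunc by (auto simp: fun_eq_iff)
    ultimately show "(L_truncated \<nu> U x \<circ> X) \<longlonglongrightarrow> integral\<^sup>L lborel k" by simp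
  qed
  show "L_defined_at \<nu> (U_fun f V \<Omega>) x"
    unfolding L_defined_at_def U_def[symmetric]
  proof (intro conjI allI impI)
    fix \<epsilon> :: real assume "0 < \<epsilon>"
    then show "set_integrable lborel {y. \<epsilon> < norm (y - x)} (L_integrand \<nu> U x)"
      using Ti(1)[of \<epsilon>] by (simp add: set_integrable_def T_def[abs_def])
  qed (use lim in blast)
  have "L_op \<nu> U x = integral\<^sup>L lborel k"
    unfolding L_op_def by (rule tendsto_Lim[OF _ lim]) simp
  then show "L_op \<nu> (U_fun f V \<Omega>) x \<le> N * CA + CB" using kb by (simp add: U_def)
qed

section \<open>The supersolution estimate\<close>

lemma supersolution_estimate:
  fixes \<Omega> :: "(real ^ 'n) set"
  assumes bnd: "bounded \<Omega>" and C11: "C11_set \<Omega>"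
    and \<eta>0: "0 < \<eta>\<^sub>0" "C11_on (collar \<Omega> \<eta>\<^sub>0) (bdist \<Omega>)"
    and R: "0 < R" and C1: "0 < C\<^sub>1"
    and integrable: "\<And>r. r \<ge> R \<Longrightarrow>
          set_integrable lborel {r<..} (\<lambda>t. 1 / sqrt (phi_inv \<phi> (1 / (varphi f t)\<^sup>2)))"
    and bound: "\<And>r. r \<ge> R \<Longrightarrow>
          (LBINT t:{r<..}. 1 / sqrt (phi_inv \<phi> (1 / (varphi f t)\<^sup>2)))
            \<le> C\<^sub>1 * (r / sqrt (phi_inv \<phi> (1 / (varphi f r)\<^sup>2)))"
  shows "\<exists>\<eta>\<^sub>1 C\<^sub>2. 0 < \<eta>\<^sub>1 \<and> \<eta>\<^sub>1 < \<eta>\<^sub>0 \<and> C\<^sub>2 > 0 \<and>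
           (\<forall>x\<in>collar \<Omega> \<eta>\<^sub>1. L_defined_at \<nu> (U_fun f V \<Omega>) x \<and>
              L_op \<nu> (U_fun f V \<Omega>) x \<le> C\<^sub>2 * f (U_fun f V \<Omega> x))"
proof -
  have op: "open \<Omega>" using C11 by (simp add: C11_set_def)
  \<comment> \<open>An exponent below \<open>1\<close> with \<open>2 * \<delta>2 < 1 + b\<close>, which holds because \<open>\<delta>2 < 1\<close>.\<close>
  define b where "b = \<delta>2"
  have b: "0 < b" "b < 1" "2 * \<delta>2 < 1 + b" using scaling_consts by (auto simp: b_def)
  obtain Cn where Cn: "0 < Cn" "\<And>x t. x \<in> \<Omega> \<Longrightarrow> bdist \<Omega> x = t \<Longrightarrow> t \<le> 1 \<Longrightarrow> 2 * t < \<eta>\<^sub>0 \<Longrightarrow>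
     \<exists>g. \<forall>z. norm z < t / 3 \<longrightarrow> \<bar>U_fun f V \<Omega> (x + z) - U_fun f V \<Omega> x - z \<bullet> g\<bar> \<le> Cn * (u t / t) * (norm z * (norm z / t) powr b)"
    by (rule near_expansion[OF bnd op \<eta>0(2) b(1,2)]) (rule that; assumption)
  obtain Ck where Ck: "0 < Ck" "\<And>t. 0 < t \<Longrightarrow> t \<le> 1 \<Longrightarrow>
    (\<integral>\<^sup>+z. indicator (ball 0 t - {0}) z * ennreal (norm z powr (1 + b) * j z) \<partial>(lborel :: (real ^ 'n) measure))
      \<le> ennreal (Ck * t powr (1 + b) * \<phi> (1 / t\<^sup>2))"
    by (rule jump_kernel_near[OF b(3), where 'n='n]) (rule that; assumption)
  obtain Cf t0 where Cf: "0 < Cf" "0 < t0"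
    "\<And>x t. x \<in> \<Omega> \<Longrightarrow> bdist \<Omega> x = t \<Longrightarrow> t \<le> t0 \<Longrightarrow>
      (\<integral>\<^sup>+y. indicator (- ball x (t / 3)) y * (ennreal (U_fun f V \<Omega> y - U_fun f V \<Omega> x) * ennreal (j (y - x))) \<partial>lborel)
        \<le> ennreal (Cf * (u t * \<phi> (1 / t\<^sup>2)))"
    by (rule far_estimate[OF bnd C11 R C1 integrable bound]) (assumption | rule that; assumption)+
  obtain cf where cf: "0 < cf" "\<And>t. 0 < t \<Longrightarrow> cf * (u t * \<phi> (1 / t\<^sup>2)) \<le> f (u t)"
    by (rule f_lower) (rule that; assumption)
  define \<eta> where "\<eta> = min (\<eta>\<^sub>0 / 2) (min 1 t0)"
  define K where "K = Cn * Ck * 9 + Cf"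
  have K: "0 < K" using Cn Ck Cf by (simp add: K_def add_pos_pos)
  have "L_defined_at \<nu> (U_fun f V \<Omega>) x \<and> L_op \<nu> (U_fun f V \<Omega>) x \<le> K / cf * f (U_fun f V \<Omega> x)"
    if xc: "x \<in> collar \<Omega> \<eta>" for x
  proof -
    define t where "t = bdist \<Omega> x"
    have x: "x \<in> \<Omega>" and t1: "t < \<eta>" using xc by (auto simp: collar_def t_def)
    have t: "0 < t" using bdist_pos[OF bnd op x] by (simp add: t_def)
    have ts: "t \<le> 1" "2 * t < \<eta>\<^sub>0" "t \<le> t0" "t / 3 \<le> 1" using t1 by (auto simp: \<eta>_def)
    have tx: "bdist \<Omega> x = t" by (simp add: t_def)
    have p: "0 < \<phi> (1 / t\<^sup>2)" using t by (intro phi_pos) simp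
    have u0: "0 < u t" by (rule u_pos[OF t])
    obtain g where g: "\<And>z. norm z < t / 3 \<Longrightarrow> \<bar>U_fun f V \<Omega> (x + z) - U_fun f V \<Omega> x - z \<bullet> g\<bar> \<le> Cn * (u t / t) * (norm z * (norm z / t) powr b)"
      using Cn(2)[OF x tx ts(1,2)] by blast
    define N where "N = Cn * (u t / t) / t powr b"
    have N: "0 \<le> N" using Cn u0 t by (simp add: N_def)
    have gN: "\<bar>U_fun f V \<Omega> (x + z) - U_fun f V \<Omega> x - z \<bullet> g\<bar> \<le> N * norm z powr (1 + b)" if "norm z < t / 3" for z
    proof -
      have "norm z * (norm z / t) powr b = norm z powr (1 + b) / t powr b"
        using t by (cases "z = 0") (auto simp: powr_divide powr_add)
      then show ?thesis using g[OF that] by (simp add: N_def)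
    qed
    define CA where "CA = Ck * t powr (1 + b) * (9 * \<phi> (1 / t\<^sup>2))"
    have CA0: "0 \<le> CA" using Ck p by (simp add: CA_def)
    have "Ck * (t / 3) powr (1 + b) * \<phi> (1 / (t / 3)\<^sup>2) \<le> CA"
      unfolding CA_def using Ck t b phi_quadratic[OF t] phi_nonneg[of "1 / (t / 3)\<^sup>2"]
      by (intro mult_mono mult_left_mono powr_mono2) auto
    then have near: "(\<integral>\<^sup>+z. indicator (ball 0 (t / 3) - {0}) z * ennreal (norm z powr (1 + b) * j z) \<partial>(lborel :: (real ^ 'n) measure)) \<le> ennreal CA"
      using Ck(2)[of "t / 3"] t ts by (intro order_trans[OF Ck(2)[of "t / 3"]] ennreal_leI) auto
    have CB0: "0 \<le> Cf * (u t * \<phi> (1 / t\<^sup>2))" using Cf u0 p by simp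
    note pv = principal_value_bound[OF bnd op x tx N gN near Cf(3)[OF x tx ts(3)] CA0 CB0]
    have "N * CA = Cn * Ck * 9 * (u t * \<phi> (1 / t\<^sup>2))"
    proof -
      have "t powr (1 + b) = t * t powr b" using t by (simp add: powr_add)
      then show ?thesis using t by (simp add: N_def CA_def)
    qed
    then have "N * CA + Cf * (u t * \<phi> (1 / t\<^sup>2)) = K * (u t * \<phi> (1 / t\<^sup>2))" by (simp add: K_def algebra_simps)
    also have "\<dots> \<le> K * (f (u t) / cf)"
      using cf(2)[OF t] cf(1) K by (intro mult_left_mono) (auto simp: pos_le_divide_eq mult.commute)
    also have "\<dots> = K / cf * f (U_fun f V \<Omega> x)" using x by (simp add: U_fun_eq tx)
    finally show ?thesis using pv by linarith
  qed
  moreover have "0 < \<eta>" "\<eta> < \<eta>\<^sub>0" using \<eta>0 Cf by (auto simp: \<eta>_def)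
  moreover have "0 < K / cf" using K cf by simp
  ultimately show ?thesis by blast
qed

end

theorem proposition3p2:
  fixes \<Omega> :: "(real ^ 'n) set"
    and \<phi> \<nu> V f :: "real \<Rightarrow> real"
    and \<eta>\<^sub>0 R C\<^sub>1 :: real
  assumes dim: "CARD('n) \<ge> 2"
    and \<Omega>: "bounded \<Omega>" "C11_set \<Omega>"
    and \<phi>: "complete_bernstein \<phi> \<nu>" "scaling_condition \<phi>"
    and V: "renewal_function \<phi> V"
    and f: "nonlinearity f" "\<And>t. t > 0 \<Longrightarrow> primitive f t > 0"
    and \<eta>0: "\<eta>\<^sub>0 > 0" "C11_on (collar \<Omega> \<eta>\<^sub>0) (bdist \<Omega>)"
    and R: "R > 0" and C1: "C\<^sub>1 > 0"
    and integrable: "\<And>r. r \<ge> R \<Longrightarrow>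
          set_integrable lborel {r<..} (\<lambda>t. 1 / sqrt (phi_inv \<phi> (1 / (varphi f t)\<^sup>2)))"
    and bound: "\<And>r. r \<ge> R \<Longrightarrow>
          (LBINT t:{r<..}. 1 / sqrt (phi_inv \<phi> (1 / (varphi f t)\<^sup>2)))
            \<le> C\<^sub>1 * (r / sqrt (phi_inv \<phi> (1 / (varphi f r)\<^sup>2)))"
  shows "\<exists>\<eta>\<^sub>1 C\<^sub>2. 0 < \<eta>\<^sub>1 \<and> \<eta>\<^sub>1 < \<eta>\<^sub>0 \<and> C\<^sub>2 > 0 \<and>
           (\<forall>x\<in>collar \<Omega> \<eta>\<^sub>1. L_defined_at \<nu> (U_fun f V \<Omega>) x \<and>
              L_op \<nu> (U_fun f V \<Omega>) x \<le> C\<^sub>2 * f (U_fun f V \<Omega> x))"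
proof -
  have levy: "levy_density \<nu>" and phi_eq: "\<And>x. 0 \<le> x \<Longrightarrow> \<phi> x = (LBINT s:{0<..}. (1 - exp (- x * s)) * \<nu> s)"
    using \<phi>(1) by (auto simp: complete_bernstein_def)
  obtain a1 a2 \<delta>1 \<delta>2 where sc: "0 < a1" "0 < a2" "0 < \<delta>1" "\<delta>1 \<le> \<delta>2" "\<delta>2 < 1"
    and sc2: "\<And>c t. 1 \<le> c \<Longrightarrow> 1 \<le> t \<Longrightarrow> a1 * c powr \<delta>1 \<le> \<phi> (c * t) / \<phi> t \<and> \<phi> (c * t) / \<phi> t \<le> a2 * c powr \<delta>2"
    using \<phi>(2) unfolding scaling_condition_def by blast
  have phi_nonneg: "0 \<le> \<phi> x" if "0 \<le> x" for x
    using levy that unfolding phi_eq[OF that] set_lebesgue_integral_def levy_density_def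
    by (intro Bochner_Integration.integral_nonneg) (auto simp: indicator_def)
  \<comment> \<open>A zero of \<open>\<phi>\<close> would make the quotient in the scaling condition \<open>0\<close>, below \<open>a1\<close>.\<close>
  have phi_pos: "0 < \<phi> t" if "1 \<le> t" for t
  proof -
    have "0 < a1 * 1 powr \<delta>1" using sc by simp
    then have "0 < \<phi> (1 * t) / \<phi> t" using sc2[of 1 t] that by linarith
    then show ?thesis using phi_nonneg[of t] that by (cases "\<phi> t = 0") auto
  qed
  obtain m M where m: "0 < m" "m \<le> M" "\<And>t. (1 + m) * f t \<le> t * deriv f t" "\<And>t. t * deriv f t \<le> (1 + M) * f t"
    using f(1) unfolding nonlinearity_def by blast
  interpret scaled_profile \<phi> \<nu> V f m M a1 a2 \<delta>1 \<delta>2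
  proof unfold_locales
    show "levy_density \<nu>" by (rule levy)
    show "\<phi> x = (LBINT s:{0<..}. (1 - exp (- x * s)) * \<nu> s)" if "0 \<le> x" for x by (rule phi_eq[OF that])
    show "0 < \<phi> 1" by (rule phi_pos) simp
    show "renewal_function \<phi> V" by (rule V)
    show "a1 * c powr \<delta>1 * \<phi> t \<le> \<phi> (c * t)" "\<phi> (c * t) \<le> a2 * c powr \<delta>2 * \<phi> t" if "1 \<le> c" "1 \<le> t" for c t
      using sc2[OF that] phi_pos[OF that(2)] by (auto simp: pos_le_divide_eq pos_divide_le_eq)
  qed (use f m sc in \<open>auto simp: nonlinearity_def\<close>)
  show ?thesis
    by (rule supersolution_estimate[OF \<Omega> \<eta>0 R C1 integrable bound])
qed

end
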